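(* Let $\Delta\in\{\mathbb D_{2m},\mathbb E_7,\mathbb E_8,\mathbb L_n\}$ with $m,n\ge2$, and let $P(\Delta)$ and $P^*(\Delta)$ be the associated algebras over an algebraically closed field $K$. Then $P^*(\Delta)\cong P(\Delta)$ if and only if $K$ is not of characteristic $2$.
   Context: Paths in a quiver are composed from left to right: for arrows $\alpha: i\to j$ and $\beta: j\to k$, $\alpha\beta$ is the path $i\to j\to k$. Quivers: for $\mathbb D_n$, vertices $0,\dots,n-1$ and arrows $a_0:0\to2$, $\bar a_0:2\to0$, $a_1:1\to2$, $\bar a_1:2\to1$, $a_i:i\to i+1$, $\bar a_i:i+1\to i$ ($2\le i\le n-2$); for $\mathbb E_n$, vertices $0,\dots,n-1$ and arrows $a_0:0\to3$, $\bar a_0:3\to0$, $a_i:i\to i+1$, $\bar a_i:i+1\to i$ ($1\le i\le n-2$); for $\mathbb L_n$, vertices $0,\dots,n-1$, arrows $a_i:i\to i+1$, $\bar a_i:i+1\to i$ ($0\le i\le n-2$) and a loop $\varepsilon$ at vertex $0$, with $\bar\varepsilon:=\varepsilon$. Put $\bar{\bar a}=a$. The preprojective algebra is $P(\Delta)=KQ_\Delta/I_\Delta$, where $I_\Delta$ is generated by $\sum_{a\text{ starting at }v}a\bar a$ for all vertices $v$ (e.g. $\varepsilon^2+a_0\bar a_0$ at vertex $0$ of $\mathbb L_n$). The algebra $P^*(\Delta)=KQ_\Delta/I^*_\Delta$, where $I^*_\Delta$ is generated by $\sum_{a\text{ starting at }v}a\bar a$ for all vertices $v$ other than the exceptional vertex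 ($2$ for $\mathbb D_{2m}$, $3$ for $\mathbb E_n$, $0$ for $\mathbb L_n$) together with: $\bar a_0a_0+\bar a_1a_1+a_2\bar a_2+(\bar a_0a_0\bar a_1a_1)^{m-1}$ and $(\bar a_0a_0+\bar a_1a_1)^{2m-2}$ for $\Delta=\mathbb D_{2m}$; $\bar a_0a_0+\bar a_2a_2+a_3\bar a_3+(\bar a_0a_0\bar a_2a_2)^{3n-17}$ and $(\bar a_0a_0+\bar a_2a_2)^{n-3}$ for $\Delta=\mathbb E_n$, $n\in\{7,8\}$; $\varepsilon^2+a_0\bar a_0+\varepsilon^{2n-1}$ and $\varepsilon^{2n}$ for $\Delta=\mathbb L_n$. *)

theory Defs
  imports "HOL-Computational_Algebra.Polynomial"
begin

text \<open>The Dynkin-type quiver; the argument is the number of vertices n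
 (so D_{2m} is Dq (2*m)).\<close>
datatype dyn = Dq nat | Eq nat | Lq nat

text \<open>Arrows: Ar i is a_i, Br i is the barred arrow of a_i, Ep is the loop epsilon.\<close>
datatype arr = Ar nat | Br nat | Ep

fun nverts :: "dyn \<Rightarrow> nat" where
  "nverts (Dq n) = n" | "nverts (Eq n) = n" | "nverts (Lq n) = n"

fun is_L :: "dyn \<Rightarrow> bool" where
  "is_L (Lq n) = True" | "is_L _ = False"

definition arrows :: "dyn \<Rightarrow> arr set" where
  "arrows D = {Ar i | i. i + 2 \<le> nverts D} \<union> {Br i | i. i + 2 \<le> nverts D}
              \<union> (if is_L D then {Ep} else {})"

fun srcA :: "dyn \<Rightarrow> nat \<Rightarrow> nat" where
  "srcA D i = i"

fun tgtA :: "dyn \<Rightarrow> nat \<Rightarrow> nat" where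
  "tgtA (Dq n) i = (if i \<le> 1 then 2 else i + 1)"
| "tgtA (Eq n) i = (if i = 0 then 3 else i + 1)"
| "tgtA (Lq n) i = i + 1"

fun src :: "dyn \<Rightarrow> arr \<Rightarrow> nat" where
  "src D (Ar i) = srcA D i" | "src D (Br i) = tgtA D i" | "src D Ep = 0"

fun tgt :: "dyn \<Rightarrow> arr \<Rightarrow> nat" where
  "tgt D (Ar i) = tgtA D i" | "tgt D (Br i) = srcA D i" | "tgt D Ep = 0"

fun bar :: "arr \<Rightarrow> arr" where
  "bar (Ar i) = Br i" | "bar (Br i) = Ar i" | "bar Ep = Ep"

text \<open>A path is a start vertex together with the list of its arrows, composed left to right.\<close>
type_synonym path = "nat \<times> arr list"

fun chain :: "dyn \<Rightarrow> nat \<Rightarrow> arr list \<Rightarrow> bool" where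
  "chain D v [] = True"
| "chain D v (a # as) = (a \<in> arrows D \<and> src D a = v \<and> chain D (tgt D a) as)"

fun pend :: "dyn \<Rightarrow> nat \<Rightarrow> arr list \<Rightarrow> nat" where
  "pend D v [] = v"
| "pend D v (a # as) = pend D (tgt D a) as"

definition valid_path :: "dyn \<Rightarrow> path \<Rightarrow> bool" where
  "valid_path D p = (fst p < nverts D \<and> chain D (fst p) (snd p))"

definition elem :: "dyn \<Rightarrow> (path \<Rightarrow> 'k::field) \<Rightarrow> bool" where
  "elem D f = (finite {p. f p \<noteq> 0} \<and> (\<forall>p. f p \<noteq> 0 \<longrightarrow> valid_path D p))"

definition padd :: "(path \<Rightarrow> 'k::field) \<Rightarrow> (path \<Rightarrow> 'k) \<Rightarrow> path \<Rightarrow> 'k" where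
  "padd f g = (\<lambda>p. f p + g p)"

definition psmult :: "'k::field \<Rightarrow> (path \<Rightarrow> 'k) \<Rightarrow> path \<Rightarrow> 'k" where
  "psmult c f = (\<lambda>p. c * f p)"

definition pzero :: "path \<Rightarrow> 'k::field" where
  "pzero = (\<lambda>p. 0)"

text \<open>Multiplication = concatenation of paths, extended bilinearly.\<close>
definition pmult :: "dyn \<Rightarrow> (path \<Rightarrow> 'k::field) \<Rightarrow> (path \<Rightarrow> 'k) \<Rightarrow> path \<Rightarrow> 'k" where
  "pmult D f g = (\<lambda>(v, as). \<Sum>i\<in>{0..length as}.
       f (v, take i as) * g (pend D v (take i as), drop i as))"

definition pone :: "dyn \<Rightarrow> path \<Rightarrow> 'k::field" where
  "pone D = (\<lambda>(v, as). if as = [] \<and> v < nverts D then 1 else 0)"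

fun ppow :: "dyn \<Rightarrow> (path \<Rightarrow> 'k::field) \<Rightarrow> nat \<Rightarrow> path \<Rightarrow> 'k" where
  "ppow D f 0 = pone D"
| "ppow D f (Suc k) = pmult D f (ppow D f k)"

definition arrow_el :: "dyn \<Rightarrow> arr \<Rightarrow> path \<Rightarrow> 'k::field" where
  "arrow_el D a = (\<lambda>p. if p = (src D a, [a]) then 1 else 0)"

inductive_set ideal_gen :: "dyn \<Rightarrow> (path \<Rightarrow> 'k::field) set \<Rightarrow> (path \<Rightarrow> 'k) set"
  for D S where
  gen: "s \<in> S \<Longrightarrow> s \<in> ideal_gen D S"
| zero: "pzero \<in> ideal_gen D S"
| add: "x \<in> ideal_gen D S \<Longrightarrow> y \<in> ideal_gen D S \<Longrightarrow> padd x y \<in> ideal_gen D S"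
| lmult: "elem D a \<Longrightarrow> x \<in> ideal_gen D S \<Longrightarrow> pmult D a x \<in> ideal_gen D S"
| rmult: "elem D a \<Longrightarrow> x \<in> ideal_gen D S \<Longrightarrow> pmult D x a \<in> ideal_gen D S"

definition mesh_rel :: "dyn \<Rightarrow> nat \<Rightarrow> path \<Rightarrow> 'k::field" where
  "mesh_rel D v = (\<lambda>p. \<Sum>a\<in>{a \<in> arrows D. src D a = v}.
                       pmult D (arrow_el D a) (arrow_el D (bar a)) p)"

fun exc_vertex :: "dyn \<Rightarrow> nat" where
  "exc_vertex (Dq n) = 2" | "exc_vertex (Eq n) = 3" | "exc_vertex (Lq n) = 0"

definition I_rels :: "dyn \<Rightarrow> (path \<Rightarrow> 'k::field) set" where
  "I_rels D = {mesh_rel D v | v. v < nverts D}"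

fun extra_rels :: "dyn \<Rightarrow> (path \<Rightarrow> 'k::field) set" where
  "extra_rels (Dq n) =
     (let m = n div 2;
          x = pmult (Dq n) (arrow_el (Dq n) (Br 0)) (arrow_el (Dq n) (Ar 0));
          y = pmult (Dq n) (arrow_el (Dq n) (Br 1)) (arrow_el (Dq n) (Ar 1));
          z = pmult (Dq n) (arrow_el (Dq n) (Ar 2)) (arrow_el (Dq n) (Br 2))
      in {padd (padd (padd x y) z) (ppow (Dq n) (pmult (Dq n) x y) (m - 1)),
          ppow (Dq n) (padd x y) (2 * m - 2)})"
| "extra_rels (Eq n) =
     (let x = pmult (Eq n) (arrow_el (Eq n) (Br 0)) (arrow_el (Eq n) (Ar 0));
          y = pmult (Eq n) (arrow_el (Eq n) (Br 2)) (arrow_el (Eq n) (Ar 2));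
          z = pmult (Eq n) (arrow_el (Eq n) (Ar 3)) (arrow_el (Eq n) (Br 3))
      in {padd (padd (padd x y) z) (ppow (Eq n) (pmult (Eq n) x y) (3 * n - 17)),
          ppow (Eq n) (padd x y) (n - 3)})"
| "extra_rels (Lq n) =
     (let e = arrow_el (Lq n) Ep;
          z = pmult (Lq n) (arrow_el (Lq n) (Ar 0)) (arrow_el (Lq n) (Br 0))
      in {padd (padd (pmult (Lq n) e e) z) (ppow (Lq n) e (2 * n - 1)),
          ppow (Lq n) e (2 * n)})"

definition Istar_rels :: "dyn \<Rightarrow> (path \<Rightarrow> 'k::field) set" where
  "Istar_rels D = {mesh_rel D v | v. v < nverts D \<and> v \<noteq> exc_vertex D} \<union> extra_rels D"

definition I_ideal :: "dyn \<Rightarrow> (path \<Rightarrow> 'k::field) set" where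
  "I_ideal D = ideal_gen D (I_rels D)"

definition Istar_ideal :: "dyn \<Rightarrow> (path \<Rightarrow> 'k::field) set" where
  "Istar_ideal D = ideal_gen D (Istar_rels D)"

definition coset :: "(path \<Rightarrow> 'k::field) set \<Rightarrow> (path \<Rightarrow> 'k) \<Rightarrow> (path \<Rightarrow> 'k) set" where
  "coset J x = {padd x i | i. i \<in> J}"

definition quot_carrier :: "dyn \<Rightarrow> (path \<Rightarrow> 'k::field) set \<Rightarrow> (path \<Rightarrow> 'k) set set" where
  "quot_carrier D J = {coset J x | x. elem D x}"

definition quot_alg_iso :: "dyn \<Rightarrow> (path \<Rightarrow> 'k::field) set \<Rightarrow> (path \<Rightarrow> 'k) set \<Rightarrow> bool" where
  "quot_alg_iso D J1 J2 =
     (\<exists>\<phi>. bij_betw \<phi> (quot_carrier D J1) (quot_carrier D J2)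
        \<and> \<phi> (coset J1 (pone D)) = coset J2 (pone D)
        \<and> (\<forall>x y x' y'. elem D x \<longrightarrow> elem D y \<longrightarrow> elem D x' \<longrightarrow> elem D y' \<longrightarrow>
              \<phi> (coset J1 x) = coset J2 x' \<longrightarrow> \<phi> (coset J1 y) = coset J2 y' \<longrightarrow>
              \<phi> (coset J1 (padd x y)) = coset J2 (padd x' y')
            \<and> \<phi> (coset J1 (pmult D x y)) = coset J2 (pmult D x' y')
            \<and> (\<forall>c. \<phi> (coset J1 (psmult c x)) = coset J2 (psmult c x'))))"

end

theory Submission imports Defs "HOL-Library.Function_Algebras" begin

text \<open>
  Let \<open>J \<delta>\<close> be the ideal obtained from the relations of \<open>P*\<close> by multiplying the deformation term \<open>f\<close>
  at the exceptional vertex by a scalar \<open>\<delta>\<close>; then \<open>P = KQ / J 0\<close> and \<open>P* = KQ / J 1\<close>.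

  In types D and E write \<open>x, y\<close> for the cycles at the exceptional vertex through \<open>0\<close> and through the other short arm,
  \<open>f = (xy)^q\<close> and \<open>w = y(xy)^(q-1)\<close>. In the local algebra generated by \<open>x, y\<close> one has \<open>(yx)^q = -(xy)^q\<close>, and
  \<open>f\<close> is annihilated by \<open>x\<close> and \<open>y\<close>. Hence \<open>a_0 \<mapsto> a_0 + c a_0 w\<close>, \<open>b_0 \<mapsto> b_0 - c w b_0\<close> replaces \<open>x\<close> by
  \<open>x + 2 c f\<close> and maps \<open>J \<delta>\<close> into \<open>J (\<delta> + 2 c)\<close>; in type L the substitution \<open>\<epsilon> \<mapsto> \<epsilon> + c \<epsilon>^(2n-2)\<close> does the same.
  If 2 is invertible, this joins \<open>J 1\<close> to \<open>J 0\<close>.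

  In characteristic 2 the algebras are separated by trace functions, i.e. linear functions \<open>t\<close> with
  \<open>t (uv) = t (vu)\<close>. In types D and E the sum of all defining relations of \<open>P*\<close> equals \<open>f\<close> modulo commutators, so every
  trace function on \<open>P*\<close> vanishes on \<open>f\<close>, and then on all paths of length at least \<open>4q\<close>; but on \<open>P\<close> there is a
  trace function that is nonzero on a path of length \<open>4q\<close>. In type L every trace function on \<open>P\<close> vanishes on
  the squares of nilpotent elements, while \<open>P*\<close> has one with value 1 on \<open>\<epsilon>\<^sup>2\<close>.
\<close>

section \<open>Path algebras\<close>

text \<open>Both halves of the proof turn on the same factor 2. With \<open>x w = f\<close> and
  \<open>w x = -f\<close> the change of arrows adds \<open>c (x w - w x) = 2 c f\<close>. Modulo
  commutators an edge contributes \<open>a (bar a) + (bar a) a\<close>, hence twice one term, to the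
  sum of the mesh relations. In characteristic 2 the obstacle is that an isomorphism need not
  respect vertices, arrows or path lengths. Trace functions can be transported along any
  isomorphism. Moreover, coefficients at trivial paths are multiplicative and the relations have
  none, so a nilpotent element of a quotient is represented without trivial paths. In types D and E
  every arrow squares to zero; an arrow of \<open>P\<close> therefore corresponds to an element of
  \<open>P*\<close> supported in positive length, and a path of length \<open>4q\<close> to one
  supported in lengths at least \<open>4q\<close>, where all traces on \<open>P*\<close> vanish. In
  type L the same remark is applied to the loop. The trace on \<open>P\<close> in types D and E
  extends a functional on the local algebra of \<open>x\<close> and \<open>y\<close>, given modulo 2
  by a set of cyclic words. A passage through the long arm counts as \<open>x + y\<close>, because
  \<open>z = x + y\<close> in characteristic 2.\<close>

declare plus_fun_apply [simp del] zero_fun_apply [simp del] minus_apply [simp del] uminus_apply [simp del]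

lemma sum_fun_apply: "sum f A x = (\<Sum>i\<in>A. f i x)"
  by (induction A rule: infinite_finite_induct) (auto simp: plus_fun_apply zero_fun_apply)

definition pel :: "path \<Rightarrow> path \<Rightarrow> 'k::field" where
  "pel q = (\<lambda>p. if p = q then 1 else 0)"

lemma padd_eq: "padd f g = f + g"
  by (auto simp: padd_def fun_eq_iff minus_apply uminus_apply plus_fun_apply zero_fun_apply)

lemma pzero_eq: "pzero = 0"
  by (auto simp: pzero_def fun_eq_iff minus_apply uminus_apply plus_fun_apply zero_fun_apply)

lemma arrow_el_eq: "arrow_el D a = pel (src D a, [a])"
  by (auto simp: arrow_el_def pel_def fun_eq_iff minus_apply uminus_apply plus_fun_apply zero_fun_apply)

lemma pmult_apply:
  "pmult D f g (v, as) = (\<Sum>i\<le>length as. f (v, take i as) * g (pend D v (take i as), drop i as))"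
  by (simp add: pmult_def atLeast0AtMost)

lemma pend_append [simp]: "pend D v (as @ bs) = pend D (pend D v as) bs"
  by (induction as arbitrary: v) auto

lemma chain_append [simp]: "chain D v (as @ bs) \<longleftrightarrow> chain D v as \<and> chain D (pend D v as) bs"
  by (induction as arbitrary: v) auto

lemma pmult_add_left [simp]: "pmult D (f + g) h = pmult D f h + pmult D g h"
  by (rule ext, rename_tac p, case_tac p) (simp add: plus_fun_apply zero_fun_apply pmult_apply algebra_simps sum.distrib)

lemma pmult_add_right [simp]: "pmult D h (f + g) = pmult D h f + pmult D h g"
  by (rule ext, rename_tac p, case_tac p) (simp add: plus_fun_apply zero_fun_apply pmult_apply algebra_simps sum.distrib)

lemma pmult_zero_left [simp]: "pmult D 0 h = 0"
  by (rule ext, rename_tac p, case_tac p) (simp add: plus_fun_apply zero_fun_apply pmult_apply)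

lemma pmult_zero_right [simp]: "pmult D h 0 = 0"
  by (rule ext, rename_tac p, case_tac p) (simp add: plus_fun_apply zero_fun_apply pmult_apply)

lemma psmult_simps [simp]:
  "psmult c (f + g) = psmult c f + psmult c g" "psmult c 0 = 0" "psmult 0 f = 0" "psmult 1 f = f"
  "psmult (c + d) f = psmult c f + psmult d f" "psmult c (psmult d f) = psmult (c * d) f"
  by (auto simp: psmult_def fun_eq_iff minus_apply uminus_apply plus_fun_apply zero_fun_apply algebra_simps)

lemma psmult_uminus: "psmult (- 1) f = - f" "psmult (- c) f = - psmult c f" "psmult c (- f) = - psmult c f"
  by (auto simp: psmult_def fun_eq_iff minus_apply uminus_apply plus_fun_apply zero_fun_apply)

lemma psmult_minus [simp]: "psmult c (f - g) = psmult c f - psmult c g"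
  by (auto simp: psmult_def fun_eq_iff minus_apply uminus_apply plus_fun_apply zero_fun_apply algebra_simps)

lemma pmult_psmult_left [simp]: "pmult D (psmult c f) h = psmult c (pmult D f h)"
  by (rule ext, rename_tac p, case_tac p) (simp add: plus_fun_apply zero_fun_apply pmult_apply psmult_def sum_distrib_left mult.assoc)

lemma pmult_psmult_right [simp]: "pmult D h (psmult c f) = psmult c (pmult D h f)"
  by (rule ext, rename_tac p, case_tac p)
    (simp add: plus_fun_apply zero_fun_apply pmult_apply psmult_def sum_distrib_left mult.left_commute)

lemma pmult_uminus_left [simp]: "pmult D (- f) h = - pmult D f h"
  using pmult_psmult_left[of D "- 1" f h] by (simp add: psmult_uminus)

lemma pmult_uminus_right [simp]: "pmult D f (- h) = - pmult D f h"
  using pmult_psmult_right[of D f "- 1" h] by (simp add: psmult_uminus)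

lemma pmult_minus_left [simp]: "pmult D (f - g) h = pmult D f h - pmult D g h"
  using pmult_add_left[of D f "- g" h] by simp

lemma pmult_minus_right [simp]: "pmult D h (f - g) = pmult D h f - pmult D h g"
  using pmult_add_right[of D h f "- g"] by simp

lemma pmult_assoc: "pmult D (pmult D f g) h = pmult D f (pmult D g h)"
proof (rule ext, clarify)
  fix v and as :: "arr list"
  let ?n = "length as"
  let ?F = "\<lambda>j i. f (v, take j as) * g (pend D v (take j as), drop j (take i as))
                  * h (pend D v (take i as), drop i as)"
  have "pmult D (pmult D f g) h (v, as) = (\<Sum>i\<le>?n. \<Sum>j\<le>i. ?F j i)"
  proof -
    have "pmult D f g (v, take i as) * h (pend D v (take i as), drop i as) = (\<Sum>j\<le>i. ?F j i)"
      if "i \<le> ?n" for i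
      using that by (auto simp: pmult_apply sum_distrib_right min_def intro!: sum.cong)
    then show ?thesis by (simp add: plus_fun_apply zero_fun_apply pmult_apply[of D "pmult D f g"])
  qed
  also have "\<dots> = (\<Sum>(i, j)\<in>(SIGMA i:{..?n}. {..i}). ?F j i)"
    by (simp add: sum.Sigma)
  \<comment> \<open>Two cut points \<open>j \<le> i\<close> of the path are recorded as the first
    cut together with the length \<open>k = i - j\<close> of the middle piece.\<close>
  also have "\<dots> = (\<Sum>(j, k)\<in>(SIGMA j:{..?n}. {..?n - j}). ?F j (j + k))"
    by (rule sum.reindex_bij_witness[where i = "\<lambda>(j, k). (j + k, j)" and j = "\<lambda>(i, j). (j, i - j)"]) auto
  also have "\<dots> = (\<Sum>j\<le>?n. \<Sum>k\<le>?n - j. ?F j (j + k))"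
    by (simp add: sum.Sigma)
  also have "\<dots> = pmult D f (pmult D g h) (v, as)"
  proof -
    have "pend D v (take (j + k) as) = pend D (pend D v (take j as)) (take k (drop j as))" for j k
      by (metis take_add pend_append)
    then show ?thesis
      by (auto simp: pmult_apply sum_distrib_left mult.assoc drop_take add.commute intro!: sum.cong)
  qed
  finally show "pmult D (pmult D f g) h (v, as) = pmult D f (pmult D g h) (v, as)" .
qed

lemma pmult_pel:
  "pmult D (pel (v, as)) (pel (w, bs)) = (if w = pend D v as then pel (v, as @ bs) else 0)"
proof (rule ext, clarify)
  fix u cs
  have *: "(pel (v, as) (u, take i cs) * pel (w, bs) (pend D u (take i cs), drop i cs) :: 'a)
     = (if i = length as \<and> u = v \<and> cs = as @ bs \<and> w = pend D v as then 1 else 0)"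
    if "i \<le> length cs" for i
  proof -
    have "u = v \<and> take i cs = as \<and> pend D u (take i cs) = w \<and> drop i cs = bs
        \<longleftrightarrow> i = length as \<and> u = v \<and> cs = as @ bs \<and> w = pend D v as"
      using that by (auto simp: min_def)
    then show ?thesis by (auto simp: pel_def)
  qed
  have "pmult D (pel (v, as)) (pel (w, bs)) (u, cs)
      = (\<Sum>i\<le>length cs. if i = length as \<and> u = v \<and> cs = as @ bs \<and> w = pend D v as then 1 else 0 :: 'a)"
    unfolding pmult_apply by (rule sum.cong) (use * in auto)
  also have "\<dots> = (if u = v \<and> cs = as @ bs \<and> w = pend D v as then 1 else 0)"
    by (auto simp: sum.delta)
  finally show "pmult D (pel (v, as)) (pel (w, bs)) (u, cs)
      = ((if w = pend D v as then pel (v, as @ bs) else 0) (u, cs) :: 'a)"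
    by (auto simp: pel_def zero_fun_apply)
qed

lemma elem_zero [simp]: "elem D 0"
  by (simp add: zero_fun_apply elem_def)

lemma elem_add [simp]: "elem D f \<Longrightarrow> elem D g \<Longrightarrow> elem D (f + g)"
proof -
  assume "elem D f" "elem D g"
  moreover have "{p. (f + g) p \<noteq> 0} \<subseteq> {p. f p \<noteq> 0} \<union> {p. g p \<noteq> 0}" by (auto simp: plus_fun_apply)
  ultimately show ?thesis unfolding elem_def by (blast intro: finite_subset)
qed

lemma elem_psmult [simp]: "elem D f \<Longrightarrow> elem D (psmult c f)"
  unfolding elem_def psmult_def by (auto intro: finite_subset[of _ "{p. f p \<noteq> 0}"])

lemma elem_uminus [simp]: "elem D f \<Longrightarrow> elem D (- f)"
  using elem_psmult[of D f "- 1"] by (simp add: psmult_uminus)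

lemma elem_minus [simp]: "elem D f \<Longrightarrow> elem D g \<Longrightarrow> elem D (f - g)"
  using elem_add[of D f "- g"] by simp

lemma elem_sum: "(\<And>i. i \<in> A \<Longrightarrow> elem D (f i)) \<Longrightarrow> elem D (sum f A)"
  by (induction A rule: infinite_finite_induct) auto

lemma elem_pel [simp]: "elem D (pel p) \<longleftrightarrow> valid_path D p"
  by (cases p) (auto simp: elem_def pel_def)

text \<open>The step keeps the fact that \<open>p\<close> lies in the support of the original
  \<open>f\<close>, not just that it is a valid path. Bounds on the support of \<open>f\<close>,
  such as a minimal path length, thus remain available in the induction.\<close>

lemma elem_induct [consumes 1, case_names zero step]:
  assumes "elem D f" "P 0"
    and step: "\<And>c p g. f p \<noteq> 0 \<Longrightarrow> valid_path D p \<Longrightarrow> elem D g \<Longrightarrow> P g \<Longrightarrow> P (psmult c (pel p) + g)"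
  shows "P f"
proof -
  let ?A = "{p. f p \<noteq> 0}"
  have fin: "finite ?A" using assms(1) by (simp add: elem_def)
  have v: "\<And>p. p \<in> ?A \<Longrightarrow> valid_path D p" using assms(1) by (auto simp: elem_def)
  have "elem D (\<Sum>p\<in>B. psmult (f p) (pel p)) \<and> P (\<Sum>p\<in>B. psmult (f p) (pel p))" if "finite B" "B \<subseteq> ?A" for B
    using that
  proof (induction B rule: finite_induct)
    case empty then show ?case unfolding sum.empty using assms(2) elem_zero by blast
  next
    case (insert p B) then show ?case using v step by auto
  qed
  from this[OF fin] have "P (\<Sum>p\<in>?A. psmult (f p) (pel p))" by auto
  also have "(\<Sum>p\<in>?A. psmult (f p) (pel p)) = f"
  proof (rule ext)
    fix q
    have "(\<Sum>p\<in>?A. psmult (f p) (pel p)) q = (\<Sum>p\<in>?A. if p = q then f p else 0)"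
      unfolding sum_fun_apply by (rule sum.cong) (auto simp: psmult_def pel_def)
    also have "\<dots> = f q" using fin by (simp add: sum.delta')
    finally show "(\<Sum>p\<in>?A. psmult (f p) (pel p)) q = f q" .
  qed
  finally show ?thesis .
qed

lemma elem_pmult [simp]:
  assumes "elem D f" "elem D g" shows "elem D (pmult D f g)"
  using assms(1)
proof (induction f rule: elem_induct)
  case (step c p f')
  obtain v as where p: "p = (v, as)" by force
  have "elem D (pmult D (pel p) g)"
    using assms(2)
  proof (induction g rule: elem_induct)
    case (step c' q g')
    obtain w bs where q: "q = (w, bs)" by force
    have "elem D (pmult D (pel p) (pel q) :: path \<Rightarrow> 'a)"
      using \<open>valid_path D p\<close> \<open>valid_path D q\<close> by (auto simp: p q pmult_pel valid_path_def)
    with step show ?case by simp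
  qed simp
  with step show ?case by simp
qed simp

lemma elem_pone [simp]: "elem D (pone D)"
proof -
  have "{p. pone D p \<noteq> (0::'a)} \<subseteq> (\<lambda>v. (v, [])) ` {..<nverts D}"
    by (auto simp: pone_def split: if_splits)
  moreover have "valid_path D p" if "pone D p \<noteq> (0::'a)" for p
    using that by (cases p) (auto simp: pone_def valid_path_def split: if_splits)
  ultimately show ?thesis unfolding elem_def by (blast intro: finite_surj)
qed

lemma pone_pel_left:
  assumes "v < nverts D" shows "pmult D (pone D) (pel (v, as)) = pel (v, as)"
proof (rule ext, clarify)
  fix w bs
  have "pmult D (pone D) (pel (v, as)) (w, bs)
      = (\<Sum>i\<le>length bs. if i = 0 then (if w < nverts D then pel (v, as) (w, bs) else 0) else 0 :: 'a)"
    unfolding pmult_apply by (rule sum.cong) (auto simp: pone_def)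
  then show "pmult D (pone D) (pel (v, as)) (w, bs) = (pel (v, as) (w, bs) :: 'a)"
    using assms by (auto simp: pel_def sum.delta)
qed

lemma pone_pel_right:
  assumes "pend D v as < nverts D" shows "pmult D (pel (v, as)) (pone D) = pel (v, as)"
proof (rule ext, clarify)
  fix w bs
  have "pmult D (pel (v, as)) (pone D) (w, bs)
      = (\<Sum>i\<le>length bs. if i = length bs then pel (v, as) (w, bs) else 0 :: 'a)"
    unfolding pmult_apply by (rule sum.cong) (use assms in \<open>auto simp: pone_def pel_def\<close>)
  then show "pmult D (pel (v, as)) (pone D) (w, bs) = (pel (v, as) (w, bs) :: 'a)"
    by (auto simp: sum.delta)
qed

text \<open>The bounds keep the ends of all arrows among the vertices and guarantee that the first
  arrow of the long arm, \<open>Ar (exc_vertex D)\<close>, exists.\<close>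

definition wf_dyn :: "dyn \<Rightarrow> bool" where
  "wf_dyn D \<longleftrightarrow> (case D of Dq n \<Rightarrow> n \<ge> 4 | Eq n \<Rightarrow> n \<ge> 5 | Lq n \<Rightarrow> n \<ge> 2)"

lemma arrow_less:
  assumes "wf_dyn D" "a \<in> arrows D" shows "src D a < nverts D" "tgt D a < nverts D"
  using assms by (cases D; cases a; auto simp: arrows_def wf_dyn_def split: if_splits)+

lemma pend_less: "wf_dyn D \<Longrightarrow> v < nverts D \<Longrightarrow> chain D v as \<Longrightarrow> pend D v as < nverts D"
  by (induction as arbitrary: v) (auto simp: arrow_less)

lemma pone_left [simp]:
  assumes "elem D f" shows "pmult D (pone D) f = f"
  using assms
proof (induction f rule: elem_induct)
  case (step c p g) then show ?case by (cases p) (simp add: pone_pel_left valid_path_def)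
qed simp

lemma pone_right [simp]:
  assumes "wf_dyn D" "elem D f" shows "pmult D f (pone D) = f"
  using assms(2)
proof (induction f rule: elem_induct)
  case (step c p g) then show ?case
    using assms(1) by (cases p) (simp add: pone_pel_right valid_path_def pend_less)
qed simp

lemma elem_arrow_el [simp]: "wf_dyn D \<Longrightarrow> a \<in> arrows D \<Longrightarrow> elem D (arrow_el D a)"
  by (simp add: arrow_el_eq valid_path_def arrow_less)

section \<open>Ideals and operator representations of quotients\<close>

definition is_ideal :: "dyn \<Rightarrow> (path \<Rightarrow> 'k::field) set \<Rightarrow> bool" where
  "is_ideal D J \<longleftrightarrow> (\<forall>f\<in>J. elem D f) \<and> 0 \<in> J \<and> (\<forall>f\<in>J. \<forall>g\<in>J. f + g \<in> J)
     \<and> (\<forall>f\<in>J. \<forall>a. elem D a \<longrightarrow> pmult D a f \<in> J \<and> pmult D f a \<in> J)"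

lemma ideal_gen_ideal:
  assumes "\<And>s. s \<in> S \<Longrightarrow> elem D s" shows "is_ideal D (ideal_gen D S)"
proof -
  have "elem D f" if "f \<in> ideal_gen D S" for f
    using that by (induction) (auto simp: assms padd_eq pzero_eq)
  then show ?thesis
    unfolding is_ideal_def
    by (auto intro: ideal_gen.lmult ideal_gen.rmult simp flip: padd_eq pzero_eq
        intro: ideal_gen.add ideal_gen.zero)
qed

lemma
  assumes "is_ideal D J"
  shows ideal_elem: "f \<in> J \<Longrightarrow> elem D f"
    and ideal_0: "0 \<in> J"
    and ideal_add: "f \<in> J \<Longrightarrow> g \<in> J \<Longrightarrow> f + g \<in> J"
    and ideal_lmult: "f \<in> J \<Longrightarrow> elem D a \<Longrightarrow> pmult D a f \<in> J"
    and ideal_rmult: "f \<in> J \<Longrightarrow> elem D a \<Longrightarrow> pmult D f a \<in> J"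
  using assms by (auto simp: is_ideal_def)

lemma ideal_psmult:
  assumes "is_ideal D J" "f \<in> J" shows "psmult c f \<in> J"
proof -
  have "pmult D (psmult c (pone D)) f = psmult c f"
    using assms by (simp add: ideal_elem)
  then show ?thesis using ideal_lmult[OF assms, of "psmult c (pone D)"] by simp
qed

lemma ideal_uminus: "is_ideal D J \<Longrightarrow> f \<in> J \<Longrightarrow> - f \<in> J"
  using ideal_psmult[of D J f "- 1"] by (simp add: psmult_uminus)

lemma ideal_minus: "is_ideal D J \<Longrightarrow> f \<in> J \<Longrightarrow> g \<in> J \<Longrightarrow> f - g \<in> J"
  using ideal_add[of D J f "- g"] by (simp add: ideal_uminus)

text \<open>A type of class \<open>ring_1\<close> allows computations modulo relations to be done
  with equations in a noncommutative ring. The operators act on all functions on paths, since a type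
  cannot depend on \<open>D\<close>; finite support is enforced later by a projection.\<close>

typedef (overloaded) 'k endo =
  "{F :: (path \<Rightarrow> 'k::field) \<Rightarrow> path \<Rightarrow> 'k. (\<forall>f g. F (f + g) = F f + F g) \<and> (\<forall>c f. F (psmult c f) = psmult c (F f))}"
  by (rule exI[of _ "\<lambda>f. f"]) simp

setup_lifting type_definition_endo

instantiation endo :: (field) ring_1
begin

lift_definition zero_endo :: "'a endo" is "\<lambda>f. 0" by simp
lift_definition one_endo :: "'a endo" is "\<lambda>f. f" by simp
lift_definition plus_endo :: "'a endo \<Rightarrow> 'a endo \<Rightarrow> 'a endo" is "\<lambda>F G f. F f + G f" by simp
lift_definition minus_endo :: "'a endo \<Rightarrow> 'a endo \<Rightarrow> 'a endo" is "\<lambda>F G f. F f - G f" by simp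
lift_definition uminus_endo :: "'a endo \<Rightarrow> 'a endo" is "\<lambda>F f. - F f" by (simp add: psmult_uminus)
lift_definition times_endo :: "'a endo \<Rightarrow> 'a endo \<Rightarrow> 'a endo" is "\<lambda>F G f. F (G f)" by simp

instance
proof
  have "psmult (1::'a) (\<lambda>p. 1) \<noteq> 0" by (auto simp: fun_eq_iff zero_fun_apply psmult_def)
  then show "(0::'a endo) \<noteq> 1"
    by transfer (metis psmult_simps(4))
qed (transfer; simp add: algebra_simps)+

end

lift_definition scale :: "'k::field \<Rightarrow> 'k endo \<Rightarrow> 'k endo" is "\<lambda>c F f. psmult c (F f)"
  by (simp add: mult.commute)

lemma scale_simps [simp]:
  "scale c F * G = scale c (F * G)" "G * scale c F = scale c (G * F)"
  "scale c (F + G) = scale c F + scale c G" "scale c 0 = 0" "scale 0 F = 0" "scale 1 F = F"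
  "scale c (scale d F) = scale (c * d) F" "scale c (- F) = - scale c F" "scale (- c) F = - scale c F"
  "scale c (F - G) = scale c F - scale c G"
  by (transfer; auto simp: psmult_uminus)+

lemma scale_add: "scale (c + d) F = scale c F + scale d F"
  by (transfer; auto)

text \<open>Preservation of the unit is not part of the notion: \<open>h (pone D)\<close> is merely
  an idempotent operator. Hence \<open>ppow\<close> is sent to a power only from exponent 1 on, or
  in the presence of a further factor.\<close>

definition alg_hom :: "dyn \<Rightarrow> ((path \<Rightarrow> 'k::field) \<Rightarrow> 'k endo) \<Rightarrow> bool" where
  "alg_hom D h \<longleftrightarrow> (\<forall>f g. elem D f \<longrightarrow> elem D g \<longrightarrow> h (f + g) = h f + h g \<and> h (pmult D f g) = h f * h g)
     \<and> (\<forall>c f. elem D f \<longrightarrow> h (psmult c f) = scale c (h f))"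

lemma
  assumes "alg_hom D h"
  shows hom_add: "elem D f \<Longrightarrow> elem D g \<Longrightarrow> h (f + g) = h f + h g"
    and hom_mult: "elem D f \<Longrightarrow> elem D g \<Longrightarrow> h (pmult D f g) = h f * h g"
    and hom_psmult: "elem D f \<Longrightarrow> h (psmult c f) = scale c (h f)"
  using assms by (auto simp: alg_hom_def)

lemma hom_0: "alg_hom D h \<Longrightarrow> h 0 = 0"
  using hom_psmult[of D h 0 0] by simp

lemma hom_uminus: "alg_hom D h \<Longrightarrow> elem D f \<Longrightarrow> h (- f) = - h f"
  using hom_psmult[of D h f "- 1"] by (simp add: psmult_uminus)

lemma hom_minus: "alg_hom D h \<Longrightarrow> elem D f \<Longrightarrow> elem D g \<Longrightarrow> h (f - g) = h f - h g"
  using hom_add[of D h f "- g"] by (simp add: hom_uminus)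

lemma hom_sum: "alg_hom D h \<Longrightarrow> (\<And>i. i \<in> A \<Longrightarrow> elem D (f i)) \<Longrightarrow> h (sum f A) = (\<Sum>i\<in>A. h (f i))"
  by (induction A rule: infinite_finite_induct) (auto simp: hom_0 hom_add elem_sum)

lemma elem_ppow [simp]: "elem D f \<Longrightarrow> elem D (ppow D f k)"
  by (induction k) auto

lemma hom_ppow: "alg_hom D h \<Longrightarrow> elem D f \<Longrightarrow> h (ppow D f (Suc k)) = h f ^ Suc k" 
  if "wf_dyn D"
proof (induction k)
  case 0 then show ?case using that by (simp)
next
  case (Suc k) then show ?case by (simp add: hom_mult del: ppow.simps(2)) (simp add: hom_mult)
qed

lemma hom_ideal_gen:
  assumes "alg_hom D h" "\<And>s. s \<in> S \<Longrightarrow> elem D s" "\<And>s. s \<in> S \<Longrightarrow> h s = 0" "f \<in> ideal_gen D S"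
  shows "h f = 0"
  using assms(4)
proof (induction)
  case (lmult a x)
  then show ?case using assms ideal_elem[OF ideal_gen_ideal] by (metis hom_mult mult_zero_right)
next
  case (rmult a x)
  then show ?case using assms ideal_elem[OF ideal_gen_ideal] by (metis hom_mult mult_zero_left)
next
  case (add x y)
  then show ?case using assms ideal_elem[OF ideal_gen_ideal] unfolding padd_eq by (metis hom_add add_0)
qed (use assms hom_0 in \<open>auto simp: pzero_eq\<close>)

lemma hom_eqI:
  assumes "alg_hom D h" "alg_hom D k" "wf_dyn D"
    and "\<And>v. v < nverts D \<Longrightarrow> h (pel (v, [])) = k (pel (v, []))"
    and "\<And>a. a \<in> arrows D \<Longrightarrow> h (arrow_el D a) = k (arrow_el D a)"
    and "elem D f"
  shows "h f = k f"
proof -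
  have path: "h (pel (v, as)) = k (pel (v, as))" if "v < nverts D" "chain D v as" for v as
    using that
  proof (induction as arbitrary: v)
    case (Cons a as)
    have 1: "pel (v, a # as) = pmult D (arrow_el D a) (pel (tgt D a, as))"
      using Cons.prems by (simp add: arrow_el_eq pmult_pel)
    have "elem D (pel (tgt D a, as) :: _ \<Rightarrow> 'a)" "elem D (arrow_el D a :: _ \<Rightarrow> 'a)"
      using Cons.prems assms(3) by (auto simp: valid_path_def arrow_less)
    moreover have "h (pel (tgt D a, as)) = k (pel (tgt D a, as))"
      using Cons assms(3) by (auto simp: arrow_less)
    ultimately show ?case using assms Cons.prems by (simp add: 1 hom_mult)
  qed (use assms in auto)
  show ?thesis using assms(6)
  proof (induction f rule: elem_induct)
    case (step c p g)
    then show ?case using assms path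
      by (cases p) (simp add: hom_add hom_psmult valid_path_def)
  qed (use assms in \<open>simp add: hom_0\<close>)
qed

text \<open>A basis of \<open>J\<close> is extended to a basis of the space of finitely supported
  elements; \<open>\<pi>\<close> kills the former and fixes the added vectors. It is defined on all
  functions, with range in the span of the images of the basis, so that its values are always
  elements.\<close>

lemma ideal_projection:
  fixes J :: "(path \<Rightarrow> 'k::field) set"
  assumes J: "is_ideal D J"
  obtains \<pi> :: "(path \<Rightarrow> 'k) \<Rightarrow> path \<Rightarrow> 'k" where
    "\<And>f g. \<pi> (f + g) = \<pi> f + \<pi> g" "\<And>c f. \<pi> (psmult c f) = psmult c (\<pi> f)"
    "\<And>f. elem D (\<pi> f)" "\<And>f. f \<in> J \<Longrightarrow> \<pi> f = 0" "\<And>f. elem D f \<Longrightarrow> \<pi> f - f \<in> J"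
proof -
  interpret vector_space "psmult :: 'k \<Rightarrow> _"
    by standard (simp_all)
  interpret vector_space_pair "psmult :: 'k \<Rightarrow> _" "psmult :: 'k \<Rightarrow> _"
    by standard
  let ?W = "{f :: path \<Rightarrow> 'k. elem D f}"
  have W: "subspace ?W" by (auto simp: subspace_def)
  have sJ: "subspace J" using J by (auto simp: subspace_def ideal_0 ideal_add ideal_psmult)
  obtain B where B: "B \<subseteq> J" "independent B" "J \<subseteq> span B"
    using maximal_independent_subset by blast
  have "B \<subseteq> ?W" using B(1) J by (auto simp: ideal_elem)
  then obtain B1 where B1: "B \<subseteq> B1" "B1 \<subseteq> ?W" "independent B1" "?W \<subseteq> span B1"
    using maximal_independent_subset_extend B(2) by blast
  obtain g where g: "Vector_Spaces.linear psmult psmult g" "\<forall>x\<in>B1. g x = (if x \<in> B then 0 else x)"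
    "range g = span ((\<lambda>x. if x \<in> B then 0 else x) ` B1)"
    using linear_independent_extend_subspace[OF B1(3), of "\<lambda>x. if x \<in> B then 0 else x"] by blast
  interpret g: Vector_Spaces.linear psmult psmult g by fact
  have r: "(\<lambda>x. if x \<in> B then 0 else x) ` B1 \<subseteq> ?W" using B1(2) by auto
  have 1: "elem D (g f)" for f
    using span_minimal[OF r W] g(3) by auto
  have 2: "g f = 0" if "f \<in> span B" for f
    using that
  proof (induction rule: span_induct_alt)
    case (step c x y) then show ?case using g(2) B1(1) by (auto simp: g.add g.scale)
  qed (simp add: g.zero)
  have 3: "g f - f \<in> J" if "f \<in> span B1" for f
    using that
  proof (induction rule: span_induct_alt)
    case (step c x y)
    have "g x - x \<in> J"
      using step(1) g(2) B(1) J ideal_uminus[OF J, of x] by (auto simp: ideal_0)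
    then have "psmult c (g x - x) + (g y - y) \<in> J"
      using step(2) J by (simp add: ideal_add ideal_psmult del: psmult_minus)
    moreover have "psmult c (g x - x) + (g y - y) = g (psmult c x + y) - (psmult c x + y)"
      by (simp add: g.add g.scale)
    ultimately show ?case by metis
  qed (use J in \<open>simp add: g.zero ideal_0\<close>)
  show thesis
  proof (rule that[of g])
    show "g f = 0" if "f \<in> J" for f using 2 B(3) that by auto
    show "g f - f \<in> J" if "elem D f" for f using 3 B1(4) that by auto
  qed (simp_all add: 1 g.add g.scale)
qed

text \<open>The quotient by an ideal is realised inside a ring of linear operators: a linear projection
  of the path space along the ideal turns left multiplication into an action of the quotient.\<close>

lemma ideal_hom:
  fixes J :: "(path \<Rightarrow> 'k::field) set"
  assumes J: "is_ideal D J" and D: "wf_dyn D"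
  obtains h where "alg_hom D h" "\<And>f. elem D f \<Longrightarrow> h f = 0 \<longleftrightarrow> f \<in> J"
proof -
  obtain \<pi> :: "(path \<Rightarrow> 'k) \<Rightarrow> path \<Rightarrow> 'k" where \<pi>:
    "\<And>f g. \<pi> (f + g) = \<pi> f + \<pi> g" "\<And>c f. \<pi> (psmult c f) = psmult c (\<pi> f)"
    "\<And>f. elem D (\<pi> f)" "\<And>f. f \<in> J \<Longrightarrow> \<pi> f = 0" "\<And>f. elem D f \<Longrightarrow> \<pi> f - f \<in> J"
    using ideal_projection[OF J] by metis
  define h where "h = (\<lambda>u. Abs_endo (\<lambda>f. \<pi> (pmult D u (\<pi> f))))"
  have h: "Rep_endo (h u) f = \<pi> (pmult D u (\<pi> f))" for u f
    unfolding h_def by (subst Abs_endo_inverse) (auto simp: \<pi>(1,2))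
  have ker: "\<pi> f = \<pi> g" if "f - g \<in> J" for f g
    using \<pi>(4)[OF that] \<pi>(1)[of "f - g" g] by simp
  have ext: "F = G" if "\<And>f. Rep_endo F f = Rep_endo G f" for F G :: "'k endo"
    using that by (metis Rep_endo_inverse ext)
  have "alg_hom D h"
    unfolding alg_hom_def
  proof (intro allI impI conjI)
    fix f g :: "path \<Rightarrow> 'k" and c assume e: "elem D f" "elem D g"
    show "h (f + g) = h f + h g" by (rule ext) (simp add: h plus_endo.rep_eq \<pi>)
    show "h (pmult D f g) = h f * h g"
    proof (rule ext)
      fix k
      \<comment> \<open>The inner projection changes its argument only by an element of
        \<open>J\<close>, and left multiplication by \<open>f\<close> keeps this error in
        \<open>J\<close>, where the outer projection removes it.\<close>
      have "pmult D f (\<pi> (pmult D g (\<pi> k))) - pmult D f (pmult D g (\<pi> k)) \<in> J"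
        using \<pi>(5)[of "pmult D g (\<pi> k)"] e ideal_lmult[OF J, of _ f]
        by (simp add: \<pi>(3) flip: pmult_minus_right)
      then show "Rep_endo (h (pmult D f g)) k = Rep_endo (h f * h g) k"
        by (simp add: h times_endo.rep_eq pmult_assoc ker[of _ "pmult D f (pmult D g (\<pi> k))"] ker[OF \<pi>(5)] \<pi>(3) e)
    qed
  next
    fix f :: "path \<Rightarrow> 'k" and c 
    show "h (psmult c f) = scale c (h f)" by (rule ext) (simp add: h scale.rep_eq \<pi>)
  qed
  moreover have "h f = 0 \<longleftrightarrow> f \<in> J" if f: "elem D f" for f
  proof
    assume "h f = 0"
    \<comment> \<open>Faithfulness: acting on the class of the unit returns the class of
      \<open>f\<close>.\<close>
    then have "\<pi> (pmult D f (\<pi> (pone D))) = 0"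
      using h[of f "pone D"] by (simp add: zero_endo.rep_eq)
    moreover have "pmult D f (\<pi> (pone D)) - f \<in> J"
      using ideal_lmult[OF J \<pi>(5)[OF elem_pone] f] D f by simp
    ultimately have "\<pi> f = 0" using ker by metis
    with \<pi>(5)[OF f] have "- f \<in> J" by simp
    then show "f \<in> J" using ideal_uminus[OF J] by fastforce
  next
    assume "f \<in> J"
    then have "pmult D f (\<pi> k) \<in> J" for k using ideal_rmult[OF J _ \<pi>(3)] by auto
    then show "h f = 0" by (intro ext) (simp add: h \<pi>(4) zero_endo.rep_eq)
  qed
  ultimately show thesis using that by blast
qed

section \<open>Homomorphisms, isomorphisms of quotients and traces\<close>

fun pathim :: "dyn \<Rightarrow> (arr \<Rightarrow> path \<Rightarrow> 'k::field) \<Rightarrow> nat \<Rightarrow> arr list \<Rightarrow> path \<Rightarrow> 'k" where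
  "pathim D G v [] = pel (v, [])"
| "pathim D G v (a # as) = pmult D (G a) (pathim D G (tgt D a) as)"

text \<open>This is the universal property of the path algebra. Since \<open>G a\<close> begins and
  ends where \<open>a\<close> does, the images of two paths that cannot be composed have product
  0.\<close>

lemma subst_hom:
  fixes G :: "arr \<Rightarrow> path \<Rightarrow> 'k::field"
  assumes D: "wf_dyn D"
    and G: "\<And>a. a \<in> arrows D \<Longrightarrow> elem D (G a)"
      "\<And>a. a \<in> arrows D \<Longrightarrow> pmult D (pel (src D a, [])) (G a) = G a"
      "\<And>a. a \<in> arrows D \<Longrightarrow> pmult D (G a) (pel (tgt D a, [])) = G a"
  obtains \<Phi> where "\<And>f. elem D f \<Longrightarrow> elem D (\<Phi> f)"
    "\<And>f g. elem D f \<Longrightarrow> elem D g \<Longrightarrow> \<Phi> (f + g) = \<Phi> f + \<Phi> g"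
    "\<And>f g. elem D f \<Longrightarrow> elem D g \<Longrightarrow> \<Phi> (pmult D f g) = pmult D (\<Phi> f) (\<Phi> g)"
    "\<And>c f. elem D f \<Longrightarrow> \<Phi> (psmult c f) = psmult c (\<Phi> f)"
    "\<And>v. \<Phi> (pel (v, [])) = pel (v, [])"
    "\<And>a. a \<in> arrows D \<Longrightarrow> \<Phi> (arrow_el D a) = G a"
proof -
  define P where "P = (\<lambda>(v, as). pathim D G v as)"
  define \<Phi> where "\<Phi> = (\<lambda>f. \<Sum>p | f p \<noteq> 0. psmult (f p) (P p))"
  have P_elem: "elem D (pathim D G v as)" if "v < nverts D" "chain D v as" for v as
    using that by (induction as arbitrary: v) (use D G(1) in \<open>simp_all add: valid_path_def arrow_less\<close>)
  have P_left: "pmult D (pel (v, [])) (pathim D G v as) = pathim D G v as" if "chain D v as" for v as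
  proof (cases as)
    case (Cons a bs)
    then show ?thesis using that G(2)[of a] by (simp add: pmult_assoc[symmetric])
  qed (simp add: pmult_pel)
  have P_right: "pmult D (pathim D G v as) (pel (pend D v as, [])) = pathim D G v as"
    if "chain D v as" for v as
    using that by (induction as arbitrary: v) (auto simp: pmult_pel pmult_assoc)
  have P_append: "pathim D G v (as @ bs) = pmult D (pathim D G v as) (pathim D G (pend D v as) bs)"
    if "chain D v (as @ bs)" for v as bs
    using that by (induction as arbitrary: v) (auto simp: P_left pmult_assoc)
  \<comment> \<open>The sum that defines \<open>\<Phi>\<close> may run over any finite set
    containing the support, so additivity becomes a comparison over one common index set.\<close>
  have sup: "\<Phi> f = (\<Sum>p\<in>A. psmult (f p) (P p))" if "finite A" "{p. f p \<noteq> 0} \<subseteq> A" for A f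
    unfolding \<Phi>_def by (rule sum.mono_neutral_left) (use that in auto)
  have add: "\<Phi> (f + g) = \<Phi> f + \<Phi> g" if "elem D f" "elem D g" for f g
  proof -
    let ?A = "{p. f p \<noteq> 0} \<union> {p. g p \<noteq> 0}"
    have fin: "finite ?A" using that by (auto simp: elem_def)
    have "\<Phi> (f + g) = (\<Sum>p\<in>?A. psmult ((f + g) p) (P p))"
      by (rule sup[OF fin]) (auto simp: plus_fun_apply)
    also have "\<dots> = \<Phi> f + \<Phi> g"
      by (simp add: sup[OF fin, of f] sup[OF fin, of g] plus_fun_apply sum.distrib)
    finally show ?thesis .
  qed
  have smult: "\<Phi> (psmult c f) = psmult c (\<Phi> f)" if "elem D f" for c f
  proof -
    have "psmult c (sum F A) = (\<Sum>p\<in>A. psmult c (F p))" for F :: "path \<Rightarrow> path \<Rightarrow> 'k" and A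
      by (induction A rule: infinite_finite_induct) auto
    moreover have fin: "finite {p. f p \<noteq> 0}" using that by (auto simp: elem_def)
    moreover have "\<Phi> (psmult c f) = (\<Sum>p | f p \<noteq> 0. psmult (psmult c f p) (P p))"
      by (rule sup[OF fin]) (auto simp: psmult_def)
    ultimately show ?thesis by (simp add: \<Phi>_def psmult_def[of c f])
  qed
  have 0: "\<Phi> 0 = 0" using smult[of 0 0] by simp
  have pel: "\<Phi> (pel p) = P p" for p
  proof -
    have "\<Phi> (pel p) = (\<Sum>q\<in>{p}. psmult (pel p q) (P q))"
      by (rule sup) (auto simp: pel_def)
    then show ?thesis by (simp add: pel_def)
  qed
  have elem: "elem D (\<Phi> f)" if "elem D f" for f
    using that
  proof (induction f rule: elem_induct)
    case (step c p g)
    then have "elem D (P p)" using P_elem by (cases p) (auto simp: P_def valid_path_def)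
    with step show ?case by (simp add: add smult pel)
  qed (simp add: 0)
  have mult: "\<Phi> (pmult D f g) = pmult D (\<Phi> f) (\<Phi> g)" if f: "elem D f" and g: "elem D g" for f g
    using f
  proof (induction f rule: elem_induct)
    case (step c p f')
    have "\<Phi> (pmult D (pel p) g) = pmult D (\<Phi> (pel p)) (\<Phi> g)"
      using g
    proof (induction g rule: elem_induct)
      case (step d q g')
      obtain v as w bs where pq: "p = (v, as)" "q = (w, bs)" by force
      have c: "chain D v as" "chain D w bs" using \<open>valid_path D p\<close> \<open>valid_path D q\<close> by (auto simp: pq valid_path_def)
      have "\<Phi> (pmult D (pel p) (pel q)) = pmult D (P p) (P q)"
      proof (cases "w = pend D v as")
        case True then show ?thesis using c by (simp add: pq pmult_pel pel P_def P_append)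
      next
        case False
        have "pmult D (P p) (P q) = pmult D (pmult D (P p) (pel (pend D v as, []))) (pmult D (pel (w, [])) (P q))"
          using c by (simp add: pq P_def P_left P_right)
        also have "\<dots> = pmult D (P p) (pmult D (pmult D (pel (pend D v as, [])) (pel (w, []))) (P q))"
          by (simp add: pmult_assoc)
        finally show ?thesis using False by (simp add: pmult_pel pq 0)
      qed
      then show ?case using step \<open>valid_path D p\<close> by (simp add: add smult pel)
    qed (simp add: 0)
    then show ?case using step g by (simp add: add smult)
  qed (simp add: 0)
  show thesis
  proof (rule that[of \<Phi>])
    show "\<Phi> (arrow_el D a) = G a" if "a \<in> arrows D" for a
      using that by (simp add: arrow_el_eq pel P_def G(3))
  qed (use add smult elem mult in \<open>auto simp: pel P_def\<close>)
qed

section \<open>Isomorphisms between quotients of the path algebra\<close>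

lemma coset_eq_iff:
  assumes J: "is_ideal D J" shows "coset J x = coset J y \<longleftrightarrow> x - y \<in> J"
proof
  assume "coset J x = coset J y"
  moreover have "x \<in> coset J x" using ideal_0[OF J] by (force simp: coset_def padd_eq)
  ultimately obtain i where "i \<in> J" "x = y + i" by (auto simp: coset_def padd_eq)
  then show "x - y \<in> J" by simp
next
  assume d: "x - y \<in> J"
  have "\<exists>j. x + i = y + j \<and> j \<in> J" if "i \<in> J" for i
    using ideal_add[OF J d that] by (intro exI[of _ "x - y + i"]) simp
  moreover have "\<exists>j. y + i = x + j \<and> j \<in> J" if "i \<in> J" for i
    using ideal_minus[OF J that d] by (intro exI[of _ "i - (x - y)"]) (simp add: algebra_simps)
  ultimately show "coset J x = coset J y" by (auto simp: coset_def padd_eq)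
qed

text \<open>One direction of the equivalence in \<open>bij\<close> makes the map on cosets
  independent of representatives, the other makes it injective; the second part of
  \<open>bij\<close> is surjectivity.\<close>

lemma quot_alg_isoI:
  assumes J1: "is_ideal D J1" and J2: "is_ideal D J2"
    and \<Phi>: "\<And>f. elem D f \<Longrightarrow> elem D (\<Phi> f)"
    "\<And>f g. elem D f \<Longrightarrow> elem D g \<Longrightarrow> \<Phi> (f + g) = \<Phi> f + \<Phi> g"
    "\<And>f g. elem D f \<Longrightarrow> elem D g \<Longrightarrow> \<Phi> (pmult D f g) = pmult D (\<Phi> f) (\<Phi> g)"
    "\<And>c f. elem D f \<Longrightarrow> \<Phi> (psmult c f) = psmult c (\<Phi> f)"
    "\<Phi> (pone D) = pone D"
    and bij: "\<And>f. elem D f \<Longrightarrow> \<Phi> f \<in> J2 \<longleftrightarrow> f \<in> J1" "\<And>f. elem D f \<Longrightarrow> \<exists>g. elem D g \<and> \<Phi> g - f \<in> J2"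
  shows "quot_alg_iso D J1 J2"
proof -
  define \<phi> where "\<phi> = (\<lambda>C. coset J2 (\<Phi> (SOME x. elem D x \<and> C = coset J1 x)))"
  have minus: "\<Phi> (x - y) = \<Phi> x - \<Phi> y" if "elem D x" "elem D y" for x y
    using \<Phi>(2)[of "x - y" y] that by simp
  have \<phi>: "\<phi> (coset J1 x) = coset J2 (\<Phi> x)" if x: "elem D x" for x
  proof -
    define y where "y = (SOME y. elem D y \<and> coset J1 x = coset J1 y)"
    have y: "elem D y" "coset J1 x = coset J1 y"
      using someI[of "\<lambda>y. elem D y \<and> coset J1 x = coset J1 y" x] x by (auto simp: y_def)
    then have "\<Phi> y - \<Phi> x \<in> J2"
      using bij(1)[of "y - x"] x y(2)[symmetric] by (simp add: coset_eq_iff[OF J1] flip: minus)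
    then show ?thesis using coset_eq_iff[OF J2] by (simp add: \<phi>_def y_def)
  qed
  have inj: "inj_on \<phi> (quot_carrier D J1)"
  proof (rule inj_onI)
    fix C C' assume "C \<in> quot_carrier D J1" "C' \<in> quot_carrier D J1" and eq: "\<phi> C = \<phi> C'"
    then obtain x y where xy: "elem D x" "elem D y" "C = coset J1 x" "C' = coset J1 y"
      unfolding quot_carrier_def by blast
    then show "C = C'"
      using eq bij(1)[of "x - y"] by (simp add: \<phi> coset_eq_iff[OF J1] coset_eq_iff[OF J2] minus)
  qed
  have "\<phi> ` quot_carrier D J1 = quot_carrier D J2"
  proof
    show "\<phi> ` quot_carrier D J1 \<subseteq> quot_carrier D J2"
      by (auto simp: quot_carrier_def \<phi> intro: \<Phi>(1))
    show "quot_carrier D J2 \<subseteq> \<phi> ` quot_carrier D J1"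
    proof
      fix C assume "C \<in> quot_carrier D J2"
      then obtain f where f: "elem D f" "C = coset J2 f" by (auto simp: quot_carrier_def)
      from bij(2)[OF f(1)] obtain g where "elem D g" "\<Phi> g - f \<in> J2" by blast
      then have "C = \<phi> (coset J1 g)" by (simp add: \<phi> f coset_eq_iff[OF J2]) (metis J2 ideal_uminus minus_diff_eq)
      with \<open>elem D g\<close> show "C \<in> \<phi> ` quot_carrier D J1" by (auto simp: quot_carrier_def)
    qed
  qed
  with inj have "bij_betw \<phi> (quot_carrier D J1) (quot_carrier D J2)" by (simp add: bij_betw_def)
  moreover have "\<phi> (coset J1 (pone D)) = coset J2 (pone D)" by (simp add: \<phi> \<Phi>)
  moreover have "\<phi> (coset J1 (padd x y)) = coset J2 (padd x' y')
      \<and> \<phi> (coset J1 (pmult D x y)) = coset J2 (pmult D x' y')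
      \<and> (\<forall>c. \<phi> (coset J1 (psmult c x)) = coset J2 (psmult c x'))"
    if e: "elem D x" "elem D y" "elem D x'" "elem D y'"
      and eq: "\<phi> (coset J1 x) = coset J2 x'" "\<phi> (coset J1 y) = coset J2 y'" for x y x' y'
  proof -
    have d: "\<Phi> x - x' \<in> J2" "\<Phi> y - y' \<in> J2" using eq e by (auto simp: \<phi> coset_eq_iff[OF J2])
    have "\<Phi> x + \<Phi> y - (x' + y') \<in> J2"
      using ideal_add[OF J2 d] by (simp add: algebra_simps)
    moreover have "pmult D (\<Phi> x) (\<Phi> y) - pmult D x' y' \<in> J2"
      using ideal_add[OF J2 ideal_rmult[OF J2 d(1) \<Phi>(1)[OF e(2)]] ideal_lmult[OF J2 d(2) e(3)]] by simp
    moreover have "psmult c (\<Phi> x) - psmult c x' \<in> J2" for c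
      using ideal_psmult[OF J2 d(1), of c] by simp
    ultimately show ?thesis
      using e by (simp add: \<phi> coset_eq_iff[OF J2] padd_eq \<Phi>)
  qed
  ultimately show ?thesis unfolding quot_alg_iso_def by blast
qed

text \<open>An isomorphism is converted into two representations in one operator ring with equal
  images: \<open>k\<close> represents the second quotient, and \<open>h\<close> is \<open>k\<close>
  after a lift of the isomorphism to elements. That \<open>f\<close> corresponds to \<open>g\<close>
  then reads \<open>h f = k g\<close>, and cosets disappear from the later arguments.\<close>

lemma quot_alg_isoD:
  fixes J1 J2 :: "(path \<Rightarrow> 'k::field) set"
  assumes J1: "is_ideal D J1" and J2: "is_ideal D J2" and D: "wf_dyn D" and iso: "quot_alg_iso D J1 J2"
  obtains h k where "alg_hom D h" "alg_hom D k"
    "\<And>f. elem D f \<Longrightarrow> h f = 0 \<longleftrightarrow> f \<in> J1" "\<And>f. elem D f \<Longrightarrow> k f = 0 \<longleftrightarrow> f \<in> J2"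
    "\<And>f. elem D f \<Longrightarrow> \<exists>g. elem D g \<and> k g = h f" "\<And>g. elem D g \<Longrightarrow> \<exists>f. elem D f \<and> k g = h f"
proof -
  from iso obtain \<phi> where bij: "bij_betw \<phi> (quot_carrier D J1) (quot_carrier D J2)"
    and hom: "\<And>x y x' y'. elem D x \<Longrightarrow> elem D y \<Longrightarrow> elem D x' \<Longrightarrow> elem D y' \<Longrightarrow>
              \<phi> (coset J1 x) = coset J2 x' \<Longrightarrow> \<phi> (coset J1 y) = coset J2 y' \<Longrightarrow>
              \<phi> (coset J1 (padd x y)) = coset J2 (padd x' y')
            \<and> \<phi> (coset J1 (pmult D x y)) = coset J2 (pmult D x' y')
            \<and> (\<forall>c. \<phi> (coset J1 (psmult c x)) = coset J2 (psmult c x'))"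
    unfolding quot_alg_iso_def by blast
  obtain k where k: "alg_hom D k" "\<And>f. elem D f \<Longrightarrow> k f = 0 \<longleftrightarrow> f \<in> J2"
    using ideal_hom[OF J2 D] by metis
  have keq: "k x = k y" if "coset J2 x = coset J2 y" "elem D x" "elem D y" for x y
    using that k(2)[of "x - y"] k(1) by (simp add: coset_eq_iff[OF J2] hom_minus)
  have "\<exists>g. elem D g \<and> \<phi> (coset J1 f) = coset J2 g" if "elem D f" for f
    using bij that unfolding bij_betw_def quot_carrier_def by blast
  note ex = this
  define G where "G = (\<lambda>f. SOME g. elem D g \<and> \<phi> (coset J1 f) = coset J2 g)"
  have G: "elem D (G f)" "\<phi> (coset J1 f) = coset J2 (G f)" if "elem D f" for f
    using someI_ex[OF ex[OF that]] by (auto simp: G_def)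
  define h where "h = (\<lambda>f. k (G f))"
  have "alg_hom D h"
    unfolding alg_hom_def
  proof (intro allI impI conjI)
    fix f g :: "path \<Rightarrow> 'k" assume e: "elem D f" "elem D g"
    note H = hom[OF e G(1)[OF e(1)] G(1)[OF e(2)] G(2)[OF e(1)] G(2)[OF e(2)]]
    have "coset J2 (G (f + g)) = coset J2 (G f + G g)"
      using H G(2)[of "f + g"] e by (simp add: padd_eq)
    from keq[OF this] show "h (f + g) = h f + h g" using e G(1) by (simp add: h_def hom_add[OF k(1)])
    have "coset J2 (G (pmult D f g)) = coset J2 (pmult D (G f) (G g))"
      using H G(2)[of "pmult D f g"] e by simp
    from keq[OF this] show "h (pmult D f g) = h f * h g" using e G(1) by (simp add: h_def hom_mult[OF k(1)])
  next
    fix c and f :: "path \<Rightarrow> 'k" assume e: "elem D f"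
    have "coset J2 (G (psmult c f)) = coset J2 (psmult c (G f))"
      using hom[OF e e G(1)[OF e] G(1)[OF e] G(2)[OF e] G(2)[OF e]] G(2)[of "psmult c f"] e by simp
    from keq[OF this] show "h (psmult c f) = scale c (h f)" using e G(1) by (simp add: h_def hom_psmult[OF k(1)])
  qed
  have phi0: "\<phi> (coset J1 0) = coset J2 0"
    using hom[OF elem_zero elem_zero G(1)[OF elem_zero] G(1)[OF elem_zero] G(2)[OF elem_zero] G(2)[OF elem_zero]]
    by (metis psmult_simps(3))
  have ker: "h f = 0 \<longleftrightarrow> f \<in> J1" if f: "elem D f" for f
  proof -
    have "h f = 0 \<longleftrightarrow> coset J2 (G f) = coset J2 0"
      using f G(1) k(2) by (simp add: h_def coset_eq_iff[OF J2])
    also have "\<dots> \<longleftrightarrow> \<phi> (coset J1 f) = \<phi> (coset J1 0)" using f G(2) phi0 by simp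
    also have "\<dots> \<longleftrightarrow> coset J1 f = coset J1 0"
    proof (rule inj_on_eq_iff[OF bij_betw_imp_inj_on[OF bij]])
      show "coset J1 f \<in> quot_carrier D J1" using f by (auto simp: quot_carrier_def)
      show "coset J1 0 \<in> quot_carrier D J1" using elem_zero by (auto simp: quot_carrier_def)
    qed
    finally show ?thesis by (simp add: coset_eq_iff[OF J1])
  qed
  have surj: "\<exists>f. elem D f \<and> k g = h f" if g: "elem D g" for g
  proof -
    have "coset J2 g \<in> \<phi> ` quot_carrier D J1" using bij g unfolding bij_betw_def quot_carrier_def by blast
    then obtain f where "elem D f" "coset J2 g = coset J2 (G f)" using G(2) unfolding quot_carrier_def by auto
    then show ?thesis using keq[of g "G f"] g G(1) unfolding h_def by metis
  qed
  show thesis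
    by (rule that[OF \<open>alg_hom D h\<close> k(1) ker k(2) _ surj]) (use G(1) in \<open>auto simp: h_def\<close>)
qed

text \<open>For \<open>A\<close> the quotient by \<open>J\<close>, these are the linear functions on
  \<open>A/[A,A]\<close>, an invariant of the algebra that does not refer to vertices or
  arrows.\<close>

definition is_trace :: "dyn \<Rightarrow> (path \<Rightarrow> 'k::field) set \<Rightarrow> ((path \<Rightarrow> 'k) \<Rightarrow> 'k) \<Rightarrow> bool" where
  "is_trace D J \<tau> \<longleftrightarrow> (\<forall>f g. elem D f \<longrightarrow> elem D g \<longrightarrow> \<tau> (f + g) = \<tau> f + \<tau> g \<and> \<tau> (pmult D f g) = \<tau> (pmult D g f))
     \<and> (\<forall>c f. elem D f \<longrightarrow> \<tau> (psmult c f) = c * \<tau> f) \<and> (\<forall>f\<in>J. \<tau> f = 0)"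

lemma
  assumes "is_trace D J \<tau>"
  shows trace_add: "elem D f \<Longrightarrow> elem D g \<Longrightarrow> \<tau> (f + g) = \<tau> f + \<tau> g"
    and trace_comm: "elem D f \<Longrightarrow> elem D g \<Longrightarrow> \<tau> (pmult D f g) = \<tau> (pmult D g f)"
    and trace_psmult: "elem D f \<Longrightarrow> \<tau> (psmult c f) = c * \<tau> f"
    and trace_ideal: "f \<in> J \<Longrightarrow> \<tau> f = 0"
  using assms by (auto simp: is_trace_def)

lemma trace_0: "is_trace D J \<tau> \<Longrightarrow> \<tau> 0 = 0"
  using trace_psmult[of D J \<tau> 0 0] by simp

lemma trace_uminus: "is_trace D J \<tau> \<Longrightarrow> elem D f \<Longrightarrow> \<tau> (- f) = - \<tau> f"
  using trace_psmult[of D J \<tau> f "- 1"] by (simp add: psmult_uminus)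

lemma trace_minus: "is_trace D J \<tau> \<Longrightarrow> elem D f \<Longrightarrow> elem D g \<Longrightarrow> \<tau> (f - g) = \<tau> f - \<tau> g"
  using trace_add[of D J \<tau> f "- g"] by (simp add: trace_uminus)

lemma trace_cong:
  assumes "is_trace D J \<tau>" "alg_hom D h" "\<And>f. elem D f \<Longrightarrow> h f = 0 \<Longrightarrow> f \<in> J"
    "elem D f" "elem D g" "h f = h g"
  shows "\<tau> f = \<tau> g"
  using assms(3)[of "f - g"] assms trace_ideal[OF assms(1), of "f - g"]
  by (simp add: hom_minus trace_minus)

text \<open>A trace on the quotient depends only on the operator representing an element. So any
  element with the same operator may be chosen in the other algebra, and the choice does not affect
  the value.\<close>

lemma trace_transport:
  fixes J J' :: "(path \<Rightarrow> 'k::field) set"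
  assumes t: "is_trace D J t" and h: "alg_hom D h" "\<And>f. elem D f \<Longrightarrow> h f = 0 \<longleftrightarrow> f \<in> J"
    and k: "alg_hom D k" "\<And>f. elem D f \<Longrightarrow> k f = 0 \<longleftrightarrow> f \<in> J'" and J': "is_ideal D J'"
    and im: "\<And>f. elem D f \<Longrightarrow> \<exists>g. elem D g \<and> h g = k f"
  obtains \<tau> where "is_trace D J' \<tau>" "\<And>f g. elem D f \<Longrightarrow> elem D g \<Longrightarrow> h g = k f \<Longrightarrow> \<tau> f = t g"
proof -
  from im obtain G where G: "\<And>f. elem D f \<Longrightarrow> elem D (G f)" "\<And>f. elem D f \<Longrightarrow> h (G f) = k f" by metis
  define \<tau> where "\<tau> = (\<lambda>f. t (G f))"
  have \<tau>: "\<tau> f = t g" if "elem D f" "elem D g" "h g = k f" for f g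
    unfolding \<tau>_def using trace_cong[OF t h(1) iffD1[OF h(2)]] that G by metis
  have "is_trace D J' \<tau>"
    unfolding is_trace_def
  proof (intro allI ballI impI conjI)
    fix f g :: "path \<Rightarrow> 'k" assume e: "elem D f" "elem D g"
    note G' = G(1)[OF e(1)] G(1)[OF e(2)]
    have "\<tau> (f + g) = t (G f + G g)" by (rule \<tau>) (use e G h k in \<open>simp_all add: hom_add\<close>)
    then show "\<tau> (f + g) = \<tau> f + \<tau> g" using G' t by (simp add: trace_add \<tau>_def)
    have "\<tau> (pmult D f g) = t (pmult D (G f) (G g))" by (rule \<tau>) (use e G h k in \<open>simp_all add: hom_mult\<close>)
    also have "\<dots> = t (pmult D (G g) (G f))" using G' t by (simp add: trace_comm)
    also have "\<dots> = \<tau> (pmult D g f)" by (rule \<tau>[symmetric]) (use e G h k in \<open>simp_all add: hom_mult\<close>)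
    finally show "\<tau> (pmult D f g) = \<tau> (pmult D g f)" .
  next
    fix c and f :: "path \<Rightarrow> 'k" assume e: "elem D f"
    have "\<tau> (psmult c f) = t (psmult c (G f))" by (rule \<tau>) (use e G h k in \<open>simp_all add: hom_psmult\<close>)
    then show "\<tau> (psmult c f) = c * \<tau> f" using G(1)[OF e] t by (simp add: trace_psmult \<tau>_def)
  next
    fix f assume "f \<in> J'"
    then have "elem D f" "k f = 0" using J' k(2) by (auto simp: ideal_elem)
    then have "\<tau> f = t 0" by (intro \<tau>) (use h in \<open>auto simp: hom_0\<close>)
    then show "\<tau> f = 0" using trace_0[OF t] by simp
  qed
  with \<tau> show thesis using that by blast
qed

text \<open>Since \<open>\<tau> (a s b) = \<tau> (s b a)\<close>, vanishing on a two-sided ideal has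
  to be tested only on products of a relation with a path on its right.\<close>

lemma is_traceI:
  assumes "\<And>f g. elem D f \<Longrightarrow> elem D g \<Longrightarrow> \<tau> (f + g) = \<tau> f + \<tau> g"
    and "\<And>c f. elem D f \<Longrightarrow> \<tau> (psmult c f) = c * \<tau> f"
    and comm: "\<And>p q. valid_path D p \<Longrightarrow> valid_path D q \<Longrightarrow> \<tau> (pmult D (pel p) (pel q)) = \<tau> (pmult D (pel q) (pel p))"
    and S: "\<And>s. s \<in> S \<Longrightarrow> elem D s"
    and rel: "\<And>s p. s \<in> S \<Longrightarrow> valid_path D p \<Longrightarrow> \<tau> (pmult D s (pel p)) = 0"
    and D: "wf_dyn D"
  shows "is_trace D (ideal_gen D S) (\<tau> :: (path \<Rightarrow> 'k::field) \<Rightarrow> 'k)"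
proof -
  have 0: "\<tau> 0 = 0" using assms(2)[of 0 0] by simp
  have comm: "\<tau> (pmult D f g) = \<tau> (pmult D g f)" if "elem D f" "elem D g" for f g
    using that(1)
  proof (induction f rule: elem_induct)
    case (step c p f')
    have "\<tau> (pmult D (pel p) g) = \<tau> (pmult D g (pel p))"
      using that(2) by (induction g rule: elem_induct) (use step assms(1,2) comm in \<open>auto simp: 0\<close>)
    with step that(2) assms(1,2) show ?case by simp
  qed (simp add: 0)
  have rel: "\<tau> (pmult D s f) = 0" if "s \<in> S" "elem D f" for s f
    using that(2) by (induction f rule: elem_induct) (use that rel S assms(1,2) in \<open>auto simp: 0\<close>)
  note el = ideal_elem[OF ideal_gen_ideal[OF S]]
  have "\<tau> (pmult D f u) = 0" if "f \<in> ideal_gen D S" "elem D u" for f u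
    using that
  proof (induction f arbitrary: u)
    case (lmult a x)
    have "\<tau> (pmult D (pmult D a x) u) = \<tau> (pmult D (pmult D x u) a)"
      using comm[of a "pmult D x u"] lmult el by (simp add: pmult_assoc)
    then show ?case using lmult by (simp add: pmult_assoc)
  qed (use el assms(1) rel in \<open>auto simp: 0 pzero_eq padd_eq pmult_assoc\<close>)
  from this[OF _ elem_pone] have "\<tau> f = 0" if "f \<in> ideal_gen D S" for f
    using that el D by (metis pone_right)
  with comm assms(1,2) show ?thesis by (auto simp: is_trace_def)
qed

section \<open>The local algebras at the branch vertex\<close>

text \<open>This is the additive span. A bare \<open>ring_1\<close> has no field scalars, and the
  reductions below produce only coefficients 0, 1 and -1. Closure under differences covers sums and
  negatives.\<close>

inductive_set gspan :: "'r::ring_1 set \<Rightarrow> 'r set" for B where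
  gspan_0: "0 \<in> gspan B"
| gspan_base: "b \<in> B \<Longrightarrow> b \<in> gspan B"
| gspan_diff: "x \<in> gspan B \<Longrightarrow> y \<in> gspan B \<Longrightarrow> x - y \<in> gspan B"

lemma gspan_uminus: "x \<in> gspan B \<Longrightarrow> - x \<in> gspan B"
  using gspan_diff[OF gspan_0] by fastforce

lemma gspan_add: "x \<in> gspan B \<Longrightarrow> y \<in> gspan B \<Longrightarrow> x + y \<in> gspan B"
  using gspan_diff[OF _ gspan_uminus] by fastforce

lemmas gspan_closed = gspan_0 gspan_base gspan_diff gspan_uminus gspan_add

lemma gspan_mult_right:
  assumes "x \<in> gspan B" "\<And>b. b \<in> B \<Longrightarrow> b * c \<in> gspan B'"
  shows "x * c \<in> gspan B'"
  using assms(1) by induction (simp_all add: assms(2) gspan_closed left_diff_distrib)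

lemma gspan_trans: "x \<in> gspan B \<Longrightarrow> B \<subseteq> gspan B' \<Longrightarrow> x \<in> gspan B'"
  using gspan_mult_right[of x B 1 B'] by auto

definition words :: "'r::ring_1 set \<Rightarrow> nat \<Rightarrow> 'r set" where
  "words A d = prod_list ` {ws. set ws \<subseteq> A \<and> length ws = d}"

lemma words_0: "words A 0 = {1}"
  by (auto simp: words_def)

lemma words_Suc: "words A (Suc d) = {w * a | w a. w \<in> words A d \<and> a \<in> A}"
proof -
  have "{ws. set ws \<subseteq> A \<and> length ws = Suc d} = {us @ [a] | us a. (set us \<subseteq> A \<and> length us = d) \<and> a \<in> A}"
    by (auto simp: length_Suc_conv_rev)
  then show ?thesis by (force simp: words_def image_iff)
qed

lemma words_step:
  assumes "words {X, Y} d \<subseteq> gspan B" "\<forall>b\<in>B. b * X \<in> gspan B' \<and> b * Y \<in> gspan B'"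
  shows "words {X, Y} (Suc d) \<subseteq> gspan B'"
  using assms by (auto simp: words_Suc intro: gspan_mult_right)

text \<open>The common outcome of the three local computations that follow, with \<open>F\<close>
  and \<open>V\<close> the elements \<open>f\<close> and \<open>w\<close> of the overview. It lets
  types D and E be treated together from then on. The condition on \<open>words\<close> puts every
  product of \<open>2 * q\<close> letters on the line through \<open>F\<close>.\<close>

definition socle_rel :: "'r::ring_1 \<Rightarrow> 'r \<Rightarrow> nat \<Rightarrow> bool" where
  "socle_rel X Y q \<longleftrightarrow> (let F = (X * Y) ^ q; V = Y * (X * Y) ^ (q - 1) in
     (Y * X) ^ q = - F \<and> X * F = 0 \<and> F * X = 0 \<and> Y * F = 0 \<and> F * Y = 0 \<and> V * V = 0
     \<and> words {X, Y} (2 * q) \<subseteq> gspan {F})"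

abbreviation (input) rmult :: "'r::times \<Rightarrow> 'r \<Rightarrow> 'r" (infixr "**" 70) where
  "a ** b \<equiv> a * b"

text \<open>The rewrite rules derived in the next two proofs form a noncommutative Groebner basis for the order in
  which \<open>Y\<close> exceeds \<open>X\<close>; each one resolves an overlap of two earlier rules. The generators of
  the spans are the normal words of each degree.\<close>

lemma e7_socle_rel:
  fixes X Y :: "'r::ring_1"
  assumes X: "X * X = 0" and Y: "Y * (Y * Y) = 0" and XY: "(X + Y) ^ 4 = 0"
  shows "socle_rel X Y 4"
proof -
  \<comment> \<open>Every rule is stored bare and with a tail \<open>u\<close>, because simplified
    products are nested to the right.\<close>
  have r0: "X * X = 0" "X * (X * u) = 0" for u using X by (simp_all flip: mult.assoc)
  have r1: "Y * (Y * Y) = 0" "Y * (Y * (Y * u)) = 0" for u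
    using Y by (simp, metis (no_types) Y mult.assoc mult_zero_left)
  have "(X + Y) ^ 4 = Y**Y**X**Y - (- (Y**X**Y**Y) - Y**X**Y**X - X**Y**Y**X - X**Y**X**Y)"
    by (simp add: numeral_eq_Suc algebra_simps r0 r1)
  then have a2: "Y**Y**X**Y = - (Y**X**Y**Y) - Y**X**Y**X - X**Y**Y**X - X**Y**X**Y" using XY by simp
  have b2: "Y**Y**X**Y**u = 0 - Y**X**Y**Y**u - Y**X**Y**X**u - X**Y**Y**X**u - X**Y**X**Y**u" for u
    using arg_cong[OF a2, of "\<lambda>w. w * u"] by (simp add: algebra_simps)
  note r2 = a2 b2[simplified]
  have "(Y**Y**X) * (Y**Y**Y) = (Y**Y**X**Y) * (Y**Y)"
    by (simp only: mult.assoc)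
  then have e: "(Y**Y**X) * (0) = (- (Y**X**Y**Y) - Y**X**Y**X - X**Y**Y**X - X**Y**X**Y) * (Y**Y)"
    by (simp only: a2 r1(1))
  have "Y**X**Y**X**Y**Y - (X**Y**X**Y**X**Y) = (Y**Y**X) * (0) - (- (Y**X**Y**Y) - Y**X**Y**X - X**Y**Y**X -
        X**Y**X**Y) * (Y**Y)"
    by (simp add: algebra_simps r0 r1) (simp add: algebra_simps r0 r1 r2)
  then have a3: "Y**X**Y**X**Y**Y = X**Y**X**Y**X**Y"
    by (simp only: e diff_self minus_zero right_minus_eq)
  have b3: "Y**X**Y**X**Y**Y**u = X**Y**X**Y**X**Y**u" for u
    using arg_cong[OF a3, of "\<lambda>w. w * u"] by (simp add: algebra_simps)
  note r3 = a3 b3[simplified]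
  have "(Y**X**Y**X) * (Y**Y**X**Y) = (Y**X**Y**X**Y**Y) * (X**Y)"
    by (simp only: mult.assoc)
  then have e: "(Y**X**Y**X) * (- (Y**X**Y**Y) - Y**X**Y**X - X**Y**Y**X - X**Y**X**Y) = (X**Y**X**Y**X**Y) *
        (X**Y)"
    by (simp only: a3 a2)
  have "Y**X**Y**X**Y**X**Y**X - (- (X**Y**X**Y**X**Y**X**Y)) = - ((Y**X**Y**X) * (- (Y**X**Y**Y) -
        Y**X**Y**X - X**Y**Y**X - X**Y**X**Y) - (X**Y**X**Y**X**Y) * (X**Y))"
    by (simp add: algebra_simps r0 r1) (simp add: algebra_simps r0 r1 r2 r3)
  \<comment> \<open>This is \<open>(Y * X) ^ 4 = - ((X * Y) ^ 4)\<close>, the sign responsible for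
    the term \<open>2 c f\<close> in the substitution of arrows.\<close>
  then have a4: "Y**X**Y**X**Y**X**Y**X = - (X**Y**X**Y**X**Y**X**Y)"
    by (simp only: e diff_self minus_zero right_minus_eq)
  have b4: "Y**X**Y**X**Y**X**Y**X**u = 0 - X**Y**X**Y**X**Y**X**Y**u" for u
    using arg_cong[OF a4, of "\<lambda>w. w * u"] by (simp add: algebra_simps)
  note r4 = a4 b4[simplified]
  note r = r0 r1 r2 r3 r4
  note s = algebra_simps r gspan_closed
  have "words {X, Y} 0 \<subseteq> gspan {1}" by (simp add: words_0 gspan_closed)
  then have "words {X, Y} (Suc 0) \<subseteq> gspan {X, Y}"
    by (rule words_step[where d = 0]) (simp add: s)
  then have "words {X, Y} 2 \<subseteq> gspan {X**Y, Y**X, Y**Y}"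
    by (rule words_step[where d = 1, simplified, simplified numeral_2_eq_2[symmetric]]) (simp add: s)
  then have "words {X, Y} 3 \<subseteq> gspan {X**Y**X, X**Y**Y, Y**X**Y, Y**Y**X}"
    by (rule words_step[where d = 2, simplified]) (simp add: s)
  then have "words {X, Y} 4 \<subseteq> gspan {X**Y**X**Y, X**Y**Y**X, Y**X**Y**X, Y**X**Y**Y}"
    by (rule words_step[where d = 3, simplified]) (simp add: s)
  then have "words {X, Y} 5 \<subseteq> gspan {X**Y**X**Y**X, X**Y**X**Y**Y, Y**X**Y**X**Y, Y**X**Y**Y**X}"
    by (rule words_step[where d = 4, simplified]) (simp add: s)
  then have "words {X, Y} 6 \<subseteq> gspan {X**Y**X**Y**X**Y, X**Y**X**Y**Y**X, Y**X**Y**X**Y**X}"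
    by (rule words_step[where d = 5, simplified]) (simp add: s)
  then have "words {X, Y} 7 \<subseteq> gspan {X**Y**X**Y**X**Y**X, Y**X**Y**X**Y**X**Y}"
    by (rule words_step[where d = 6, simplified]) (simp add: s)
  then have "words {X, Y} 8 \<subseteq> gspan {X**Y**X**Y**X**Y**X**Y}"
    by (rule words_step[where d = 7, simplified]) (simp add: s)
  moreover have "(X * Y) ^ 4 = X**Y**X**Y**X**Y**X**Y" "(Y * X) ^ 4 = Y**X**Y**X**Y**X**Y**X"
      "(X * Y) ^ 3 = X**Y**X**Y**X**Y"
    by (simp_all add: numeral_eq_Suc mult.assoc)
  ultimately show ?thesis by (simp add: socle_rel_def Let_def algebra_simps r)
qed

lemma e8_socle_rel:
  fixes X Y :: "'r::ring_1"
  assumes X: "X * X = 0" and Y: "Y * (Y * Y) = 0" and XY: "(X + Y) ^ 5 = 0"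
  shows "socle_rel X Y 7"
proof -
  have r0: "X * X = 0" "X * (X * u) = 0" for u using X by (simp_all flip: mult.assoc)
  have r1: "Y * (Y * Y) = 0" "Y * (Y * (Y * u)) = 0" for u
    using Y by (simp, metis (no_types) Y mult.assoc mult_zero_left)
  have "(X + Y) ^ 5 = Y**Y**X**Y**Y - (- (Y**Y**X**Y**X) - Y**X**Y**Y**X - Y**X**Y**X**Y - X**Y**Y**X**Y -
        X**Y**X**Y**Y - X**Y**X**Y**X)"
    by (simp add: numeral_eq_Suc algebra_simps r0 r1)
  then have a2: "Y**Y**X**Y**Y = - (Y**Y**X**Y**X) - Y**X**Y**Y**X - Y**X**Y**X**Y - X**Y**Y**X**Y -
        X**Y**X**Y**Y - X**Y**X**Y**X" using XY by simp
  have b2: "Y**Y**X**Y**Y**u = 0 - Y**Y**X**Y**X**u - Y**X**Y**Y**X**u - Y**X**Y**X**Y**u - X**Y**Y**X**Y**u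
        - X**Y**X**Y**Y**u - X**Y**X**Y**X**u" for u
    using arg_cong[OF a2, of "\<lambda>w. w * u"] by (simp add: algebra_simps)
  note r2 = a2 b2[simplified]
  have "(Y**Y**X) * (Y**Y**Y) = (Y**Y**X**Y**Y) * (Y)"
    by (simp only: mult.assoc)
  then have e: "(Y**Y**X) * (0) = (- (Y**Y**X**Y**X) - Y**X**Y**Y**X - Y**X**Y**X**Y - X**Y**Y**X**Y -
        X**Y**X**Y**Y - X**Y**X**Y**X) * (Y)"
    by (simp only: a2 r1(1))
  have "Y**Y**X**Y**X**Y - (- (Y**X**Y**Y**X**Y) - Y**X**Y**X**Y**Y + X**Y**Y**X**Y**X + X**Y**X**Y**Y**X) =
        (Y**Y**X) * (0) - (- (Y**Y**X**Y**X) - Y**X**Y**Y**X - Y**X**Y**X**Y - X**Y**Y**X**Y - X**Y**X**Y**Y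
        - X**Y**X**Y**X) * (Y)"
    by (simp add: algebra_simps r0 r1 r2)
  then have a3: "Y**Y**X**Y**X**Y = - (Y**X**Y**Y**X**Y) - Y**X**Y**X**Y**Y + X**Y**Y**X**Y**X +
        X**Y**X**Y**Y**X"
    by (simp only: e diff_self minus_zero right_minus_eq)
  have b3: "Y**Y**X**Y**X**Y**u = 0 - Y**X**Y**Y**X**Y**u - Y**X**Y**X**Y**Y**u + X**Y**Y**X**Y**X**u +
        X**Y**X**Y**Y**X**u" for u
    using arg_cong[OF a3, of "\<lambda>w. w * u"] by (simp add: algebra_simps)
  note r3 = a3 b3[simplified]
  have "(Y**Y**X**Y**X) * (Y**Y**X**Y**Y) = (Y**Y**X**Y**X**Y) * (Y**X**Y**Y)"
    by (simp only: mult.assoc)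
  then have e: "(Y**Y**X**Y**X) * (- (Y**Y**X**Y**X) - Y**X**Y**Y**X - Y**X**Y**X**Y - X**Y**Y**X**Y -
        X**Y**X**Y**Y - X**Y**X**Y**X) = (- (Y**X**Y**Y**X**Y) - Y**X**Y**X**Y**Y + X**Y**Y**X**Y**X +
        X**Y**X**Y**Y**X) * (Y**X**Y**Y)"
    by (simp only: a3 a2)
  have "Y**X**Y**X**Y**X**Y**Y**X**Y - (- (Y**X**Y**X**Y**X**Y**X**Y**Y) - Y**X**Y**X**Y**X**Y**X**Y**X -
        X**Y**X**Y**X**Y**X**Y**Y**X - X**Y**X**Y**X**Y**X**Y**X**Y) = - ((Y**Y**X**Y**X) * (-
        (Y**Y**X**Y**X) - Y**X**Y**Y**X - Y**X**Y**X**Y - X**Y**Y**X**Y - X**Y**X**Y**Y - X**Y**X**Y**X) - (-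
        (Y**X**Y**Y**X**Y) - Y**X**Y**X**Y**Y + X**Y**Y**X**Y**X + X**Y**X**Y**Y**X) * (Y**X**Y**Y))"
    by (simp add: algebra_simps r0 r1) (simp add: algebra_simps r0 r1 r2 r3)
  then have a4: "Y**X**Y**X**Y**X**Y**Y**X**Y = - (Y**X**Y**X**Y**X**Y**X**Y**Y) -
        Y**X**Y**X**Y**X**Y**X**Y**X - X**Y**X**Y**X**Y**X**Y**Y**X - X**Y**X**Y**X**Y**X**Y**X**Y"
    by (simp only: e diff_self minus_zero right_minus_eq)
  have b4: "Y**X**Y**X**Y**X**Y**Y**X**Y**u = 0 - Y**X**Y**X**Y**X**Y**X**Y**Y**u -
        Y**X**Y**X**Y**X**Y**X**Y**X**u - X**Y**X**Y**X**Y**X**Y**Y**X**u - X**Y**X**Y**X**Y**X**Y**X**Y**u"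
        for u
    using arg_cong[OF a4, of "\<lambda>w. w * u"] by (simp add: algebra_simps)
  note r4 = a4 b4[simplified]
  have "(Y**X**Y**X**Y**X**Y**Y**X) * (Y**Y**Y) = (Y**X**Y**X**Y**X**Y**Y**X**Y) * (Y**Y)"
    by (simp only: mult.assoc)
  then have e: "(Y**X**Y**X**Y**X**Y**Y**X) * (0) = (- (Y**X**Y**X**Y**X**Y**X**Y**Y) -
        Y**X**Y**X**Y**X**Y**X**Y**X - X**Y**X**Y**X**Y**X**Y**Y**X - X**Y**X**Y**X**Y**X**Y**X**Y) * (Y**Y)"
    by (simp only: a4 r1(1))
  have "Y**X**Y**X**Y**X**Y**X**Y**X**Y**Y - (X**Y**X**Y**X**Y**X**Y**X**Y**X**Y) =
        (Y**X**Y**X**Y**X**Y**Y**X) * (0) - (- (Y**X**Y**X**Y**X**Y**X**Y**Y) - Y**X**Y**X**Y**X**Y**X**Y**X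
        - X**Y**X**Y**X**Y**X**Y**Y**X - X**Y**X**Y**X**Y**X**Y**X**Y) * (Y**Y)"
    by (simp add: algebra_simps r0 r1) (simp add: algebra_simps r0 r1 r2 r3 r4)
  then have a5: "Y**X**Y**X**Y**X**Y**X**Y**X**Y**Y = X**Y**X**Y**X**Y**X**Y**X**Y**X**Y"
    by (simp only: e diff_self minus_zero right_minus_eq)
  have b5: "Y**X**Y**X**Y**X**Y**X**Y**X**Y**Y**u = X**Y**X**Y**X**Y**X**Y**X**Y**X**Y**u" for u
    using arg_cong[OF a5, of "\<lambda>w. w * u"] by (simp add: algebra_simps)
  note r5 = a5 b5[simplified]
  have "(Y**X**Y**X) * (Y**X**Y**X**Y**X**Y**Y**X**Y) = (Y**X**Y**X**Y**X**Y**X**Y**X**Y**Y) * (X**Y)"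
    by (simp only: mult.assoc)
  then have e: "(Y**X**Y**X) * (- (Y**X**Y**X**Y**X**Y**X**Y**Y) - Y**X**Y**X**Y**X**Y**X**Y**X -
        X**Y**X**Y**X**Y**X**Y**Y**X - X**Y**X**Y**X**Y**X**Y**X**Y) = (X**Y**X**Y**X**Y**X**Y**X**Y**X**Y) *
        (X**Y)"
    by (simp only: a5 a4)
  have "Y**X**Y**X**Y**X**Y**X**Y**X**Y**X**Y**X - (- (X**Y**X**Y**X**Y**X**Y**X**Y**X**Y**X**Y)) = -
        ((Y**X**Y**X) * (- (Y**X**Y**X**Y**X**Y**X**Y**Y) - Y**X**Y**X**Y**X**Y**X**Y**X -
        X**Y**X**Y**X**Y**X**Y**Y**X - X**Y**X**Y**X**Y**X**Y**X**Y) - (X**Y**X**Y**X**Y**X**Y**X**Y**X**Y) *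
        (X**Y))"
    by (simp add: algebra_simps r0 r1) (simp add: algebra_simps r0 r1 r2 r3 r4 r5)
  \<comment> \<open>The sign rule for E8, \<open>(Y * X) ^ 7 = - ((X * Y) ^ 7)\<close>.\<close>
  then have a6: "Y**X**Y**X**Y**X**Y**X**Y**X**Y**X**Y**X = - (X**Y**X**Y**X**Y**X**Y**X**Y**X**Y**X**Y)"
    by (simp only: e diff_self minus_zero right_minus_eq)
  have b6: "Y**X**Y**X**Y**X**Y**X**Y**X**Y**X**Y**X**u = 0 - X**Y**X**Y**X**Y**X**Y**X**Y**X**Y**X**Y**u"
        for u
    using arg_cong[OF a6, of "\<lambda>w. w * u"] by (simp add: algebra_simps)
  note r6 = a6 b6[simplified]
  note r = r0 r1 r2 r3 r4 r5 r6
  note s = algebra_simps r gspan_closed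
  have "words {X, Y} 0 \<subseteq> gspan {1}" by (simp add: words_0 gspan_closed)
  then have "words {X, Y} (Suc 0) \<subseteq> gspan {X, Y}"
    by (rule words_step[where d = 0]) (simp add: s)
  then have "words {X, Y} 2 \<subseteq> gspan {X**Y, Y**X, Y**Y}"
    by (rule words_step[where d = 1, simplified, simplified numeral_2_eq_2[symmetric]]) (simp add: s)
  then have "words {X, Y} 3 \<subseteq> gspan {X**Y**X, X**Y**Y, Y**X**Y, Y**Y**X}"
    by (rule words_step[where d = 2, simplified]) (simp add: s)
  then have "words {X, Y} 4 \<subseteq> gspan {X**Y**X**Y, X**Y**Y**X, Y**X**Y**X, Y**X**Y**Y, Y**Y**X**Y}"
    by (rule words_step[where d = 3, simplified]) (simp add: s)
  then have "words {X, Y} 5 \<subseteq> gspan {X**Y**X**Y**X, X**Y**X**Y**Y, X**Y**Y**X**Y, Y**X**Y**X**Y,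
        Y**X**Y**Y**X, Y**Y**X**Y**X}"
    by (rule words_step[where d = 4, simplified]) (simp add: s)
  then have "words {X, Y} 6 \<subseteq> gspan {X**Y**X**Y**X**Y, X**Y**X**Y**Y**X, X**Y**Y**X**Y**X,
        Y**X**Y**X**Y**X, Y**X**Y**X**Y**Y, Y**X**Y**Y**X**Y}"
    by (rule words_step[where d = 5, simplified]) (simp add: s)
  then have "words {X, Y} 7 \<subseteq> gspan {X**Y**X**Y**X**Y**X, X**Y**X**Y**X**Y**Y, X**Y**X**Y**Y**X**Y,
        Y**X**Y**X**Y**X**Y, Y**X**Y**X**Y**Y**X, Y**X**Y**Y**X**Y**X}"
    by (rule words_step[where d = 6, simplified]) (simp add: s)
  then have "words {X, Y} 8 \<subseteq> gspan {X**Y**X**Y**X**Y**X**Y, X**Y**X**Y**X**Y**Y**X,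
        X**Y**X**Y**Y**X**Y**X, Y**X**Y**X**Y**X**Y**X, Y**X**Y**X**Y**X**Y**Y, Y**X**Y**X**Y**Y**X**Y}"
    by (rule words_step[where d = 7, simplified]) (simp add: s)
  then have "words {X, Y} 9 \<subseteq> gspan {X**Y**X**Y**X**Y**X**Y**X, X**Y**X**Y**X**Y**X**Y**Y,
        X**Y**X**Y**X**Y**Y**X**Y, Y**X**Y**X**Y**X**Y**X**Y, Y**X**Y**X**Y**X**Y**Y**X,
        Y**X**Y**X**Y**Y**X**Y**X}"
    by (rule words_step[where d = 8, simplified]) (simp add: s)
  then have "words {X, Y} 10 \<subseteq> gspan {X**Y**X**Y**X**Y**X**Y**X**Y, X**Y**X**Y**X**Y**X**Y**Y**X,
        X**Y**X**Y**X**Y**Y**X**Y**X, Y**X**Y**X**Y**X**Y**X**Y**X, Y**X**Y**X**Y**X**Y**X**Y**Y}"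
    by (rule words_step[where d = 9, simplified]) (simp add: s)
  then have "words {X, Y} 11 \<subseteq> gspan {X**Y**X**Y**X**Y**X**Y**X**Y**X,
        X**Y**X**Y**X**Y**X**Y**X**Y**Y, Y**X**Y**X**Y**X**Y**X**Y**X**Y, Y**X**Y**X**Y**X**Y**X**Y**Y**X}"
    by (rule words_step[where d = 10, simplified]) (simp add: s)
  then have "words {X, Y} 12 \<subseteq> gspan {X**Y**X**Y**X**Y**X**Y**X**Y**X**Y,
        X**Y**X**Y**X**Y**X**Y**X**Y**Y**X, Y**X**Y**X**Y**X**Y**X**Y**X**Y**X}"
    by (rule words_step[where d = 11, simplified]) (simp add: s)
  then have "words {X, Y} 13 \<subseteq> gspan {X**Y**X**Y**X**Y**X**Y**X**Y**X**Y**X,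
        Y**X**Y**X**Y**X**Y**X**Y**X**Y**X**Y}"
    by (rule words_step[where d = 12, simplified]) (simp add: s)
  then have "words {X, Y} 14 \<subseteq> gspan {X**Y**X**Y**X**Y**X**Y**X**Y**X**Y**X**Y}"
    by (rule words_step[where d = 13, simplified]) (simp add: s)
  moreover have "(X * Y) ^ 7 = X**Y**X**Y**X**Y**X**Y**X**Y**X**Y**X**Y" "(Y * X) ^ 7 =
        Y**X**Y**X**Y**X**Y**X**Y**X**Y**X**Y**X"
      "(X * Y) ^ 6 = X**Y**X**Y**X**Y**X**Y**X**Y**X**Y"
    by (simp_all add: numeral_eq_Suc mult.assoc)
  ultimately show ?thesis by (simp add: socle_rel_def Let_def algebra_simps r)
qed

text \<open>Since both squares vanish, only alternating words survive, and
  \<open>(X + Y) ^ (2 * k) = (X * Y) ^ k + (Y * X) ^ k\<close> for positive \<open>k\<close>. The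
  last relation therefore identifies the two alternating words of length \<open>2 * q\<close> up to
  sign; multiplying either by one more letter creates a square in one of its two forms.\<close>

lemma dihedral_socle_rel:
  fixes X Y :: "'r::ring_1"
  assumes X: "X * X = 0" and Y: "Y * Y = 0" and XY: "(X + Y) ^ (2 * q) = 0" and q: "q \<ge> 1"
  shows "socle_rel X Y q"
proof -
  have r: "X * (X * u) = 0" "Y * (Y * u) = 0" "u * X * X = 0" "u * Y * Y = 0" for u
    using X Y by (simp_all add: mult.assoc) (simp_all flip: mult.assoc)
  have pow: "(X * Y) ^ Suc k = X * (Y * (X * Y) ^ k)" "(Y * X) ^ Suc k = Y * (X * (Y * X) ^ k)"
    "(X * Y) ^ Suc k = (X * Y) ^ k * X * Y" "(Y * X) ^ Suc k = (Y * X) ^ k * Y * X" for k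
    by (simp_all only: power_Suc2 mult.assoc) (simp_all add: mult.assoc flip: power_Suc2)
  obtain p where p: "q = Suc p" using q by (cases q) auto
  have ann: "X * (X * Y) ^ Suc k = 0" "Y * (Y * X) ^ Suc k = 0" "(X * Y) ^ Suc k * Y = 0" "(Y * X) ^ Suc k * X = 0" for k
  proof -
    show "X * (X * Y) ^ Suc k = 0" "Y * (Y * X) ^ Suc k = 0" by (simp_all only: pow(1,2) r)
    show "(X * Y) ^ Suc k * Y = 0" "(Y * X) ^ Suc k * X = 0" by (simp_all only: pow(3,4) r)
  qed
  have "(X + Y) ^ (2 * Suc k) = (X * Y) ^ Suc k + (Y * X) ^ Suc k" for k
  proof (induction k)
    case 0 show ?case using X Y by (simp add: numeral_eq_Suc algebra_simps)
  next
    case (Suc k)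
    have "(X + Y) ^ (2 * Suc (Suc k)) = (X + Y) * ((X + Y) * (X + Y) ^ (2 * Suc k))" by simp
    also have "\<dots> = (X * Y + Y * X) * ((X * Y) ^ Suc k + (Y * X) ^ Suc k)"
      using X Y by (simp only: Suc.IH flip: mult.assoc) (simp add: algebra_simps)
    also have "\<dots> = (X * Y) ^ Suc (Suc k) + (Y * X) ^ Suc (Suc k)"
      by (simp only: distrib_left distrib_right mult.assoc ann pow(1)[of "Suc k"] pow(2)[of "Suc k"]
          mult_zero_right add_0_left add_0_right)
    finally show ?case .
  qed
  from this[of p] have yx: "(Y * X) ^ q = - ((X * Y) ^ q)"
    using XY by (simp add: p eq_neg_iff_add_eq_0 add.commute)
  have XF: "X * (X * Y) ^ q = 0" "(X * Y) ^ q * Y = 0" by (simp_all only: p ann)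
  have "Y * (Y * X) ^ q = 0" "(Y * X) ^ q * X = 0" by (simp_all only: p ann)
  with yx have FX: "Y * (X * Y) ^ q = 0" "(X * Y) ^ q * X = 0" by simp_all
  \<comment> \<open>For \<open>q = 1\<close> this is \<open>Y * Y = 0\<close>. For larger
    \<open>q\<close> the factor \<open>(X * Y) ^ (q - 1) * Y\<close> inside the product ends in a
    square.\<close>
  have VV: "Y * (X * Y) ^ (q - 1) * (Y * (X * Y) ^ (q - 1)) = 0"
  proof (cases p)
    case 0 then show ?thesis using Y by (simp add: p)
  next
    case (Suc p')
    have "(X * Y) ^ p * (Y * u) = 0" for u
      using ann(3)[of p'] by (simp only: Suc flip: mult.assoc) simp
    then show ?thesis by (simp add: p mult.assoc)
  qed
  have "words {X, Y} (2 * k) \<subseteq> {0, (X * Y) ^ k, (Y * X) ^ k}" for k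
  proof (induction k)
    case 0 show ?case by (simp add: words_0)
  next
    case (Suc k)
    have step: "w * a * b \<in> {0, (X * Y) ^ Suc k, (Y * X) ^ Suc k}"
      if w: "w \<in> {0, (X * Y) ^ k, (Y * X) ^ k}" and ab: "a \<in> {X, Y}" "b \<in> {X, Y}" for w a b
    proof (cases k)
      case 0
      then show ?thesis using w ab X Y by auto
    next
      case (Suc l)
      have "(Y * X) ^ k * X = 0" "(X * Y) ^ k * Y = 0" using ann by (simp_all only: Suc)
      then show ?thesis using w ab r(3,4) by (auto simp only: pow(3,4) insert_iff empty_iff mult_zero_left)
    qed
    have W: "words {X, Y} (2 * Suc k) = words {X, Y} (Suc (Suc (2 * k)))" by simp
    show ?case
    proof
      fix x assume "x \<in> words {X, Y} (2 * Suc k)"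
      then obtain w a b where "x = w * a * b" "w \<in> words {X, Y} (2 * k)" "a \<in> {X, Y}" "b \<in> {X, Y}"
        unfolding W words_Suc by blast
      moreover from this(2) Suc.IH have "w \<in> {0, (X * Y) ^ k, (Y * X) ^ k}" by (rule subsetD[rotated])
      ultimately show "x \<in> {0, (X * Y) ^ Suc k, (Y * X) ^ Suc k}" using step by (simp only:)
    qed
  qed
  from this[of q] have "words {X, Y} (2 * q) \<subseteq> gspan {(X * Y) ^ q}"
    by (auto simp: yx gspan_closed subset_iff)
  then show ?thesis using yx XF FX VV by (simp add: socle_rel_def Let_def)
qed

lemma socle_relD:
  assumes "socle_rel X Y q"
  shows "(Y * X) ^ q = - ((X * Y) ^ q)" "X * (X * Y) ^ q = 0" "(X * Y) ^ q * X = 0"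
    "Y * (X * Y) ^ q = 0" "(X * Y) ^ q * Y = 0" "Y * (X * Y) ^ (q - 1) * (Y * (X * Y) ^ (q - 1)) = 0"
    "words {X, Y} (2 * q) \<subseteq> gspan {(X * Y) ^ q}"
  using assms by (auto simp: socle_rel_def Let_def)

text \<open>The hypothesis on \<open>Z\<close> is the deformed relation at the exceptional vertex.
  Substituting \<open>Z = - X - Y - F\<close> turns words in three letters into combinations of
  words in two; from degree two on the terms with \<open>F\<close> drop out, because
  \<open>F\<close> is annihilated by \<open>X\<close>, \<open>Y\<close> and itself.\<close>

lemma socle_rel_words:
  fixes X Y Z :: "'r::ring_1" and q :: nat
  defines "F \<equiv> (X * Y) ^ q"
  assumes rel: "socle_rel X Y q" and q: "q \<ge> 1" and Z: "X + Y + Z + F = 0"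
  shows "words {X, Y, Z} (2 * q) \<subseteq> gspan {F}" and "d > 2 * q \<Longrightarrow> words {X, Y, Z} d \<subseteq> {0}"
proof -
  note F = socle_relD[OF rel, folded F_def]
  have Z: "Z = - X - Y - F" using Z by (simp add: eq_neg_iff_add_eq_0 algebra_simps)
  have ZZ: "c * Z = - (c * X) - c * Y - c * F" "Z * c = - (X * c) - Y * c - F * c" for c
    unfolding Z by (simp_all add: algebra_simps)
  have "F = X * (Y * (X * Y) ^ (q - 1))" using q by (cases q) (auto simp: F_def mult.assoc)
  then have FF: "F * F = 0" using F(3) by (metis mult.assoc mult_zero_left)
  have 2: "words {X, Y, Z} (Suc (Suc d)) \<subseteq> gspan (words {X, Y} (Suc (Suc d)))" for d
  proof (induction d)
    case 0
    have "words {X, Y} (Suc (Suc 0)) = {X * X, X * Y, Y * X, Y * Y}"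
      by (auto simp: words_Suc words_0)
    moreover have "a * b \<in> gspan {X * X, X * Y, Y * X, Y * Y}" if "a \<in> {X, Y, Z}" "b \<in> {X, Y, Z}" for a b
      using that by (elim insertE emptyE) (simp_all add: ZZ F(2-5) FF gspan_closed right_diff_distrib left_diff_distrib)
    ultimately show ?case by (auto simp: words_Suc words_0)
  next
    case (Suc d)
    have "b * a \<in> gspan (words {X, Y} (Suc (Suc (Suc d))))"
      if b: "b \<in> words {X, Y} (Suc (Suc d))" and a: "a \<in> {X, Y, Z}" for a b
    proof -
      obtain b' a' where ba: "b = b' * a'" "a' \<in> {X, Y}"
        using b unfolding words_Suc[of _ "Suc d"] by blast
      then have bF: "b * F = 0" using F(2,4) by (auto simp: mult.assoc)
      have "b * X \<in> gspan (words {X, Y} (Suc (Suc (Suc d))))" "b * Y \<in> gspan (words {X, Y} (Suc (Suc (Suc d))))"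
        using b unfolding words_Suc[of _ "Suc (Suc d)"] by (auto intro!: gspan_base)
      with a bF show ?thesis by (elim insertE emptyE) (simp_all add: ZZ gspan_closed)
    qed
    then show ?case
      unfolding words_Suc[of "{X, Y, Z}" "Suc (Suc d)"] using Suc.IH by (auto intro: gspan_mult_right)
  qed
  obtain p where p: "2 * q = Suc (Suc p)" using q by (cases q) auto
  show L: "words {X, Y, Z} (2 * q) \<subseteq> gspan {F}"
    using 2[of p] F(7) gspan_trans unfolding p by blast
  have "x = 0" if "x \<in> gspan {0}" for x :: 'r
    using that by induction auto
  moreover have "words {X, Y, Z} (Suc d) \<subseteq> {0}" if "words {X, Y, Z} d \<subseteq> {0}" for d
    using that by (auto simp: words_Suc)
  moreover have "words {X, Y, Z} (Suc (2 * q)) \<subseteq> gspan {0}"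
  proof
    fix x assume "x \<in> words {X, Y, Z} (Suc (2 * q))"
    then obtain w a where x: "x = w * a" "w \<in> words {X, Y, Z} (2 * q)" "a \<in> {X, Y, Z}"
      unfolding words_Suc by blast
    have "F * a = 0" using x(3) by (elim insertE emptyE) (simp_all add: ZZ F(2-5) FF)
    moreover have "w \<in> gspan {F}" using x(2) L by blast
    ultimately show "x \<in> gspan {0}" unfolding x by (intro gspan_mult_right[of w "{F}"]) (auto intro: gspan_0)
  qed
  ultimately have "words {X, Y, Z} (Suc (2 * q) + k) \<subseteq> {0}" for k
    by (induction k) auto
  then show "words {X, Y, Z} d \<subseteq> {0}" if "d > 2 * q"
    using that by (metis add.commute less_eqE Suc_leI)
qed

section \<open>Substitutions of arrows\<close>

definition path_hom :: "dyn \<Rightarrow> ((path \<Rightarrow> 'k::field) \<Rightarrow> path \<Rightarrow> 'k) \<Rightarrow> bool" where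
  "path_hom D \<Phi> \<longleftrightarrow> (\<forall>f g. elem D f \<longrightarrow> elem D g \<longrightarrow> elem D (\<Phi> f) \<and> \<Phi> (f + g) = \<Phi> f + \<Phi> g
       \<and> \<Phi> (pmult D f g) = pmult D (\<Phi> f) (\<Phi> g))
     \<and> (\<forall>c f. elem D f \<longrightarrow> \<Phi> (psmult c f) = psmult c (\<Phi> f)) \<and> (\<forall>v. \<Phi> (pel (v, [])) = pel (v, []))"

lemma pone_sum: "pone D = (\<Sum>v<nverts D. pel (v, []) :: path \<Rightarrow> 'k::field)"
proof (rule ext, clarify)
  fix v as
  have "(\<Sum>u<nverts D. pel (u, []) (v, as) :: 'k) = (\<Sum>u<nverts D. if u = v then (if as = [] then 1 else 0) else 0)"
    by (rule sum.cong) (auto simp: pel_def)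
  then show "pone D (v, as) = (\<Sum>v<nverts D. pel (v, []) :: path \<Rightarrow> 'k) (v, as)"
    by (simp add: sum_fun_apply pone_def)
qed

lemma path_hom_elem: "path_hom D \<Phi> \<Longrightarrow> elem D f \<Longrightarrow> elem D (\<Phi> f)"
  by (auto simp: path_hom_def)

lemma path_hom_pone: assumes "path_hom D \<Phi>" shows "\<Phi> (pone D) = (pone D :: path \<Rightarrow> 'k::field)"
proof -
  have "\<Phi> 0 = 0" using assms psmult_simps(3)[of "0 :: path \<Rightarrow> 'k"] elem_zero[of D] unfolding path_hom_def by (metis psmult_simps(3))
  then have "\<Phi> (\<Sum>v\<in>A. pel (v, [])) = (\<Sum>v\<in>A. pel (v, []))" if "A \<subseteq> {..<nverts D}" for A
    using that
  proof (induction A rule: infinite_finite_induct)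
    case (insert v A)
    have e: "elem D (\<Sum>v\<in>A. pel (v, []) :: path \<Rightarrow> 'k)" "elem D (pel (v, []) :: path \<Rightarrow> 'k)"
      using insert.prems by (auto intro!: elem_sum simp: valid_path_def)
    show ?case using insert assms e unfolding path_hom_def by simp
  qed auto
  then show ?thesis by (simp add: pone_sum)
qed

lemma alg_hom_comp: "alg_hom D h \<Longrightarrow> path_hom D \<Phi> \<Longrightarrow> alg_hom D (\<lambda>f. h (\<Phi> f))"
  by (auto simp: alg_hom_def path_hom_def)

text \<open>Substitutions that respect the relations and are inverse to each other on arrows induce
  an isomorphism. Each condition is stated for an arbitrary representation killing the relations in
  question, so it can be checked in a ring where they hold as equations; here it is applied to
  faithful representations of the two quotients.\<close>

lemma quot_alg_iso_subst:
  fixes R1 R2 :: "(path \<Rightarrow> 'k::field) set"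
  assumes D: "wf_dyn D" and \<Phi>: "path_hom D \<Phi>" and \<Psi>: "path_hom D \<Psi>"
    and R: "\<And>r. r \<in> R1 \<Longrightarrow> elem D r" "\<And>r. r \<in> R2 \<Longrightarrow> elem D r"
    and 1: "\<And>h r. alg_hom D h \<Longrightarrow> (\<And>r. r \<in> R2 \<Longrightarrow> h r = 0) \<Longrightarrow> r \<in> R1 \<Longrightarrow> h (\<Phi> r) = 0"
    and 2: "\<And>h r. alg_hom D h \<Longrightarrow> (\<And>r. r \<in> R1 \<Longrightarrow> h r = 0) \<Longrightarrow> r \<in> R2 \<Longrightarrow> h (\<Psi> r) = 0"
    and 3: "\<And>h a. alg_hom D h \<Longrightarrow> (\<And>r. r \<in> R1 \<Longrightarrow> h r = 0) \<Longrightarrow> a \<in> arrows D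
      \<Longrightarrow> h (\<Psi> (\<Phi> (arrow_el D a))) = h (arrow_el D a)"
    and 4: "\<And>h a. alg_hom D h \<Longrightarrow> (\<And>r. r \<in> R2 \<Longrightarrow> h r = 0) \<Longrightarrow> a \<in> arrows D
      \<Longrightarrow> h (\<Phi> (\<Psi> (arrow_el D a))) = h (arrow_el D a)"
  shows "quot_alg_iso D (ideal_gen D R1) (ideal_gen D R2)"
proof -
  note J = ideal_gen_ideal[of R1 D, OF R(1)] ideal_gen_ideal[of R2 D, OF R(2)]
  obtain h1 where h1: "alg_hom D h1" "\<And>f. elem D f \<Longrightarrow> h1 f = 0 \<longleftrightarrow> f \<in> ideal_gen D R1"
    using ideal_hom[OF J(1) D] by metis
  obtain h2 where h2: "alg_hom D h2" "\<And>f. elem D f \<Longrightarrow> h2 f = 0 \<longleftrightarrow> f \<in> ideal_gen D R2"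
    using ideal_hom[OF J(2) D] by metis
  have z1: "h1 r = 0" if "r \<in> R1" for r using that h1(2) R(1) ideal_gen.gen by blast
  have z2: "h2 r = 0" if "r \<in> R2" for r using that h2(2) R(2) ideal_gen.gen by blast
  note c = alg_hom_comp[OF h2(1) \<Phi>] alg_hom_comp[OF h1(1) \<Psi>]
  have f: "\<Phi> f \<in> ideal_gen D R2" if "f \<in> ideal_gen D R1" for f
    using hom_ideal_gen[OF c(1) R(1) 1[OF h2(1) z2] that] ideal_elem[OF J(1) that] h2(2) path_hom_elem[OF \<Phi>] by blast
  have g: "\<Psi> f \<in> ideal_gen D R1" if "f \<in> ideal_gen D R2" for f
    using hom_ideal_gen[OF c(2) R(2) 2[OF h1(1) z1] that] ideal_elem[OF J(2) that] h1(2) path_hom_elem[OF \<Psi>] by blast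
  have gf: "h1 (\<Psi> (\<Phi> f)) = h1 f" if "elem D f" for f
    using hom_eqI[OF alg_hom_comp[OF c(2) \<Phi>] h1(1) D _ 3[OF h1(1) z1] that] \<Phi> \<Psi>
    unfolding path_hom_def by metis
  have fg: "h2 (\<Phi> (\<Psi> f)) = h2 f" if "elem D f" for f
    using hom_eqI[OF alg_hom_comp[OF c(1) \<Psi>] h2(1) D _ 4[OF h2(1) z2] that] \<Phi> \<Psi>
    unfolding path_hom_def by metis
  show ?thesis
  proof (rule quot_alg_isoI[OF J, of \<Phi>])
    show "\<Phi> f \<in> ideal_gen D R2 \<longleftrightarrow> f \<in> ideal_gen D R1" if "elem D f" for f
      using f g[of "\<Phi> f"] gf[OF that] h1(2)[OF that] h1(2)[of "\<Psi> (\<Phi> f)"] that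
        path_hom_elem[OF \<Psi> path_hom_elem[OF \<Phi> that]] by metis
    show "\<exists>g. elem D g \<and> \<Phi> g - f \<in> ideal_gen D R2" if "elem D f" for f
      using that fg h2 path_hom_elem[OF \<Phi>] path_hom_elem[OF \<Psi>]
      by (intro exI[of _ "\<Psi> f"]) (simp add: hom_minus flip: h2(2))
  qed (use \<Phi> path_hom_pone in \<open>auto simp: path_hom_def\<close>)
qed

lemma subst_path_hom:
  fixes G :: "arr \<Rightarrow> path \<Rightarrow> 'k::field"
  assumes "wf_dyn D" "\<And>a. a \<in> arrows D \<Longrightarrow> elem D (G a)"
      "\<And>a. a \<in> arrows D \<Longrightarrow> pmult D (pel (src D a, [])) (G a) = G a"
      "\<And>a. a \<in> arrows D \<Longrightarrow> pmult D (G a) (pel (tgt D a, [])) = G a"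
  obtains \<Phi> where "path_hom D \<Phi>" "\<And>a. a \<in> arrows D \<Longrightarrow> \<Phi> (arrow_el D a) = G a"
  using subst_hom[OF assms] unfolding path_hom_def by (metis (no_types, lifting))

definition out :: "dyn \<Rightarrow> nat \<Rightarrow> arr set" where
  "out D v = {a \<in> arrows D. src D a = v}"

lemma finite_arrows [simp]: "finite (arrows D)"
proof -
  have "arrows D \<subseteq> Ar ` {..nverts D} \<union> Br ` {..nverts D} \<union> {Ep}"
    by (auto simp: arrows_def)
  then show ?thesis by (rule finite_subset) simp
qed

lemma bar_arrows [simp]: "bar a \<in> arrows D \<longleftrightarrow> a \<in> arrows D"
  by (cases a) (auto simp: arrows_def)

lemma src_bar [simp]: "src D (bar a) = tgt D a" and tgt_bar [simp]: "tgt D (bar a) = src D a"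
  by (cases a; simp)+

lemma bar_bar [simp]: "bar (bar a) = a"
  by (cases a) auto

lemma mesh_rel_eq: "mesh_rel D v = (\<Sum>a\<in>out D v. pel (v, [a, bar a]))"
proof (rule ext)
  fix p
  show "mesh_rel D v p = (\<Sum>a\<in>out D v. pel (v, [a, bar a])) p"
    unfolding mesh_rel_def sum_fun_apply out_def
    by (rule sum.cong) (auto simp: arrow_el_eq pmult_pel)
qed

lemma elem_mesh_rel [simp]: "v < nverts D \<Longrightarrow> elem D (mesh_rel D v)"
  by (auto simp: mesh_rel_eq out_def valid_path_def intro!: elem_sum)

lemma hom_mesh_rel:
  assumes "alg_hom D h" "wf_dyn D"
  shows "h (mesh_rel D v) = (\<Sum>a\<in>out D v. h (arrow_el D a) * h (arrow_el D (bar a)))"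
proof -
  have "pel (v, [a, bar a]) = pmult D (arrow_el D a) (arrow_el D (bar a))" if "a \<in> out D v" for a
    using that by (simp add: arrow_el_eq pmult_pel out_def)
  then have "mesh_rel D v = (\<Sum>a\<in>out D v. pmult D (arrow_el D a) (arrow_el D (bar a)) :: path \<Rightarrow> 'a)"
    unfolding mesh_rel_eq by (rule sum.cong[OF refl])
  moreover have el: "elem D (arrow_el D a :: path \<Rightarrow> 'a)" "elem D (arrow_el D (bar a) :: path \<Rightarrow> 'a)"
    if "a \<in> out D v" for a
    using that assms by (simp_all add: out_def)
  ultimately have "h (mesh_rel D v) = (\<Sum>a\<in>out D v. h (pmult D (arrow_el D a) (arrow_el D (bar a))))"
    by (simp only:) (rule hom_sum[OF assms(1)], rule elem_pmult, erule el(1), erule el(2))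
  also have "\<dots> = (\<Sum>a\<in>out D v. h (arrow_el D a) * h (arrow_el D (bar a)))"
    by (rule sum.cong) (use el hom_mult[OF assms(1)] in auto)
  finally show ?thesis .
qed

text \<open>In types D and E, the vertex of the second short arm that is adjacent to the exceptional
  vertex. That arm is a single vertex in type D and the chain from 1 through 2 in type E.\<close>

fun yi :: "dyn \<Rightarrow> nat" where
  "yi (Dq n) = 1" | "yi (Eq n) = 2" | "yi (Lq n) = 0"

lemma out_arm:
  assumes "wf_dyn D" "exc_vertex D < v" "v < nverts D"
  shows "out D v = (if v + 1 < nverts D then {Br (v - 1), Ar v} else {Br (v - 1)})"
  using assms by (cases D; auto simp: out_def arrows_def wf_dyn_def elim!: tgtA.elims split: if_splits)

lemma out_exc:
  assumes "wf_dyn D" "\<not> is_L D"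
  shows "out D (exc_vertex D) = {Br 0, Br (yi D), Ar (exc_vertex D)}"
  using assms by (cases D; auto simp: out_def arrows_def wf_dyn_def split: if_splits)

lemma out_Lq: "n \<ge> 2 \<Longrightarrow> out (Lq n) 0 = {Ep, Ar 0}"
  by (auto simp: out_def arrows_def)

lemma out_0: "wf_dyn D \<Longrightarrow> \<not> is_L D \<Longrightarrow> out D 0 = {Ar 0}"
  by (cases D; auto simp: out_def arrows_def wf_dyn_def split: if_splits)

lemma out_1: "wf_dyn D \<Longrightarrow> \<not> is_L D \<Longrightarrow> out D 1 = {Ar 1}"
  by (cases D; auto simp: out_def arrows_def wf_dyn_def split: if_splits)

lemma out_Eq_2: "n \<ge> 5 \<Longrightarrow> out (Eq n) 2 = {Br 1, Ar 2}"
  by (auto simp: out_def arrows_def split: if_splits)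

section \<open>Types D and E\<close>

definition star :: "dyn \<Rightarrow> bool" where
  "star D \<longleftrightarrow> (\<exists>m\<ge>2. D = Dq (2 * m)) \<or> D = Eq 7 \<or> D = Eq 8"

text \<open>The number \<open>q\<close> with \<open>f = (xy)^q\<close>: it is \<open>m - 1\<close>
  for \<open>Dq (2 * m)\<close>, 4 for E7 and 7 for E8. The path occurring in \<open>f\<close> has
  length \<open>4 * q\<close>.\<close>

fun qexp :: "dyn \<Rightarrow> nat" where
  "qexp (Dq n) = n div 2 - 1" | "qexp (Eq n) = 3 * n - 17" | "qexp (Lq n) = 0"

definition xe :: "dyn \<Rightarrow> path \<Rightarrow> 'k::field" where
  "xe D = pmult D (arrow_el D (Br 0)) (arrow_el D (Ar 0))"

definition ye :: "dyn \<Rightarrow> path \<Rightarrow> 'k::field" where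
  "ye D = pmult D (arrow_el D (Br (yi D))) (arrow_el D (Ar (yi D)))"

definition fe :: "dyn \<Rightarrow> path \<Rightarrow> 'k::field" where
  "fe D = ppow D (pmult D (xe D) (ye D)) (qexp D)"

text \<open>The exponent counts the vertices of the long arm, the exceptional one included. This
  equals \<open>2 * m - 2\<close> for \<open>Dq (2 * m)\<close> and \<open>n - 3\<close> for
  \<open>Eq n\<close>.\<close>

definition ge :: "dyn \<Rightarrow> path \<Rightarrow> 'k::field" where
  "ge D = ppow D (xe D + ye D) (nverts D - exc_vertex D)"

definition rels :: "dyn \<Rightarrow> 'k::field \<Rightarrow> (path \<Rightarrow> 'k) set" where
  "rels D \<delta> = {mesh_rel D v | v. v < nverts D \<and> v \<noteq> exc_vertex D}
      \<union> {mesh_rel D (exc_vertex D) + psmult \<delta> (fe D), ge D}"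

lemma star_cases:
  assumes "star D"
  obtains (D) m where "m \<ge> 2" "D = Dq (2 * m)" | (E7) "D = Eq 7" | (E8) "D = Eq 8"
  using assms by (auto simp: star_def)

lemma star_wf: "star D \<Longrightarrow> wf_dyn D" and star_not_L: "star D \<Longrightarrow> \<not> is_L D"
  by (auto simp: star_def wf_dyn_def)

lemma star_arrows [simp]:
  assumes "star D"
  shows "Ar 0 \<in> arrows D" "Br 0 \<in> arrows D" "Ar (yi D) \<in> arrows D" "Br (yi D) \<in> arrows D"
    "Ar (exc_vertex D) \<in> arrows D" "Br (exc_vertex D) \<in> arrows D"
  using assms by (auto simp: star_def arrows_def)

lemma star_tgt [simp]:
  assumes "star D"
  shows "tgtA D 0 = exc_vertex D" "tgtA D (yi D) = exc_vertex D" "exc_vertex D < nverts D"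
    "exc_vertex D \<noteq> 0" "yi D \<noteq> 0" "yi D \<noteq> exc_vertex D" "0 < nverts D" "yi D < nverts D"
    "yi D < exc_vertex D" "1 < exc_vertex D"
  using assms by (auto simp: star_def)

lemma star_qexp: "star D \<Longrightarrow> qexp D \<ge> 1" "star D \<Longrightarrow> nverts D - exc_vertex D \<ge> 2"
  by (auto simp: star_def)

lemma star_elem [simp]:
  assumes "star D"
  shows "elem D (xe D)" "elem D (ye D)" "elem D (fe D)" "elem D (ge D)"
  using assms star_wf[OF assms] by (auto simp: xe_def ye_def fe_def ge_def)

lemma rels_elem: "star D \<Longrightarrow> r \<in> rels D \<delta> \<Longrightarrow> elem D r"
  by (auto simp: rels_def)

lemma hom_mesh_exc:
  assumes "star D" "alg_hom D h"
  shows "h (mesh_rel D (exc_vertex D)) = h (xe D) + h (ye D)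
    + h (arrow_el D (Ar (exc_vertex D))) * h (arrow_el D (Br (exc_vertex D)))"
  using assms star_wf[OF assms(1)] star_not_L[OF assms(1)] star_tgt[OF assms(1)]
  by (simp add: hom_mesh_rel out_exc xe_def ye_def hom_mult add.assoc)

text \<open>The mesh relation at vertex 0 says \<open>a_0 b_0 = 0\<close>, whence
  \<open>x^2 = 0\<close>. In type D the one at vertex 1 gives \<open>y^2 = 0\<close> likewise. In
  type E, \<open>a_2 b_2 = - b_1 a_1\<close> at vertex 2 and \<open>a_1 b_1 = 0\<close> at vertex 1
  give \<open>(a_2 b_2)^2 = 0\<close>, whence \<open>y^3 = 0\<close>. The hypotheses hold for every
  value of the deformation parameter, so the local facts are available in all the quotients
  compared.\<close>

lemma star_socle_rel:
  assumes D: "star D" and h: "alg_hom D h"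
    and mesh: "\<And>v. v < nverts D \<Longrightarrow> v \<noteq> exc_vertex D \<Longrightarrow> h (mesh_rel D v) = 0" and g: "h (ge D) = 0"
  shows "socle_rel (h (xe D)) (h (ye D)) (qexp D)"
proof -
  note wf = star_wf[OF D] and nL = star_not_L[OF D]
  let ?A = "\<lambda>a. h (arrow_el D a)"
  have X: "h (xe D) = ?A (Br 0) * ?A (Ar 0)" and Y: "h (ye D) = ?A (Br (yi D)) * ?A (Ar (yi D))"
    using D h wf by (simp_all add: xe_def ye_def hom_mult)
  have "?A (Ar 0) * ?A (Br 0) = 0"
    using mesh[of 0] D hom_mesh_rel[OF h wf, of 0] by (simp add: out_0[OF wf nL])
  then have XX: "h (xe D) * h (xe D) = 0"
    by (simp add: X mult.assoc) (simp flip: mult.assoc)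
  have ab1: "?A (Ar 1) * ?A (Br 1) = 0"
    using mesh[of 1] D star_tgt[OF D] hom_mesh_rel[OF h wf, of 1] out_1[OF wf nL] by simp
  have "Suc (nverts D - exc_vertex D - 1) = nverts D - exc_vertex D"
    using star_tgt(3)[OF D] by simp
  then have XY: "(h (xe D) + h (ye D)) ^ (nverts D - exc_vertex D) = 0"
    using g hom_ppow[OF wf h, of "xe D + ye D" "nverts D - exc_vertex D - 1"] D
    by (simp add: ge_def hom_add[OF h])
  have E: "h (ye D) * (h (ye D) * h (ye D)) = 0" if "D = Eq n" "n \<ge> 5" for n
  proof -
    have "?A (Br 1) * ?A (Ar 1) + ?A (Ar 2) * ?A (Br 2) = 0"
      using mesh[of 2] that hom_mesh_rel[OF h wf, of 2] by (simp add: out_Eq_2)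
    then have "?A (Ar 2) * ?A (Br 2) = - (?A (Br 1) * ?A (Ar 1))" by (simp add: eq_neg_iff_add_eq_0 add.commute)
    then have "(?A (Ar 2) * ?A (Br 2)) * (?A (Ar 2) * ?A (Br 2)) = ?A (Br 1) * (?A (Ar 1) * ?A (Br 1)) * ?A (Ar 1)"
      by (simp add: mult.assoc)
    then have "?A (Br 2) * ((?A (Ar 2) * ?A (Br 2)) * (?A (Ar 2) * ?A (Br 2))) * ?A (Ar 2) = 0"
      using ab1 by simp
    then show ?thesis using that Y by (simp add: mult.assoc)
  qed
  show ?thesis
    using D
  proof (cases rule: star_cases)
    case (D m)
    have "h (ye D) * h (ye D) = ?A (Br 1) * (?A (Ar 1) * ?A (Br 1)) * ?A (Ar 1)"
      by (simp add: Y mult.assoc) (simp add: D(2))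
    then have "h (ye D) * h (ye D) = 0" using ab1 by simp
    moreover have "nverts D - exc_vertex D = 2 * qexp D" using D by simp
    ultimately show ?thesis
      using XX XY D(1) by (intro dihedral_socle_rel) (auto simp: D(2))
  next
    case E7 then show ?thesis using e7_socle_rel[OF XX E[OF E7]] XY by simp
  next
    case E8 then show ?thesis using e8_socle_rel[OF XX E[OF E8]] XY by simp
  qed
qed

text \<open>The factor \<open>u\<close> absorbs exponent 0, where \<open>ppow\<close> is
  \<open>pone D\<close> while the ring power is the identity operator. This case occurs in
  \<open>we\<close> when \<open>qexp D = 1\<close>.\<close>

lemma hom_mult_ppow:
  assumes "alg_hom D h" "wf_dyn D" "elem D f" "elem D u"
  shows "h (pmult D u (ppow D f k)) = h u * h f ^ k"
  using assms(4)
proof (induction k arbitrary: u)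
  case 0 then show ?case using assms by simp
next
  case (Suc k)
  have "h (pmult D u (ppow D f (Suc k))) = h (pmult D (pmult D u f) (ppow D f k))"
    by (simp add: pmult_assoc)
  then show ?case using Suc assms by (simp add: hom_mult mult.assoc)
qed

lemma hom_fe:
  assumes "star D" "alg_hom D h" shows "h (fe D) = (h (xe D) * h (ye D)) ^ qexp D"
proof -
  obtain k where k: "qexp D = Suc k" using star_qexp(1)[OF assms(1)] by (cases "qexp D") auto
  show ?thesis
    using hom_ppow[OF star_wf[OF assms(1)] assms(2), of "pmult D (xe D) (ye D)" k] assms
    by (simp only: fe_def k) (simp add: hom_mult)
qed

definition we :: "dyn \<Rightarrow> path \<Rightarrow> 'k::field" where
  "we D = pmult D (ye D) (ppow D (pmult D (xe D) (ye D)) (qexp D - 1))"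

definition star_im :: "dyn \<Rightarrow> 'k::field \<Rightarrow> arr \<Rightarrow> path \<Rightarrow> 'k" where
  "star_im D c a = (if a = Ar 0 then arrow_el D a + psmult c (pmult D (arrow_el D a) (we D))
     else if a = Br 0 then arrow_el D a - psmult c (pmult D (we D) (arrow_el D a)) else arrow_el D a)"

lemma arrow_el_units:
  "pmult D (pel (src D a, [])) (arrow_el D a) = arrow_el D a"
  "pmult D (arrow_el D a) (pel (tgt D a, [])) = arrow_el D a"
  by (simp_all add: arrow_el_eq pmult_pel)

lemma we_units:
  assumes "star D"
  shows "pmult D (pel (exc_vertex D, [])) (we D) = (we D :: path \<Rightarrow> 'k::field)" "pmult D (we D) (pel (exc_vertex D, [])) = (we D :: path \<Rightarrow> 'k::field)"
proof -
  let ?e = "pel (exc_vertex D, []) :: path \<Rightarrow> 'k"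
  have x: "pmult D ?e (xe D) = xe D" "pmult D (xe D) ?e = xe D"
    and y: "pmult D ?e (ye D) = ye D" "pmult D (ye D) ?e = ye D"
    using assms by (simp_all add: xe_def ye_def arrow_el_eq pmult_pel)
  \<comment> \<open>At exponent 0 the power is the unit of the whole path algebra, so it commutes
    with \<open>?e\<close> without being fixed by it; the factor \<open>ye D\<close> in
    \<open>we D\<close> supplies the rest.\<close>
  have p: "pmult D (ppow D (pmult D (xe D) (ye D)) k) ?e = pmult D ?e (ppow D (pmult D (xe D) (ye D)) k)" for k
  proof (induction k)
    case 0 then show ?case using assms star_wf[OF assms] by (simp add: valid_path_def)
  next
    case (Suc k)
    then show ?case by (simp add: pmult_assoc) (metis pmult_assoc x(1) y(2))
  qed
  show "pmult D ?e (we D) = we D" by (simp add: we_def y flip: pmult_assoc)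
  show "pmult D (we D) ?e = we D" by (simp add: we_def pmult_assoc p) (simp add: y flip: pmult_assoc)
qed

lemma star_we_elem [simp]: "star D \<Longrightarrow> elem D (we D)"
  using star_wf by (simp add: we_def)

lemma star_subst:
  assumes D: "star D"
  obtains \<Phi> where "path_hom D \<Phi>" "\<And>a. a \<in> arrows D \<Longrightarrow> \<Phi> (arrow_el D a) = star_im D (c :: 'k::field) a"
proof (rule subst_path_hom[OF star_wf[OF D], of "star_im D c"])
  fix a assume a: "a \<in> arrows D"
  show "elem D (star_im D c a)" using D a star_wf[OF D] by (simp add: star_im_def)
  show "pmult D (pel (src D a, [])) (star_im D c a) = star_im D c a"
    using D we_units[OF D, where 'k = 'k] arrow_el_units[of D a]
    by (auto simp: star_im_def simp flip: pmult_assoc)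
  show "pmult D (star_im D c a) (pel (tgt D a, [])) = star_im D c a"
    using D we_units[OF D, where 'k = 'k] arrow_el_units[of D a]
    by (auto simp: star_im_def pmult_assoc)
qed (use that in blast)

lemma scale_double: "scale (2 * c) F = scale c F + scale c F"
  by (simp only: mult_2 scale_add)

lemma sum_pow:
  fixes S G :: "'r::ring_1"
  assumes "S * G = 0" "G * S = 0" "G * G = 0" "n \<ge> 2" shows "(S + G) ^ n = S ^ n"
proof -
  have "(S + G) ^ Suc (Suc k) = S ^ Suc (Suc k)" for k
  proof (induction k)
    case 0 show ?case using assms by (simp add: algebra_simps)
  next
    case (Suc k)
    have "G * S ^ Suc (Suc k) = 0" using assms(2) by (simp flip: mult.assoc)
    then show ?case
      by (simp only: power_Suc[of _ "Suc (Suc k)"] Suc.IH distrib_right add_0_right)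
  qed
  from this[of "n - 2"] show ?thesis using assms(4) by (simp add: Suc_diff_Suc numeral_2_eq_2 del: power_Suc)
qed

text \<open>Everything follows from \<open>x w = f\<close>, \<open>w x = -f\<close> and
  \<open>w^2 = 0\<close>. The first two shift \<open>x\<close> by \<open>2 c f\<close>. The third
  preserves the mesh relation at vertex 0 and gives \<open>(1 + c w)(1 - c w) = 1\<close>, so that
  the substitution with \<open>- c\<close> is the inverse. Since \<open>x\<close> and
  \<open>y\<close> annihilate \<open>f\<close>, the elements \<open>f\<close>, \<open>w\<close> and
  \<open>(x + y)^k\<close> with \<open>k \<ge> 2\<close> keep their values.\<close>

lemma star_hom_subst:
  fixes h :: "(path \<Rightarrow> 'k::field) \<Rightarrow> 'k endo"
  assumes D: "star D" and h: "alg_hom D h"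
    and mesh: "\<And>v. v < nverts D \<Longrightarrow> v \<noteq> exc_vertex D \<Longrightarrow> h (mesh_rel D v) = 0" and g: "h (ge D) = 0"
    and \<Phi>: "path_hom D \<Phi>" "\<And>a. a \<in> arrows D \<Longrightarrow> \<Phi> (arrow_el D a) = star_im D c a"
  shows "v < nverts D \<Longrightarrow> v \<noteq> exc_vertex D \<Longrightarrow> h (\<Phi> (mesh_rel D v)) = 0"
    and "h (\<Phi> (mesh_rel D (exc_vertex D))) = h (mesh_rel D (exc_vertex D)) + scale (c + c) (h (fe D))"
    and "h (\<Phi> (fe D)) = h (fe D)" and "h (\<Phi> (ge D)) = 0"
    and "\<Psi> = (\<lambda>f. h (\<Phi> f)) \<Longrightarrow> a \<in> arrows D \<Longrightarrow> \<Psi> (star_im D (- c) a) = h (arrow_el D a)"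
proof -
  note wf = star_wf[OF D] and nL = star_not_L[OF D]
  define k where "k = (\<lambda>f. h (\<Phi> f))"
  have k: "alg_hom D k" unfolding k_def by (rule alg_hom_comp[OF h \<Phi>(1)])
  let ?A = "\<lambda>a. h (arrow_el D a)"
  define X Y where "X = h (xe D)" and "Y = h (ye D)"
  define q where "q = qexp D"
  define W where "W = Y * (X * Y) ^ (q - 1)"
  define F where "F = (X * Y) ^ q"
  obtain p where p: "q = Suc p" using star_qexp(1)[OF D] by (cases q) (auto simp: q_def)
  note soc = socle_relD[OF star_socle_rel[OF D h mesh g], folded X_def Y_def q_def, folded F_def W_def]
  have hW: "h (we D) = W"
    unfolding we_def W_def X_def Y_def q_def using hom_mult_ppow[OF h wf] D by (simp add: hom_mult[OF h])
  have kA: "k (arrow_el D (Ar 0)) = ?A (Ar 0) + scale c (?A (Ar 0) * W)"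
    "k (arrow_el D (Br 0)) = ?A (Br 0) - scale c (W * ?A (Br 0))"
    using D wf hW
    by (simp_all add: k_def \<Phi> star_im_def hom_add[OF h] hom_minus[OF h] hom_psmult[OF h] hom_mult[OF h])
  have kB: "k (arrow_el D a) = ?A a" if "a \<in> arrows D" "a \<noteq> Ar 0" "a \<noteq> Br 0" for a
    using that by (simp add: k_def \<Phi> star_im_def)
  have X: "X = ?A (Br 0) * ?A (Ar 0)" and Y: "Y = ?A (Br (yi D)) * ?A (Ar (yi D))"
    using D h wf by (simp_all add: X_def Y_def xe_def ye_def hom_mult)
  have XW: "X * W = F" by (simp add: F_def W_def p mult.assoc)
  have pc: "(X * Y) ^ j * X = X * (Y * X) ^ j" for j
    by (induction j) (simp_all add: mult.assoc)
  \<comment> \<open>Moving \<open>X\<close> through the power turns \<open>W * X\<close> into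
    \<open>(Y * X) ^ q\<close>, where the sign rule applies.\<close>
  have WX: "W * X = - F"
    using soc(1) by (simp add: W_def p mult.assoc pc)
  have FW: "F * W = 0" unfolding W_def using soc(5) by (simp flip: mult.assoc)
  have WF: "W * F = 0" using WX FW by (metis XW minus_mult_left mult.assoc neg_0_equal_iff_equal)
  have FF: "F * F = 0" using soc(3) by (metis XW mult.assoc mult_zero_left)
  have "k (xe D) = k (arrow_el D (Br 0)) * k (arrow_el D (Ar 0))"
    using D wf by (simp add: xe_def hom_mult[OF k])
  also have "\<dots> = X + scale c (X * W) - scale c (W * X) - scale (c * c) (W * (X * W))"
    by (simp add: kA X algebra_simps)
  also have "\<dots> = X + scale (c + c) F"
    by (simp add: XW WX WF scale_double)
  finally have kx: "k (xe D) = X + scale (c + c) F" .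
  have ky: "k (ye D) = Y"
    using D wf star_tgt(5)[OF D] by (simp add: ye_def hom_mult[OF k] kB Y)
  have kxy: "k (pmult D (xe D) (ye D)) = X * Y"
    using D by (simp add: hom_mult[OF k] kx ky distrib_right soc)
  have kf: "k (fe D) = F"
    using hom_fe[OF D k] kxy D by (simp add: hom_mult[OF k] F_def q_def)
  have hf: "h (fe D) = F"
    using hom_fe[OF D h] by (simp add: F_def X_def Y_def q_def)
  have kw: "k (we D) = W"
    unfolding we_def W_def q_def[symmetric] using hom_mult_ppow[OF k wf] D by (simp add: kxy ky)
  \<comment> \<open>The two terms linear in \<open>c\<close> cancel and the quadratic one contains
    \<open>W * W\<close>.\<close>
  have k0: "k (arrow_el D (Ar 0)) * k (arrow_el D (Br 0)) = 0"
  proof -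
    have "?A (Ar 0) * ?A (Br 0) = 0"
      using mesh[of 0] D hom_mesh_rel[OF h wf, of 0] by (simp add: out_0[OF wf nL])
    moreover have "W * (W * u) = 0" for u using soc(6) by (simp flip: mult.assoc)
    ultimately show ?thesis
      by (simp add: kA distrib_right right_diff_distrib mult.assoc)
  qed
  show m: "h (\<Phi> (mesh_rel D v)) = 0" if v: "v < nverts D" "v \<noteq> exc_vertex D" for v
  proof (cases "v = 0")
    case True
    then show ?thesis using k0 hom_mesh_rel[OF k wf, of 0] by (simp add: out_0[OF wf nL] k_def)
  next
    case False
    have "k (mesh_rel D v) = h (mesh_rel D v)"
      unfolding hom_mesh_rel[OF k wf] hom_mesh_rel[OF h wf]
    proof (rule sum.cong[OF refl])
      fix a assume "a \<in> out D v"
      then have a: "a \<in> arrows D" "a \<noteq> Ar 0" "a \<noteq> Br 0"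
        using False v(2) star_tgt(1)[OF D] by (auto simp: out_def)
      then have "bar a \<noteq> Ar 0" "bar a \<noteq> Br 0" by (cases a; simp)+
      with a show "k (arrow_el D a) * k (arrow_el D (bar a)) = ?A a * ?A (bar a)"
        by (simp add: kB)
    qed
    then show ?thesis using mesh[OF v] by (simp add: k_def)
  qed
  show "h (\<Phi> (mesh_rel D (exc_vertex D))) = h (mesh_rel D (exc_vertex D)) + scale (c + c) (h (fe D))"
    using hom_mesh_exc[OF D k] hom_mesh_exc[OF D h] kx ky hf kB D
    by (simp add: k_def X_def Y_def algebra_simps)
  show "h (\<Phi> (fe D)) = h (fe D)" using kf hf by (simp add: k_def)
  have pow: "u (ge D) = (u (xe D) + u (ye D)) ^ (nverts D - exc_vertex D)" if u: "alg_hom D u" for u :: "(path \<Rightarrow> 'k) \<Rightarrow> 'k endo"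
  proof -
    have "Suc (nverts D - exc_vertex D - 1) = nverts D - exc_vertex D"
      using star_tgt(3)[OF D] by simp
    then show ?thesis
      using hom_ppow[OF wf u, of "xe D + ye D" "nverts D - exc_vertex D - 1"] D
      by (simp add: ge_def hom_add[OF u])
  qed
  have "k (ge D) = (X + Y + scale (c + c) F) ^ (nverts D - exc_vertex D)"
    unfolding pow[OF k] kx ky by (simp add: algebra_simps)
  also have "\<dots> = (X + Y) ^ (nverts D - exc_vertex D)"
  proof (rule sum_pow)
    show "scale (c + c) F * scale (c + c) F = 0" by (simp add: FF)
  qed (use star_qexp(2)[OF D] in \<open>auto simp: distrib_left distrib_right soc\<close>)
  finally show "h (\<Phi> (ge D)) = 0" using g pow[OF h] by (simp add: k_def X_def Y_def)
  show "\<Psi> (star_im D (- c) a) = h (arrow_el D a)" if \<Psi>: "\<Psi> = (\<lambda>f. h (\<Phi> f))" and a: "a \<in> arrows D"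
  proof -
    have "k (star_im D (- c) a) = ?A a"
    proof -
      have W: "u * W * W = 0" "W * (W * u) = 0" for u
        using soc(6) by (simp_all add: mult.assoc) (simp flip: mult.assoc)
      show ?thesis
        using a D wf by (cases "a = Ar 0"; cases "a = Br 0")
         (auto simp: star_im_def hom_add[OF k] hom_minus[OF k] hom_psmult[OF k] hom_mult[OF k] hom_uminus[OF k] 
            kA kB kw psmult_uminus distrib_right right_diff_distrib W)
    qed
    then show ?thesis by (simp add: \<Psi> k_def)
  qed
qed

text \<open>The auxiliary facts \<open>kill\<close> and \<open>comp\<close> are stated for an
  arbitrary coefficient \<open>d\<close>, so that each serves both \<open>\<Phi>\<close> with
  \<open>c\<close> and \<open>\<Psi>\<close> with \<open>- c\<close>.\<close>

lemma star_iso: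
  fixes \<delta> c :: "'k::field"
  assumes D: "star D" and \<delta>: "\<delta> + (c + c) = \<delta>'"
  shows "quot_alg_iso D (ideal_gen D (rels D \<delta>)) (ideal_gen D (rels D \<delta>'))"
proof -
  note wf = star_wf[OF D]
  obtain \<Phi> where \<Phi>: "path_hom D \<Phi>" "\<And>a. a \<in> arrows D \<Longrightarrow> \<Phi> (arrow_el D a) = star_im D c a"
    using star_subst[OF D] by metis
  obtain \<Psi> where \<Psi>: "path_hom D \<Psi>" "\<And>a. a \<in> arrows D \<Longrightarrow> \<Psi> (arrow_el D a) = star_im D (- c) a"
    using star_subst[OF D] by metis
  have kill: "h (\<Xi> r) = 0"
    if h: "alg_hom D h" and R: "\<And>r. r \<in> rels D \<delta>2 \<Longrightarrow> h r = 0" and r: "r \<in> rels D \<delta>1"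
      and \<Xi>: "path_hom D \<Xi>" "\<And>a. a \<in> arrows D \<Longrightarrow> \<Xi> (arrow_el D a) = star_im D d a" and d: "\<delta>1 + (d + d) = \<delta>2"
    for h \<Xi> r d and \<delta>1 \<delta>2 :: 'k
  proof -
    have mesh: "h (mesh_rel D v) = 0" if "v < nverts D" "v \<noteq> exc_vertex D" for v
      using R that by (auto simp: rels_def)
    have g: "h (ge D) = 0" using R by (auto simp: rels_def)
    note H = star_hom_subst[OF D h mesh g \<Xi>]
    have e: "h (mesh_rel D (exc_vertex D) + psmult \<delta>2 (fe D)) = 0" using R by (auto simp: rels_def)
    have "\<Xi> (mesh_rel D (exc_vertex D) + psmult \<delta>1 (fe D)) = \<Xi> (mesh_rel D (exc_vertex D)) + psmult \<delta>1 (\<Xi> (fe D))"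
      using \<Xi>(1) D unfolding path_hom_def by simp
    then have "h (\<Xi> (mesh_rel D (exc_vertex D) + psmult \<delta>1 (fe D)))
        = h (mesh_rel D (exc_vertex D)) + scale (d + d) (h (fe D)) + scale \<delta>1 (h (fe D))"
      using H(2,3) D \<Xi>(1) by (simp add: hom_add[OF h] hom_psmult[OF h] path_hom_elem)
    also have "\<dots> = h (mesh_rel D (exc_vertex D) + psmult \<delta>2 (fe D))"
      using D by (simp add: hom_add[OF h] hom_psmult[OF h] d[symmetric] scale_add algebra_simps)
    finally show ?thesis using e r H(1,4) by (auto simp: rels_def)
  qed
  have comp: "h (\<Xi> (star_im D (- d) a)) = h (arrow_el D a)"
    if h: "alg_hom D h" and R: "\<And>r. r \<in> rels D \<delta>2 \<Longrightarrow> h r = 0" 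
      and \<Xi>: "path_hom D \<Xi>" "\<And>a. a \<in> arrows D \<Longrightarrow> \<Xi> (arrow_el D a) = star_im D d a" and a: "a \<in> arrows D"
    for h \<Xi> d a and \<delta>2 :: 'k
  proof -
    have mesh: "h (mesh_rel D v) = 0" if "v < nverts D" "v \<noteq> exc_vertex D" for v
      using R that by (auto simp: rels_def)
    have g: "h (ge D) = 0" using R by (auto simp: rels_def)
    show ?thesis by (rule star_hom_subst(5)[OF D h mesh g \<Xi> refl a])
  qed
  show ?thesis
  proof (rule quot_alg_iso_subst[OF wf \<Phi>(1) \<Psi>(1) rels_elem[OF D] rels_elem[OF D]])
    fix h :: "(path \<Rightarrow> 'k) \<Rightarrow> 'k endo" and r a
    assume h: "alg_hom D h"
    show "h (\<Phi> r) = 0" if "\<And>r. r \<in> rels D \<delta>' \<Longrightarrow> h r = 0" "r \<in> rels D \<delta>"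
      using kill[OF h that(1) that(2) \<Phi> \<delta>] .
    show "h (\<Psi> r) = 0" if "\<And>r. r \<in> rels D \<delta> \<Longrightarrow> h r = 0" "r \<in> rels D \<delta>'"
      using kill[OF h that(1) that(2) \<Psi>] \<delta> by auto
    show "h (\<Psi> (\<Phi> (arrow_el D a))) = h (arrow_el D a)" if "\<And>r. r \<in> rels D \<delta> \<Longrightarrow> h r = 0" "a \<in> arrows D"
      using comp[OF h that(1) \<Psi> that(2)] by (simp add: \<Phi>(2)[OF that(2)])
    show "h (\<Phi> (\<Psi> (arrow_el D a))) = h (arrow_el D a)" if "\<And>r. r \<in> rels D \<delta>' \<Longrightarrow> h r = 0" "a \<in> arrows D"
      using comp[OF h that(1) \<Phi> that(2)] by (simp add: \<Psi>(2)[OF that(2)])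
  qed
qed

text \<open>Along the arm \<open>b_i a_i = - a_{i+1} b_{i+1}\<close>, and at the last vertex
  \<open>b_i a_i = 0\<close>. Since \<open>(ab)^(j+1) = a (ba)^j b\<close>, the vanishing exponent
  grows by one with each step back towards the exceptional vertex, starting from 2 at the last
  arrow.\<close>

lemma arm_nilpotent:
  fixes h :: "(path \<Rightarrow> 'a::field) \<Rightarrow> 'a endo"
  assumes h: "alg_hom D h" and wf: "wf_dyn D"
    and mesh: "\<And>v. exc_vertex D < v \<Longrightarrow> v < nverts D \<Longrightarrow> h (mesh_rel D v) = 0"
    and "exc_vertex D \<le> i" "i + 2 \<le> nverts D"
  shows "(h (arrow_el D (Ar i)) * h (arrow_el D (Br i))) ^ (nverts D - i) = 0"
proof -
  let ?A = "\<lambda>i. h (arrow_el D (Ar i))" and ?B = "\<lambda>i. h (arrow_el D (Br i))"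
  have pow: "(a * b) ^ Suc j = a * (b * a) ^ j * b" for a b :: "'a endo" and j
  proof (induction j)
    case (Suc j)
    then show ?case by (simp only: power_Suc[of _ "Suc j"]) (simp add: mult.assoc)
  qed simp
  have "(?A i * ?B i) ^ Suc (Suc k) = 0" if "nverts D - i = Suc (Suc k)" "exc_vertex D \<le> i" for k i
    using that
  proof (induction k arbitrary: i)
    case 0
    then have "Suc i < nverts D" "\<not> Suc (Suc i) < nverts D" by simp_all
    with 0 have "?B i * ?A i = 0"
      using mesh[of "Suc i"] hom_mesh_rel[OF h wf, of "Suc i"] out_arm[OF wf, of "Suc i"] by simp
    then show ?case by (simp only: pow[of _ _ "Suc 0"]) simp
  next
    case (Suc k)
    have "Suc i < nverts D" "Suc (Suc i) < nverts D" using Suc.prems by simp_all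
    then have "?B i * ?A i + ?A (Suc i) * ?B (Suc i) = 0"
      using Suc.prems mesh[of "Suc i"] hom_mesh_rel[OF h wf, of "Suc i"] out_arm[OF wf, of "Suc i"] by simp
    then have "?B i * ?A i = - (?A (Suc i) * ?B (Suc i))" by (simp add: eq_neg_iff_add_eq_0)
    moreover have "(?A (Suc i) * ?B (Suc i)) ^ Suc (Suc k) = 0"
      using Suc.prems by (intro Suc.IH) auto
    ultimately have "(?B i * ?A i) ^ Suc (Suc k) = 0"
      by (simp only: power_minus[of "_ * _"] mult_zero_right)
    then show ?case by (simp only: pow[of _ _ "Suc (Suc k)"]) simp
  qed
  moreover have "nverts D - i = Suc (Suc (nverts D - i - 2))" using assms(5) by simp
  ultimately show ?thesis using assms(4) by metis
qed

section \<open>Identification of the ideals; type L\<close>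

lemma ideal_gen_mono: "\<forall>s\<in>S. s \<in> ideal_gen D S' \<Longrightarrow> ideal_gen D S \<subseteq> ideal_gen D S'"
proof
  fix f assume "\<forall>s\<in>S. s \<in> ideal_gen D S'" and "f \<in> ideal_gen D S"
  from this(2,1) show "f \<in> ideal_gen D S'"
    by induction (auto intro: ideal_gen.intros)
qed

lemma I_rels_elem: "r \<in> I_rels D \<Longrightarrow> elem D r"
  by (auto simp: I_rels_def)

text \<open>Without deformation \<open>x + y = - z\<close> for the cycle \<open>z\<close> into the
  long arm, and \<open>arm_nilpotent\<close> bounds the nilpotency of \<open>z\<close> by exactly
  the exponent in \<open>ge D\<close>. Hence the mesh relations already imply
  \<open>ge D\<close>.\<close>

lemma star_I_ideal:
  assumes D: "star D" shows "I_ideal D = ideal_gen D (rels D (0 :: 'k::field))"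
proof -
  note wf = star_wf[OF D]
  have J: "is_ideal D (ideal_gen D (I_rels D :: (path \<Rightarrow> 'k) set))"
    by (rule ideal_gen_ideal) (rule I_rels_elem)
  have g: "ge D \<in> ideal_gen D (I_rels D :: (path \<Rightarrow> 'k) set)"
  proof -
    obtain h where h: "alg_hom D h" "\<And>f. elem D f \<Longrightarrow> h f = (0 :: 'k endo) \<longleftrightarrow> f \<in> ideal_gen D (I_rels D)"
      using ideal_hom[OF J wf] by metis
    have mesh: "h (mesh_rel D v) = 0" if "v < nverts D" for v
      using that h(2)[of "mesh_rel D v"] by (auto simp: I_rels_def intro: ideal_gen.gen)
    let ?Z = "h (arrow_el D (Ar (exc_vertex D))) * h (arrow_el D (Br (exc_vertex D)))"
    have "Suc (nverts D - exc_vertex D - 1) = nverts D - exc_vertex D" using star_qexp(2)[OF D] by simp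
    then have "h (ge D) = (h (xe D) + h (ye D)) ^ (nverts D - exc_vertex D)"
      using hom_ppow[OF wf h(1), of "xe D + ye D" "nverts D - exc_vertex D - 1"] D
      by (simp add: ge_def hom_add[OF h(1)])
    also have "h (xe D) + h (ye D) = - ?Z"
      using mesh[of "exc_vertex D"] hom_mesh_exc[OF D h(1)] D by (simp add: eq_neg_iff_add_eq_0)
    also have "(- ?Z) ^ (nverts D - exc_vertex D) = 0"
      using arm_nilpotent[OF h(1) wf mesh, of "exc_vertex D"] star_qexp(2)[OF D]
      by (simp add: power_minus[of ?Z])
    finally show ?thesis using h(2)[of "ge D"] D by simp
  qed
  have "ideal_gen D (rels D (0 :: 'k)) \<subseteq> ideal_gen D (I_rels D)"
    using D g by (intro ideal_gen_mono) (auto simp: rels_def I_rels_def intro!: ideal_gen.gen)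
  moreover have "ideal_gen D (I_rels D :: (path \<Rightarrow> 'k) set) \<subseteq> ideal_gen D (rels D 0)"
    by (intro ideal_gen_mono) (auto simp: rels_def I_rels_def intro!: ideal_gen.gen)
  ultimately show ?thesis unfolding I_ideal_def by blast
qed

lemma mesh_exc:
  assumes "star D"
  shows "mesh_rel D (exc_vertex D) = xe D + ye D + pmult D (arrow_el D (Ar (exc_vertex D))) (arrow_el D (Br (exc_vertex D)))"
  using assms star_tgt[OF assms]
  by (simp add: mesh_rel_eq out_exc star_wf star_not_L xe_def ye_def arrow_el_eq pmult_pel add.assoc)

lemma star_Istar_ideal:
  assumes D: "star D" shows "Istar_ideal D = ideal_gen D (rels D (1 :: 'k::field))"
proof -
  note mesh = mesh_exc[OF D, where 'a = 'k]
  show ?thesis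
  using D
proof (cases rule: star_cases)
  case (D m)
  have "extra_rels D = {mesh_rel D (exc_vertex D) + psmult (1::'k) (fe D), ge D}"
    using mesh
    by (simp add: D(2) Let_def padd_eq fe_def ge_def xe_def ye_def del: ppow.simps)
  then show ?thesis by (simp add: Istar_ideal_def Istar_rels_def rels_def)
next
  case E7
  have "extra_rels D = {mesh_rel D (exc_vertex D) + psmult (1::'k) (fe D), ge D}"
    using mesh
    by (simp add: E7 Let_def padd_eq fe_def ge_def xe_def ye_def del: ppow.simps)
  then show ?thesis by (simp add: Istar_ideal_def Istar_rels_def rels_def)
next
  case E8
  have "extra_rels D = {mesh_rel D (exc_vertex D) + psmult (1::'k) (fe D), ge D}"
    using mesh
    by (simp add: E8 Let_def padd_eq fe_def ge_def xe_def ye_def del: ppow.simps)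
  then show ?thesis by (simp add: Istar_ideal_def Istar_rels_def rels_def)
qed
qed

section \<open>Type L: the family of ideals and the substitution of the loop\<close>

definition Lrels :: "nat \<Rightarrow> 'k::field \<Rightarrow> (path \<Rightarrow> 'k) set" where
  "Lrels n \<delta> = {mesh_rel (Lq n) v | v. v < n \<and> v \<noteq> 0}
     \<union> {mesh_rel (Lq n) 0 + psmult \<delta> (ppow (Lq n) (arrow_el (Lq n) Ep) (2 * n - 1)),
        ppow (Lq n) (arrow_el (Lq n) Ep) (2 * n)}"

lemma wf_L: "n \<ge> 2 \<Longrightarrow> wf_dyn (Lq n)"
  by (simp add: wf_dyn_def)

lemma Ep_arrow [simp]: "Ep \<in> arrows (Lq n)"
  by (simp add: arrows_def)

lemma Lrels_elem: "n \<ge> 2 \<Longrightarrow> r \<in> Lrels n \<delta> \<Longrightarrow> elem (Lq n) r"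
  using wf_L[of n] by (auto simp: Lrels_def simp del: ppow.simps)

lemma hom_ppow_pos:
  assumes "wf_dyn D" "alg_hom D h" "elem D f" "k \<ge> 1" shows "h (ppow D f k) = h f ^ k"
  using hom_ppow[OF assms(1-3), of "k - 1"] assms(4) by (simp del: ppow.simps)

lemma hom_mesh_L0:
  assumes "n \<ge> 2" "alg_hom (Lq n) h"
  shows "h (mesh_rel (Lq n) 0) = h (arrow_el (Lq n) Ep) * h (arrow_el (Lq n) Ep)
     + h (arrow_el (Lq n) (Ar 0)) * h (arrow_el (Lq n) (Br 0))"
  using assms by (simp add: hom_mesh_rel wf_L out_Lq)

text \<open>In the preprojective algebra \<open>\<epsilon>^2 = - a_0 b_0\<close>, and the arm has
  \<open>n\<close> vertices counted from 0, so
  \<open>\<epsilon>^(2n) = (- a_0 b_0)^n = 0\<close>.\<close>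

lemma L_I_ideal:
  assumes n: "n \<ge> 2" shows "I_ideal (Lq n) = ideal_gen (Lq n) (Lrels n (0 :: 'k::field))"
proof -
  note wf = wf_L[OF n]
  have J: "is_ideal (Lq n) (ideal_gen (Lq n) (I_rels (Lq n) :: (path \<Rightarrow> 'k) set))"
    by (rule ideal_gen_ideal) (rule I_rels_elem)
  let ?e = "arrow_el (Lq n) Ep :: path \<Rightarrow> 'k"
  have g: "ppow (Lq n) ?e (2 * n) \<in> ideal_gen (Lq n) (I_rels (Lq n))"
  proof -
    obtain h where h: "alg_hom (Lq n) h" "\<And>f. elem (Lq n) f \<Longrightarrow> h f = (0 :: 'k endo) \<longleftrightarrow> f \<in> ideal_gen (Lq n) (I_rels (Lq n))"
      using ideal_hom[OF J wf] by metis
    have mesh: "h (mesh_rel (Lq n) v) = 0" if "v < n" for v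
      using that h(2)[of "mesh_rel (Lq n) v"] by (auto simp: I_rels_def intro: ideal_gen.gen)
    let ?Z = "h (arrow_el (Lq n) (Ar 0)) * h (arrow_el (Lq n) (Br 0))"
    have "h (ppow (Lq n) ?e (2 * n)) = (h ?e * h ?e) ^ n"
      using hom_ppow_pos[OF wf h(1), of ?e "2 * n"] n wf by (simp add: power_mult power2_eq_square)
    also have "h ?e * h ?e = - ?Z"
      using mesh[of 0] hom_mesh_L0[OF n h(1)] n by (simp add: eq_neg_iff_add_eq_0)
    also have "(- ?Z) ^ n = 0"
      using arm_nilpotent[OF h(1) wf, of 0] mesh n by (simp add: power_minus[of ?Z])
    finally show ?thesis using h(2)[of "ppow (Lq n) ?e (2 * n)"] wf by simp
  qed
  have "ideal_gen (Lq n) (Lrels n (0 :: 'k)) \<subseteq> ideal_gen (Lq n) (I_rels (Lq n))"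
    using n g by (intro ideal_gen_mono) (auto simp: Lrels_def I_rels_def simp del: ppow.simps intro!: ideal_gen.gen)
  moreover have "ideal_gen (Lq n) (I_rels (Lq n) :: (path \<Rightarrow> 'k) set) \<subseteq> ideal_gen (Lq n) (Lrels n 0)"
    by (intro ideal_gen_mono) (auto simp: Lrels_def I_rels_def intro!: ideal_gen.gen)
  ultimately show ?thesis unfolding I_ideal_def by blast
qed

lemma L_Istar_ideal:
  assumes n: "n \<ge> 2" shows "Istar_ideal (Lq n) = ideal_gen (Lq n) (Lrels n (1 :: 'k::field))"
proof -
  have "mesh_rel (Lq n) 0 = pmult (Lq n) (arrow_el (Lq n) Ep) (arrow_el (Lq n) Ep)
     + (pmult (Lq n) (arrow_el (Lq n) (Ar 0)) (arrow_el (Lq n) (Br 0)) :: path \<Rightarrow> 'k)"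
    using n by (simp add: mesh_rel_eq out_Lq arrow_el_eq pmult_pel)
  then show ?thesis
    by (simp add: Istar_ideal_def Istar_rels_def Lrels_def Let_def padd_eq del: ppow.simps)
qed

text \<open>The term with coefficient \<open>d\<close> is needed only to invert the substitution for \<open>n = 2\<close>.\<close>

definition L_im :: "nat \<Rightarrow> 'k::field \<Rightarrow> 'k \<Rightarrow> arr \<Rightarrow> path \<Rightarrow> 'k" where
  "L_im n c d a = (let e = arrow_el (Lq n) Ep in if a = Ep then
      e + psmult c (ppow (Lq n) e (2 * n - 2)) + psmult d (ppow (Lq n) e (4 * n - 5)) else arrow_el (Lq n) a)"

lemma L_subst:
  assumes n: "n \<ge> 2"
  obtains \<Phi> where "path_hom (Lq n) \<Phi>" "\<And>a. a \<in> arrows (Lq n) \<Longrightarrow> \<Phi> (arrow_el (Lq n) a) = L_im n (c :: 'k::field) d a"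
proof -
  let ?e = "arrow_el (Lq n) Ep :: path \<Rightarrow> 'k" and ?v = "pel (0, []) :: path \<Rightarrow> 'k"
  note wf = wf_L[OF n]
  have e: "pmult (Lq n) ?v ?e = ?e" "pmult (Lq n) ?e ?v = ?e"
    by (simp_all add: arrow_el_eq pmult_pel)
  have p: "pmult (Lq n) ?v (ppow (Lq n) ?e (Suc k)) = ppow (Lq n) ?e (Suc k)"
    "pmult (Lq n) (ppow (Lq n) ?e (Suc k)) ?v = ppow (Lq n) ?e (Suc k)" for k
  proof -
    show "pmult (Lq n) ?v (ppow (Lq n) ?e (Suc k)) = ppow (Lq n) ?e (Suc k)"
      by (simp add: e flip: pmult_assoc)
    have "pmult (Lq n) (ppow (Lq n) ?e k) ?e = ppow (Lq n) ?e (Suc k)"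
      using wf by (induction k) (simp_all add: pmult_assoc)
    then show "pmult (Lq n) (ppow (Lq n) ?e (Suc k)) ?v = ppow (Lq n) ?e (Suc k)"
      by (metis e(2) pmult_assoc)
  qed
  have q: "2 * n - 2 = Suc (2 * n - 3)" "4 * n - 5 = Suc (4 * n - 6)" using n by simp_all
  show thesis
  proof (rule subst_path_hom[OF wf, of "L_im n c d"])
    fix a assume a: "a \<in> arrows (Lq n)"
    show "elem (Lq n) (L_im n c d a)" using a wf by (simp add: L_im_def Let_def)
    show "pmult (Lq n) (pel (src (Lq n) a, [])) (L_im n c d a) = L_im n c d a"
      using arrow_el_units[of "Lq n" a] e p unfolding L_im_def Let_def q
      by (cases "a = Ep") (simp_all del: ppow.simps)
    show "pmult (Lq n) (L_im n c d a) (pel (tgt (Lq n) a, [])) = L_im n c d a"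
      using arrow_el_units[of "Lq n" a] e p unfolding L_im_def Let_def q
      by (cases "a = Ep") (simp_all del: ppow.simps)
  qed (use that in blast)
qed

lemma power_zero_ge: "(E :: 'r::ring_1) ^ N = 0 \<Longrightarrow> N \<le> k \<Longrightarrow> E ^ k = 0"
  by (metis le_add_diff_inverse mult_zero_left power_add)

text \<open>Write \<open>R\<close> and \<open>T\<close> for the powers of \<open>\<epsilon>\<close>
  that are added. Squaring \<open>\<epsilon> + c R + d T\<close> produces just one new term,
  \<open>2 c \<epsilon>^(2n-1)\<close>, since all other products have exponent at least
  \<open>2n\<close>. For the same reason powers from the third on are unchanged.\<close>

lemma L_hom_subst:
  fixes h :: "(path \<Rightarrow> 'k::field) \<Rightarrow> 'k endo" and c d :: 'k
  assumes n: "n \<ge> 2" and h: "alg_hom (Lq n) h" and g: "h (ppow (Lq n) (arrow_el (Lq n) Ep) (2 * n)) = 0"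
    and \<Phi>: "path_hom (Lq n) \<Phi>" "\<And>a. a \<in> arrows (Lq n) \<Longrightarrow> \<Phi> (arrow_el (Lq n) a) = L_im n c d a"
  defines "e \<equiv> arrow_el (Lq n) Ep"
  shows "v < n \<Longrightarrow> v \<noteq> 0 \<Longrightarrow> h (\<Phi> (mesh_rel (Lq n) v)) = h (mesh_rel (Lq n) v)"
    and "h (\<Phi> (mesh_rel (Lq n) 0)) = h (mesh_rel (Lq n) 0) + scale (c + c) (h (ppow (Lq n) e (2 * n - 1)))"
    and "k \<ge> 3 \<Longrightarrow> h (\<Phi> (ppow (Lq n) e k)) = h (ppow (Lq n) e k)"
    and "a \<in> arrows (Lq n) \<Longrightarrow> d + d' = 2 * c * c \<Longrightarrow> h (\<Phi> (L_im n (- c) d' a)) = h (arrow_el (Lq n) a)"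
proof -
  note wf = wf_L[OF n]
  define k where "k = (\<lambda>f. h (\<Phi> f))"
  have k: "alg_hom (Lq n) k" unfolding k_def by (rule alg_hom_comp[OF h \<Phi>(1)])
  define E where "E = h e"
  have ee: "elem (Lq n) e" using wf by (simp add: e_def)
  note hp = hom_ppow_pos[OF wf h ee, folded E_def] and kp = hom_ppow_pos[OF wf k ee]
  have E: "E ^ j = 0" if "j \<ge> 2 * n" for j
    by (rule power_zero_ge[OF _ that]) (use g hp[of "2 * n"] n in \<open>simp add: e_def\<close>)
  define R T where "R = E ^ (2 * n - 2)" and "T = E ^ (4 * n - 5)"
  have ER: "E * R = E ^ (2 * n - 1)" "R * E = E ^ (2 * n - 1)"
    using n by (simp_all add: R_def flip: power_Suc power_Suc2) (simp_all add: Suc_diff_Suc numeral_2_eq_2 flip: Suc_diff_le)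
  \<comment> \<open>Each of these products is a power of \<open>E\<close> with exponent at least
    \<open>2 * n\<close>, by \<open>n \<ge> 2\<close>.\<close>
  have z: "R * R = 0" "R * T = 0" "T * R = 0" "T * T = 0" "E * T = 0" "T * E = 0"
    "E * (E * R) = 0" "E * (E * T) = 0" "R * (E * R) = 0"
    using n by (auto simp: R_def T_def intro!: E simp flip: power_add power_Suc power_Suc2)
  have ke: "k e = E + scale c R + scale d T"
    using n ee hp unfolding k_def e_def[symmetric] \<Phi>(2)[OF Ep_arrow, folded e_def]
    by (simp add: L_im_def Let_def hom_add[OF h] hom_psmult[OF h] E_def R_def T_def del: ppow.simps flip: e_def)
  have k2: "k e * k e = E * E + scale (2 * c) (E ^ (2 * n - 1))"
    by (simp add: ke distrib_left distrib_right z ER scale_double)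
  have k3: "k e ^ j = E ^ j" if "j \<ge> 3" for j
    using that
  proof (induction j rule: nat_induct_at_least)
    case base
    have "k e ^ 3 = k e * k e * k e" by (simp add: numeral_eq_Suc mult.assoc)
    also have "\<dots> = E * E * E + scale (2 * c) (R * E * E)"
      using z(6) unfolding k2 ER(2)[symmetric] by (simp add: ke distrib_left distrib_right mult.assoc z)
    also have "R * E * E = 0" using z(7) by (metis ER mult.assoc)
    finally show ?case by (simp add: numeral_eq_Suc mult.assoc)
  next
    case (Suc j)
    obtain i where j: "j = Suc (Suc i)" using that[of "j - 2"] Suc.hyps by simp
    have "E ^ j = E ^ i * (E * E)" unfolding j by (simp only: power_Suc2 mult.assoc)
    then have "E ^ j * R = 0" "E ^ j * T = 0" by (simp_all add: mult.assoc z)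
    then have "E ^ j * k e = E ^ j * E" by (simp add: ke distrib_left)
    then show ?case by (simp only: power_Suc2 Suc.IH)
  qed
  \<comment> \<open>For \<open>n = 2\<close> the exponent \<open>2 * n - 2\<close> is 2, below the
    range of \<open>k3\<close>, and \<open>T = E ^ 3\<close> may survive. For larger
    \<open>n\<close> the exponent of \<open>T\<close> is at least \<open>2 * n\<close>, so
    \<open>T = 0\<close>.\<close>
  have kR: "k e ^ (2 * n - 2) = R + scale (2 * c) T"
  proof (cases "n = 2")
    case True then show ?thesis using k2 by (simp add: R_def T_def power2_eq_square)
  next
    case False
    then have "2 * n - 2 \<ge> 3" "T = 0" using n by (auto simp: T_def intro!: E)
    then show ?thesis using k3 by (simp add: R_def)
  qed
  have kB: "k (arrow_el (Lq n) a) = h (arrow_el (Lq n) a)" if "a \<in> arrows (Lq n)" "a \<noteq> Ep" for a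
    using that by (simp add: k_def \<Phi> L_im_def)
  show "h (\<Phi> (mesh_rel (Lq n) v)) = h (mesh_rel (Lq n) v)" if v: "v < n" "v \<noteq> 0" for v
  proof -
    have "k (mesh_rel (Lq n) v) = h (mesh_rel (Lq n) v)"
      unfolding hom_mesh_rel[OF k wf] hom_mesh_rel[OF h wf]
    proof (rule sum.cong[OF refl])
      fix a assume "a \<in> out (Lq n) v"
      then have "a \<in> arrows (Lq n)" "a \<noteq> Ep" using v by (auto simp: out_def)
      moreover from this have "bar a \<noteq> Ep" by (cases a) auto
      ultimately show "k (arrow_el (Lq n) a) * k (arrow_el (Lq n) (bar a)) = h (arrow_el (Lq n) a) * h (arrow_el (Lq n) (bar a))"
        by (simp add: kB)
    qed
    then show ?thesis by (simp add: k_def)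
  qed
  have "Ar 0 \<in> arrows (Lq n)" "Br 0 \<in> arrows (Lq n)" using n by (auto simp: arrows_def)
  then have "k (mesh_rel (Lq n) 0) = h (mesh_rel (Lq n) 0) + scale (2 * c) (E ^ (2 * n - 1))"
    using k2 unfolding hom_mesh_L0[OF n k] hom_mesh_L0[OF n h] by (simp add: kB e_def[symmetric] E_def[symmetric])
  then show "h (\<Phi> (mesh_rel (Lq n) 0)) = h (mesh_rel (Lq n) 0) + scale (c + c) (h (ppow (Lq n) e (2 * n - 1)))"
    using hp[of "2 * n - 1"] n by (simp add: k_def)
  show "h (\<Phi> (ppow (Lq n) e k')) = h (ppow (Lq n) e k')" if "k' \<ge> 3" for k'
    using that hp[of k'] kp[of k'] k3 by (simp add: k_def)
  show "h (\<Phi> (L_im n (- c) d' a)) = h (arrow_el (Lq n) a)" if a: "a \<in> arrows (Lq n)" and d: "d + d' = 2 * c * c"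
  proof (cases "a = Ep")
    case True
    have "k (L_im n (- c) d' a) = k e - scale c (k e ^ (2 * n - 2)) + scale d' (k e ^ (4 * n - 5))"
      using n ee kp[of "2 * n - 2"] kp[of "4 * n - 5"]
      by (simp add: True L_im_def Let_def e_def[symmetric] hom_add[OF k] hom_psmult[OF k] del: ppow.simps)
    also have "k e ^ (4 * n - 5) = T" using n k3 by (simp add: T_def)
    \<comment> \<open>The terms with \<open>R\<close> cancel, while those with \<open>T\<close> have
      total coefficient \<open>d + d' - 2 c^2\<close>.\<close>
    also have "k e - scale c (k e ^ (2 * n - 2)) + scale d' T = E + (scale (d + d') T - scale (2 * c * c) T)"
      unfolding kR unfolding ke by (simp add: scale_add algebra_simps)
    also have "\<dots> = E" using d by simp
    finally show ?thesis by (simp add: k_def True E_def e_def)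
  next
    case False
    then show ?thesis using kB[OF a] by (simp add: L_im_def k_def)
  qed
qed

lemma L_iso:
  fixes \<delta> c :: "'k::field"
  assumes n: "n \<ge> 2" and \<delta>: "\<delta> + (c + c) = \<delta>'"
  shows "quot_alg_iso (Lq n) (ideal_gen (Lq n) (Lrels n \<delta>)) (ideal_gen (Lq n) (Lrels n \<delta>'))"
proof -
  note wf = wf_L[OF n]
  obtain \<Phi> where \<Phi>: "path_hom (Lq n) \<Phi>" "\<And>a. a \<in> arrows (Lq n) \<Longrightarrow> \<Phi> (arrow_el (Lq n) a) = L_im n c 0 a"
    using L_subst[OF n] by metis
  \<comment> \<open>The parameters \<open>d\<close> of \<open>\<Phi>\<close> and
    \<open>\<Psi>\<close> are 0 and \<open>2 * c * c\<close>; their sum is the value required for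
    inversion in either order.\<close>
  obtain \<Psi> where \<Psi>: "path_hom (Lq n) \<Psi>"
    "\<And>a. a \<in> arrows (Lq n) \<Longrightarrow> \<Psi> (arrow_el (Lq n) a) = L_im n (- c) (2 * c * c) a"
    using L_subst[OF n] by metis
  have kill: "h (\<Xi> r) = 0"
    if h: "alg_hom (Lq n) h" and R: "\<And>r. r \<in> Lrels n \<delta>2 \<Longrightarrow> h r = 0" and r: "r \<in> Lrels n \<delta>1"
      and \<Xi>: "path_hom (Lq n) \<Xi>" "\<And>a. a \<in> arrows (Lq n) \<Longrightarrow> \<Xi> (arrow_el (Lq n) a) = L_im n b d a"
      and d: "\<delta>1 + (b + b) = \<delta>2"
    for h \<Xi> r b d and \<delta>1 \<delta>2 :: 'k
  proof -
    let ?f = "ppow (Lq n) (arrow_el (Lq n) Ep) (2 * n - 1) :: path \<Rightarrow> 'k"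
    have f: "elem (Lq n) ?f" using wf by simp
    have mesh: "h (mesh_rel (Lq n) v) = 0" if "v < n" "v \<noteq> 0" for v
      using R that by (auto simp: Lrels_def)
    have g: "h (ppow (Lq n) (arrow_el (Lq n) Ep) (2 * n)) = 0" using R by (auto simp: Lrels_def)
    note H = L_hom_subst[OF n h g \<Xi>]
    have e: "h (mesh_rel (Lq n) 0 + psmult \<delta>2 ?f) = 0" using R unfolding Lrels_def by blast
    have "\<Xi> (mesh_rel (Lq n) 0 + psmult \<delta>1 ?f) = \<Xi> (mesh_rel (Lq n) 0) + psmult \<delta>1 (\<Xi> ?f)"
      using \<Xi>(1) n f unfolding path_hom_def by (simp del: ppow.simps)
    then have "h (\<Xi> (mesh_rel (Lq n) 0 + psmult \<delta>1 ?f))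
        = h (mesh_rel (Lq n) 0) + scale (b + b) (h ?f) + scale \<delta>1 (h ?f)"
      using H(2) H(3)[of "2 * n - 1"] n f \<Xi>(1) by (simp add: hom_add[OF h] hom_psmult[OF h] path_hom_elem del: ppow.simps)
    also have "\<dots> = h (mesh_rel (Lq n) 0 + psmult \<delta>2 ?f)"
      using n f by (simp add: hom_add[OF h] hom_psmult[OF h] d[symmetric] scale_add algebra_simps del: ppow.simps)
    finally have "h (\<Xi> (mesh_rel (Lq n) 0 + psmult \<delta>1 ?f)) = 0" using e by simp
    moreover have "h (\<Xi> (ppow (Lq n) (arrow_el (Lq n) Ep) (2 * n))) = 0" using H(3)[of "2 * n"] n g by simp
    ultimately show ?thesis using r H(1) mesh by (auto simp: Lrels_def)
  qed
  have g: "h (ppow (Lq n) (arrow_el (Lq n) Ep) (2 * n)) = 0"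
    if "\<And>r. r \<in> Lrels n \<delta>2 \<Longrightarrow> h r = 0" for h :: "(path \<Rightarrow> 'k) \<Rightarrow> 'k endo" and \<delta>2
    using that unfolding Lrels_def by blast
  show ?thesis
  proof (rule quot_alg_iso_subst[OF wf \<Phi>(1) \<Psi>(1) Lrels_elem[OF n] Lrels_elem[OF n]])
    fix h :: "(path \<Rightarrow> 'k) \<Rightarrow> 'k endo" and r a
    assume h: "alg_hom (Lq n) h"
    show "h (\<Phi> r) = 0" if "\<And>r. r \<in> Lrels n \<delta>' \<Longrightarrow> h r = 0" "r \<in> Lrels n \<delta>"
      using kill[OF h that(1) that(2) \<Phi> \<delta>] .
    show "h (\<Psi> r) = 0" if "\<And>r. r \<in> Lrels n \<delta> \<Longrightarrow> h r = 0" "r \<in> Lrels n \<delta>'"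
      using kill[OF h that(1) that(2) \<Psi>] \<delta> by auto
    show "h (\<Psi> (\<Phi> (arrow_el (Lq n) a))) = h (arrow_el (Lq n) a)"
      if "\<And>r. r \<in> Lrels n \<delta> \<Longrightarrow> h r = 0" "a \<in> arrows (Lq n)"
      using L_hom_subst(4)[OF n h g[of \<delta> h, OF that(1)] \<Psi> that(2), of 0] by (simp add: \<Phi>(2)[OF that(2)])
    show "h (\<Phi> (\<Psi> (arrow_el (Lq n) a))) = h (arrow_el (Lq n) a)"
      if "\<And>r. r \<in> Lrels n \<delta>' \<Longrightarrow> h r = 0" "a \<in> arrows (Lq n)"
      using L_hom_subst(4)[OF n h g[of \<delta>' h, OF that(1)] \<Phi> that(2), of "2 * c * c"] by (simp add: \<Psi>(2)[OF that(2)])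
  qed
qed

section \<open>Trace functions in characteristic two\<close>

lemma char2_double:
  assumes "CHAR('k::field) = 2" shows "(x::'k) + x = 0"
proof -
  have "(2::'k) = 0" using of_nat_CHAR[where 'a = 'k] assms by simp
  then show ?thesis by (metis mult_2 mult_zero_left)
qed

lemma char2_endo:
  assumes "CHAR('k::field) = 2" shows "(x::'k endo) + x = 0"
  using char2_double[OF assms, of 1] scale_add[of 1 1 x] by simp

lemma char2_uminus:
  assumes "CHAR('k::field) = 2" shows "- (x::'k) = x"
  using char2_double[OF assms, of x] by (simp add: minus_unique)

lemma char2_endo_uminus:
  assumes "CHAR('k::field) = 2" shows "- (x::'k endo) = x"
  using char2_endo[OF assms, of x] by (simp add: minus_unique)

section \<open>Closed paths under trace functions\<close>

definition closed_path :: "dyn \<Rightarrow> nat \<Rightarrow> arr list \<Rightarrow> bool" where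
  "closed_path D v as \<longleftrightarrow> v < nverts D \<and> chain D v as \<and> pend D v as = v"

lemma closed_path_rotate:
  "wf_dyn D \<Longrightarrow> closed_path D v (xs @ ys) \<Longrightarrow> closed_path D (pend D v xs) (ys @ xs)"
  by (auto simp: closed_path_def pend_less)

lemma trace_rotate:
  assumes "is_trace D J \<tau>" "wf_dyn D" "closed_path D v (xs @ ys)"
  shows "\<tau> (pel (v, xs @ ys)) = \<tau> (pel (pend D v xs, ys @ xs))"
proof -
  have "elem D (pel (v, xs) :: path \<Rightarrow> 'a)" "elem D (pel (pend D v xs, ys) :: path \<Rightarrow> 'a)"
    using assms(2,3) by (auto simp: valid_path_def closed_path_def pend_less)
  from trace_comm[OF assms(1) this] show ?thesis
    using assms(3) by (simp add: pmult_pel closed_path_def)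
qed

text \<open>Under a trace, a detour along an edge at \<open>v\<close> may be exchanged for minus the
  sum of the detours along the other edges at \<open>v\<close>.\<close>

lemma trace_mesh:
  assumes \<tau>: "is_trace D J \<tau>" and J: "is_ideal D J" "mesh_rel D v \<in> J" and wf: "wf_dyn D"
    and v: "v < nverts D" "chain D v bs"
  shows "(\<Sum>a\<in>out D v. \<tau> (pel (v, a # bar a # bs))) = 0"
proof -
  have el: "elem D (pel (v, a # bar a # bs) :: path \<Rightarrow> 'a)" if "a \<in> out D v" for a
    using that v by (auto simp: valid_path_def out_def)
  have p: "pmult D (\<Sum>a\<in>A. pel (v, [a, bar a])) (pel (v, bs)) = (\<Sum>a\<in>A. pel (v, a # bar a # bs) :: path \<Rightarrow> 'a)"
    if "A \<subseteq> out D v" for A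
    using that by (induction A rule: infinite_finite_induct) (auto simp: pmult_pel out_def)
  have s: "\<tau> (\<Sum>a\<in>A. pel (v, a # bar a # bs)) = (\<Sum>a\<in>A. \<tau> (pel (v, a # bar a # bs)))" if "A \<subseteq> out D v" for A
    using that
  proof (induction A rule: infinite_finite_induct)
    case (insert a A)
    then have "elem D (\<Sum>a\<in>A. pel (v, a # bar a # bs) :: path \<Rightarrow> 'a)" by (auto intro!: elem_sum el)
    then show ?case using insert el by (simp add: trace_add[OF \<tau>])
  qed (auto simp: trace_0[OF \<tau>])
  have "pmult D (mesh_rel D v) (pel (v, bs)) \<in> J"
    using J v by (intro ideal_rmult) (auto simp: valid_path_def)
  then show ?thesis
    using trace_ideal[OF \<tau>] s[OF order_refl] p[OF order_refl] by (simp add: mesh_rel_eq)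
qed

lemma chain_tgt_src:
  assumes "chain D v as" "a \<in> set as" shows "tgt D a \<in> src D ` set as \<or> tgt D a = pend D v as"
  using assms
proof (induction as arbitrary: v)
  case (Cons b bs)
  then show ?case by (cases bs) auto
qed simp

lemma closed_tgt_src:
  assumes "closed_path D v as" "a \<in> set as" shows "tgt D a \<in> src D ` set as"
proof -
  have "v \<in> src D ` set as" using assms by (cases as) (auto simp: closed_path_def)
  then show ?thesis using chain_tgt_src[of D v as a] assms by (auto simp: closed_path_def)
qed

text \<open>A closed path has a peak at every vertex of maximal height; the mesh relation below the peak
  pushes it down, so only paths of height at most one remain.\<close>

lemma peak_reduction:
  fixes \<tau> :: "nat \<Rightarrow> arr list \<Rightarrow> 'c" and d :: "nat \<Rightarrow> nat"
  assumes wf: "wf_dyn D"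
    and rot: "\<And>v xs ys. closed_path D v (xs @ ys) \<Longrightarrow> \<tau> v (xs @ ys) = \<tau> (pend D v xs) (ys @ xs)"
    and edge: "\<And>a. a \<in> arrows D \<Longrightarrow> d (tgt D a) = Suc (d (src D a)) \<or> d (src D a) = Suc (d (tgt D a))
          \<or> d (src D a) = 0 \<and> d (tgt D a) = 0"
    and parent: "\<And>a b. a \<in> arrows D \<Longrightarrow> b \<in> arrows D \<Longrightarrow> src D a = src D b \<Longrightarrow>
      d (tgt D a) < d (src D a) \<Longrightarrow> d (tgt D b) < d (src D b) \<Longrightarrow> a = b"
    and step: "\<And>a mid. a \<in> arrows D \<Longrightarrow> d (tgt D a) = Suc (d (src D a)) \<Longrightarrow> d (src D a) > 0 \<Longrightarrow>
      closed_path D (src D a) mid \<Longrightarrow> \<exists>b\<in>arrows D. src D b = src D a \<and> Suc (d (tgt D b)) = d (src D b) \<and>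
        \<tau> (src D a) (a # bar a # mid) = \<tau> (src D a) (b # bar b # mid)"
    and cl: "closed_path D v as" "as \<noteq> []"
  shows "\<exists>w bs. closed_path D w bs \<and> d w = 0 \<and> length bs = length as \<and> (\<forall>a\<in>set bs. d (src D a) \<le> 1)
    \<and> \<tau> v as = \<tau> w bs"
  using cl
\<comment> \<open>The measure is the sum of the heights of the vertices visited, which drops when a
  peak is replaced by a dip.\<close>
proof (induction "\<Sum>a\<leftarrow>as. d (src D a)" arbitrary: v as rule: less_induct)
  case less
  define m where "m = Max ((\<lambda>a. d (src D a)) ` set as)"
  have m: "d (src D a) \<le> m" if "a \<in> set as" for a
    unfolding m_def using that by (intro Max_ge) auto
  have "m \<in> (\<lambda>a. d (src D a)) ` set as"
    unfolding m_def using less.prems by (intro Max_in) auto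
  then obtain a0 where a0: "a0 \<in> set as" "d (src D a0) = m" by auto
  then obtain xs ys where as: "as = xs @ a0 # ys" by (auto simp: in_set_conv_decomp)
  define u cs where "u = src D a0" and "cs = a0 # ys @ xs"
  have u: "u = pend D v xs" using less.prems as by (auto simp: closed_path_def u_def)
  have cs: "closed_path D u cs" "\<tau> v as = \<tau> u cs"
    using closed_path_rotate[OF wf, of v xs "a0 # ys"] rot[of v xs "a0 # ys"] less.prems
    by (simp_all add: as cs_def u)
  have set_cs: "set cs = set as" by (auto simp: cs_def as)
  have tgt: "d (tgt D a) \<le> m" if "a \<in> set cs" for a
    using closed_tgt_src[OF cs(1) that] m set_cs by auto
  have len: "length cs = length as" by (simp add: cs_def as)
  have summ: "(\<Sum>a\<leftarrow>cs. d (src D a)) = (\<Sum>a\<leftarrow>as. d (src D a))" by (simp add: cs_def as)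
  have arr: "a \<in> arrows D" if "a \<in> set cs" for a
  proof -
    have "chain D u bs \<Longrightarrow> a \<in> set bs \<Longrightarrow> a \<in> arrows D" for u bs by (induction bs arbitrary: u) auto
    then show ?thesis using cs(1) that by (auto simp: closed_path_def)
  qed
  show ?case
  proof (cases "m = 0")
    case True
    then show ?thesis using cs len m set_cs a0
      by (intro exI[of _ u] exI[of _ cs]) (auto simp: u_def)
  next
    case False
    have a0': "d (src D a0) = Suc (d (tgt D a0))" "a0 \<in> arrows D"
      using edge[of a0] arr[of a0] tgt[of a0] a0 False by (auto simp: cs_def)
    have "ys @ xs \<noteq> []"
      using cs(1) a0' by (auto simp: closed_path_def cs_def u_def)
    then obtain mid l where ml: "ys @ xs = mid @ [l]" by (metis rev_exhaust)
    have l: "l \<in> arrows D" "tgt D l = u" using cs(1) arr[of l] by (auto simp: closed_path_def cs_def ml)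
    have "d (src D l) \<le> m" using m set_cs by (auto simp: cs_def ml)
    then have l': "d (tgt D l) = Suc (d (src D l))"
      using edge[OF l(1)] l a0 False by (auto simp: u_def)
    \<comment> \<open>The path enters the highest vertex by \<open>l\<close> from below and leaves
      it downwards by \<open>a0\<close>. Only one edge leads down from there, so it leaves along the
      edge by which it came.\<close>
    have "bar l = a0"
      using l l' a0' by (intro parent) (auto simp: u_def)
    then have cs': "cs = bar l # mid @ [l]" by (simp add: cs_def ml)
    define w where "w = src D l"
    have w: "w = pend D u (bar l # mid)" using cs(1) by (auto simp: closed_path_def cs' w_def)
    have c2: "closed_path D w (l # bar l # mid)" "\<tau> u cs = \<tau> w (l # bar l # mid)"
      using closed_path_rotate[OF wf, of u "bar l # mid" "[l]"] rot[of u "bar l # mid" "[l]"] cs(1)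
      by (simp_all add: cs' w)
    then have mid: "closed_path D w mid" by (auto simp: closed_path_def w_def)
    have dw: "Suc (d w) = m" using l' l a0 by (simp add: w_def u_def)
    show ?thesis
    proof (cases "d w = 0")
      case True
      have "\<forall>a\<in>set (l # bar l # mid). d (src D a) \<le> 1"
        using m set_cs dw True by (force simp: cs')
      then show ?thesis using c2 cs len True
        by (intro exI[of _ w] exI[of _ "l # bar l # mid"]) (auto simp: cs')
    next
      case False
      then obtain b where b: "b \<in> arrows D" "src D b = w" "Suc (d (tgt D b)) = d w"
        "\<tau> w (l # bar l # mid) = \<tau> w (b # bar b # mid)"
        using step[OF l(1) l', of mid] mid by (auto simp: w_def)
      have cb: "closed_path D w (b # bar b # mid)"
        using mid b by (auto simp: closed_path_def)
      \<comment> \<open>The peak of height \<open>m\<close> above \<open>w\<close> is traded for a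
        dip to height \<open>m - 2\<close>.\<close>
      have "(\<Sum>a\<leftarrow>b # bar b # mid. d (src D a)) < (\<Sum>a\<leftarrow>as. d (src D a))"
        using b l' unfolding summ[symmetric] by (simp add: cs' w_def[symmetric] l)
      from less.hyps[OF this cb] show ?thesis
        using b(4) c2 cs len by (auto simp: cs')
    qed
  qed
qed

section \<open>Linear functions given by weights on paths\<close>

definition wt :: "(path \<Rightarrow> 'k::field) \<Rightarrow> (path \<Rightarrow> 'k) \<Rightarrow> 'k" where
  "wt w f = (\<Sum>p | f p \<noteq> 0. f p * w p)"

lemma wt_eq: "finite A \<Longrightarrow> {p. f p \<noteq> 0} \<subseteq> A \<Longrightarrow> wt w f = (\<Sum>p\<in>A. f p * w p)"
  unfolding wt_def by (rule sum.mono_neutral_left) auto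

lemma wt_add: "elem D f \<Longrightarrow> elem D g \<Longrightarrow> wt w (f + g) = wt w f + wt w g"
proof -
  assume "elem D f" "elem D g"
  then have fin: "finite ({p. f p \<noteq> 0} \<union> {p. g p \<noteq> 0})" by (auto simp: elem_def)
  show ?thesis
    by (subst (1 2 3) wt_eq[OF fin]) (auto simp: plus_fun_apply algebra_simps sum.distrib)
qed

lemma wt_psmult: "elem D f \<Longrightarrow> wt w (psmult c f) = c * wt w f"
proof -
  assume "elem D f"
  then have fin: "finite {p. f p \<noteq> 0}" by (auto simp: elem_def)
  show ?thesis
    by (subst (1 2) wt_eq[OF fin]) (auto simp: psmult_def sum_distrib_left mult.assoc)
qed

lemma wt_pel [simp]: "wt w (pel p) = w p"
  by (subst wt_eq[of "{p}"]) (auto simp: pel_def)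

lemma wt_0 [simp]: "wt w 0 = 0"
  by (simp add: wt_def zero_fun_apply)

lemma wt_sum: "(\<And>i. i \<in> A \<Longrightarrow> elem D (f i)) \<Longrightarrow> wt w (sum f A) = (\<Sum>i\<in>A. wt w (f i))"
proof (induction A rule: infinite_finite_induct)
  case (insert x F)
  then have "wt w (f x + sum f F) = wt w (f x) + wt w (sum f F)"
    by (intro wt_add[of D]) (auto intro: elem_sum)
  with insert show ?case by simp
qed auto

text \<open>On basis elements the trace property amounts to invariance of the weight under rotation
  of closed paths and vanishing on the others: for a path that is not closed, the product of the two
  factors in the opposite order is 0.\<close>

lemma wt_trace:
  assumes wf: "wf_dyn D"
    and w: "\<And>v as bs. closed_path D v (as @ bs) \<Longrightarrow> w (v, as @ bs) = w (pend D v as, bs @ as)"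
      "\<And>v as. v < nverts D \<Longrightarrow> chain D v as \<Longrightarrow> pend D v as \<noteq> v \<Longrightarrow> w (v, as) = 0"
    and S: "\<And>s. s \<in> S \<Longrightarrow> elem D s"
    and rel: "\<And>s p. s \<in> S \<Longrightarrow> valid_path D p \<Longrightarrow> wt w (pmult D s (pel p)) = 0"
  shows "is_trace D (ideal_gen D S) (wt w)"
proof (rule is_traceI)
  fix p q assume pq: "valid_path D p" "valid_path D q"
  obtain v as u bs where p: "p = (v, as)" "q = (u, bs)" by force
  show "wt w (pmult D (pel p) (pel q)) = wt w (pmult D (pel q) (pel p))"
    using pq w(1)[of v as bs] w(1)[of u bs as] w(2)[of v "as @ bs"] w(2)[of u "bs @ as"]
    by (auto simp: p pmult_pel valid_path_def closed_path_def)
qed (use wt_add wt_psmult S rel wf in auto)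

lemma pmult_mesh_rel:
  "pmult D (mesh_rel D v) (pel (u, bs)) = (if u = v then \<Sum>a\<in>out D v. pel (v, a # bar a # bs) else 0)"
proof -
  have "pmult D (\<Sum>a\<in>A. pel (v, [a, bar a])) (pel (u, bs))
      = (if u = v then \<Sum>a\<in>A. pel (v, a # bar a # bs) else 0)" if "A \<subseteq> out D v" for A
    using that by (induction A rule: infinite_finite_induct) (auto simp: pmult_pel out_def)
  from this[OF order_refl] show ?thesis by (simp only: mesh_rel_eq)
qed

lemma wt_mesh_rel:
  assumes "v < nverts D" "chain D v bs"
  shows "wt w (pmult D (mesh_rel D v) (pel (v, bs))) = (\<Sum>a\<in>out D v. w (v, a # bar a # bs))"
proof -
  have "wt w (\<Sum>a\<in>out D v. pel (v, a # bar a # bs)) = (\<Sum>a\<in>out D v. wt w (pel (v, a # bar a # bs)))"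
    by (rule wt_sum[of _ D]) (use assms in \<open>auto simp: valid_path_def out_def\<close>)
  then show ?thesis by (simp add: pmult_mesh_rel)
qed

text \<open>The coefficient at a trivial path is multiplicative, and a field has no zero
  divisors.\<close>

lemma ppow_trivial_zero:
  assumes "\<And>v. pmult D f f (v, []) = (0::'k::field)" shows "f (v, []) = 0"
  using assms[of v] by (simp add: pmult_apply)

section \<open>Type L in characteristic two\<close>

text \<open>In characteristic 2 the mixed terms of a square satisfy
  \<open>\<tau> (ab + ba) = 2 \<tau> (ab) = 0\<close>. So \<open>\<tau> (u u)\<close> is additive in
  \<open>u\<close> and is determined by the squares of the paths in its support.\<close>

lemma trace_square:
  fixes \<tau> :: "(path \<Rightarrow> 'k::field) \<Rightarrow> 'k"
  assumes \<tau>: "is_trace D J \<tau>" and char: "CHAR('k) = 2"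
    and paths: "\<And>v as. valid_path D (v, as) \<Longrightarrow> as \<noteq> [] \<Longrightarrow> \<tau> (pmult D (pel (v, as)) (pel (v, as))) = 0"
    and u: "elem D u" "\<And>v. u (v, []) = 0"
  shows "\<tau> (pmult D u u) = 0"
  using u(1)
proof (induction u rule: elem_induct)
  case zero then show ?case by (simp add: trace_0[OF \<tau>])
next
  case (step c p g)
  obtain v as where p: "p = (v, as)" by force
  have "as \<noteq> []" using step(1) u(2) p by auto
  then have pp: "\<tau> (pmult D (pel p) (pel p)) = 0" using paths step(2) p by auto
  have "pmult D (psmult c (pel p) + g) (psmult c (pel p) + g)
    = psmult (c * c) (pmult D (pel p) (pel p)) + psmult c (pmult D (pel p) g + pmult D g (pel p)) + pmult D g g"
    by (simp add: add_ac)
  then show ?case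
    using step pp char2_double[OF char, of "\<tau> (pmult D g (pel p))"] trace_comm[OF \<tau>, of "pel p" g]
    by (auto simp: trace_add[OF \<tau>] trace_psmult[OF \<tau>])
qed

lemma Lq_arrow_cases:
  assumes "a \<in> arrows (Lq n)"
  obtains (Ar) i where "a = Ar i" "i + 2 \<le> n" | (Br) i where "a = Br i" "i + 2 \<le> n" | (Ep) "a = Ep"
  using assms by (auto simp: arrows_def)

lemma Lq_path_bound:
  "chain (Lq n) v as \<Longrightarrow> v \<le> pend (Lq n) v as + length as \<and> pend (Lq n) v as \<le> v + length as"
proof (induction as arbitrary: v)
  case (Cons a as)
  have "a \<in> arrows (Lq n)" "src (Lq n) a = v" using Cons.prems by auto
  then have "v \<le> tgt (Lq n) a + 1 \<and> tgt (Lq n) a \<le> v + 1" by (elim Lq_arrow_cases) auto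
  moreover have "tgt (Lq n) a \<le> pend (Lq n) v (a # as) + length as
      \<and> pend (Lq n) v (a # as) \<le> tgt (Lq n) a + length as"
    using Cons.IH[of "tgt (Lq n) a"] Cons.prems by simp
  ultimately show ?case unfolding list.size by linarith
qed simp

lemma Lq_path_parity:
  "chain (Lq n) v as \<Longrightarrow> Ep \<notin> set as \<Longrightarrow> even (v + pend (Lq n) v as + length as)"
proof (induction as arbitrary: v)
  case (Cons a as)
  have "a \<in> arrows (Lq n)" "src (Lq n) a = v" using Cons.prems by auto
  then have "odd (v + tgt (Lq n) a)" using Cons.prems by (elim Lq_arrow_cases) auto
  then show ?case using Cons.IH[of "tgt (Lq n) a"] Cons.prems by auto
qed simp

text \<open>Every arrow except the loop changes the parity of the vertex. A closed path of odd
  length therefore uses the loop, and must travel from \<open>v\<close> to 0 and back.\<close>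

lemma Lq_odd_path:
  assumes "chain (Lq n) v as" "pend (Lq n) v as = v" "odd (length as)" shows "length as \<ge> 2 * v + 1"
proof -
  have "Ep \<in> set as" using Lq_path_parity[OF assms(1)] assms(2,3) by auto
  then obtain xs ys where as: "as = xs @ Ep # ys" by (auto simp: in_set_conv_decomp)
  have "chain (Lq n) v xs" "pend (Lq n) v xs = 0" "chain (Lq n) 0 ys" "pend (Lq n) 0 ys = v"
    using assms as by auto
  then have "v \<le> length xs" "v \<le> length ys"
    using Lq_path_bound[of n v xs] Lq_path_bound[of n 0 ys] by auto
  then show ?thesis by (simp add: as)
qed

lemma ppow_Ep: "ppow (Lq n) (arrow_el (Lq n) Ep) (Suc k) = (pel (0, replicate (Suc k) Ep) :: path \<Rightarrow> 'k::field)" if "n \<ge> 2"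
proof (induction k)
  case 0 then show ?case using that wf_L[OF that] by (simp add: arrow_el_eq valid_path_def)
next
  case (Suc k)
  then show ?case unfolding ppow.simps(2)[of _ _ "Suc k"] Suc.IH
    by (simp add: arrow_el_eq pmult_pel)
qed

text \<open>All closed paths of length \<open>2 * n - 1\<close> get weight 1, and
  \<open>\<epsilon>^2\<close> gets weight 1 to balance \<open>\<epsilon>^(2n-1)\<close> in the
  deformed relation, where \<open>a_0 b_0\<close> has weight 0.\<close>

definition wL :: "nat \<Rightarrow> path \<Rightarrow> 'k::field" where
  "wL n = (\<lambda>(v, as). if closed_path (Lq n) v as \<and> (as = [Ep, Ep] \<or> length as = 2 * n - 1) then 1 else 0)"

lemma wL_trace:
  assumes n: "n \<ge> 2" and char: "CHAR('k::field) = 2"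
  shows "is_trace (Lq n) (Istar_ideal (Lq n)) (wt (wL n :: path \<Rightarrow> 'k))"
  unfolding L_Istar_ideal[OF n]
proof (rule wt_trace[OF wf_L[OF n]])
  let ?L = "Lq n" and ?w = "wL n :: path \<Rightarrow> 'k"
  fix v as bs assume c: "closed_path ?L v (as @ bs)"
  have "as @ bs = [Ep, Ep] \<longleftrightarrow> bs @ as = [Ep, Ep]"
    by (cases as; cases bs; auto simp: append_eq_Cons_conv Cons_eq_append_conv)
  then show "?w (v, as @ bs) = ?w (pend ?L v as, bs @ as)"
    using c closed_path_rotate[OF wf_L[OF n] c] by (auto simp: wL_def)
next
  let ?L = "Lq n" and ?w = "wL n :: path \<Rightarrow> 'k"
  fix s :: "path \<Rightarrow> 'k" and p assume s: "s \<in> Lrels n 1" and p: "valid_path ?L p"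
  obtain v bs where vb: "p = (v, bs)" "v < n" "chain ?L v bs" using p by (cases p) (auto simp: valid_path_def)
  note wf = wf_L[OF n]
  have dbl: "x + x = 0" for x :: 'k using char2_double[OF char] .
  have pr: "pend ?L 0 (replicate k Ep) = 0" "chain ?L 0 (replicate k Ep)" for k
    by (induction k) auto
  have ep: "pmult ?L (ppow ?L (arrow_el ?L Ep) k) (pel p) = (if v = 0 then pel (0, replicate k Ep @ bs) else 0)"
    if "k \<ge> 1" for k
  proof -
    obtain j where j: "k = Suc j" using \<open>k \<ge> 1\<close> by (cases k) auto
    show ?thesis unfolding j ppow_Ep[OF n] vb pmult_pel pr by (cases "v = 0") simp_all
  qed
  from s consider (mesh) u where "s = mesh_rel ?L u" "u < n" "u \<noteq> 0"
    | (exc) "s = mesh_rel ?L 0 + ppow ?L (arrow_el ?L Ep) (2 * n - 1)" | (pow) "s = ppow ?L (arrow_el ?L Ep) (2 * n)"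
    by (auto simp: Lrels_def simp del: ppow.simps)
  then show "wt ?w (pmult ?L s (pel p)) = 0"
  proof cases
    case mesh
    show ?thesis
    proof (cases "v = u")
      case True
      have eq: "wt ?w (pmult ?L s (pel p)) = (\<Sum>a\<in>out ?L v. ?w (v, a # bar a # bs))"
        using wt_mesh_rel[of v ?L bs ?w] vb mesh True by simp
      have out: "out ?L v = (if v + 1 < n then {Br (v - 1), Ar v} else {Br (v - 1)})"
        using out_arm[OF wf, of v] mesh True by simp
      show ?thesis
      \<comment> \<open>At an inner vertex of the arm the two detours have equal length, hence equal
        weight, and cancel in characteristic 2. At the end only one detour remains.\<close>
      proof (cases "v + 1 < n")
        case True
        then show ?thesis
          using eq out vb \<open>v = u\<close> mesh dbl by (auto simp: wL_def closed_path_def arrows_def)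
      next
        case False
        \<comment> \<open>A closed path of odd length at \<open>n - 1\<close> has at least
          \<open>2 * n - 1\<close> arrows, whereas \<open>bs\<close> would have
          \<open>2 * n - 3\<close>.\<close>
        have "?w (v, Br (v - 1) # Ar (v - 1) # bs) = 0"
        proof (rule ccontr)
          assume "?w (v, Br (v - 1) # Ar (v - 1) # bs) \<noteq> 0"
          then have "closed_path ?L v bs" "length bs + 2 = 2 * n - 1"
            using mesh \<open>v = u\<close> vb by (auto simp: wL_def closed_path_def split: if_splits)
          moreover from this have "odd (length bs)" using n by presburger
          ultimately have "length bs \<ge> 2 * v + 1" by (intro Lq_odd_path) (auto simp: closed_path_def)
          then show False using \<open>length bs + 2 = 2 * n - 1\<close> False vb by simp
        qed
        then show ?thesis using eq out False by simp
      qed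
    next
      case False
      then show ?thesis using mesh by (simp add: vb pmult_mesh_rel)
    qed
  next
    case pow
    have "length (replicate (2 * n) Ep @ bs) \<noteq> 2 * n - 1" "length (replicate (2 * n) Ep @ bs) \<noteq> length [Ep, Ep]"
      using n by simp_all
    then have "?w (0, replicate (2 * n) Ep @ bs) = 0" by (auto simp: wL_def simp del: length_append)
    moreover have "2 * n \<ge> 1" using n by simp
    ultimately show ?thesis unfolding pow by (simp only: ep) simp
  next
    case exc
    show ?thesis
    proof (cases "v = 0")
      case True
      have a0: "Ar 0 \<in> arrows ?L" "Br 0 \<in> arrows ?L" using n by (auto simp: arrows_def)
      have m: "2 * n - 1 \<ge> 1" using n by simp
      have e1: "elem ?L (pmult ?L (mesh_rel ?L 0) (pel p) :: path \<Rightarrow> 'k)"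
        using p n by simp
      have e2: "elem ?L (pel (0, replicate (2 * n - 1) Ep @ bs) :: path \<Rightarrow> 'k)"
        using vb True n by (auto simp: valid_path_def pr)
      have "wt ?w (pmult ?L s (pel p)) = wt ?w (pmult ?L (mesh_rel ?L 0) (pel p)) + ?w (0, replicate (2 * n - 1) Ep @ bs)"
        unfolding exc pmult_add_left ep[OF m] using wt_add[OF e1 e2] True by simp
      also have "wt ?w (pmult ?L (mesh_rel ?L 0) (pel p)) = ?w (0, Ep # Ep # bs) + ?w (0, Ar 0 # Br 0 # bs)"
        using wt_mesh_rel[of 0 ?L bs ?w] vb True n by (simp add: out_Lq)
      also have "?w (0, Ep # Ep # bs) + ?w (0, Ar 0 # Br 0 # bs) + ?w (0, replicate (2 * n - 1) Ep @ bs) = 0"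
      \<comment> \<open>For empty \<open>bs\<close> the three weights are 1, 0 and 1. Otherwise the
        first two agree, and the third path is longer than \<open>2 * n - 1\<close>.\<close>
      proof (cases "bs = []")
        case True
        have "replicate (2 * n - 1) Ep \<noteq> [Ep, Ep]" using n by (auto dest: arg_cong[of _ _ length])
        moreover have "2 \<noteq> 2 * n - 1" using n by presburger
        ultimately show ?thesis using n True dbl[of 1] by (simp add: wL_def closed_path_def pr)
      next
        case False
        have "?w (0, Ep # Ep # bs) = ?w (0, Ar 0 # Br 0 # bs)"
          using False a0 by (simp add: wL_def closed_path_def)
        moreover have "?w (0, replicate (2 * n - 1) Ep @ bs) = 0"
          using False n by (cases bs) (auto simp: wL_def dest: arg_cong[of _ _ length])
        ultimately show ?thesis using dbl by simp
      qed
      finally show ?thesis .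
    next
      case False
      have "2 * n - 1 \<ge> 1" using n by simp
      with False show ?thesis unfolding exc pmult_add_left by (simp only: ep) (simp add: vb pmult_mesh_rel)
    qed
  qed
qed (use Lrels_elem[OF n] in \<open>auto simp: wL_def closed_path_def\<close>)

text \<open>Under a trace on \<open>P\<close> a closed path is determined by its length. Peak
  reduction brings it down to the vertices 0 and 1, and then each passage \<open>a_0 b_0\<close>
  equals \<open>\<epsilon>^2\<close>, the sign being immaterial in characteristic 2.\<close>

lemma L_closed_trace:
  fixes \<tau> :: "(path \<Rightarrow> 'k::field) \<Rightarrow> 'k"
  assumes n: "n \<ge> 2" and char: "CHAR('k) = 2" and \<tau>: "is_trace (Lq n) (I_ideal (Lq n)) \<tau>"
    and cl: "closed_path (Lq n) v as" "as \<noteq> []"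
  shows "\<tau> (pel (v, as)) = \<tau> (pel (0, replicate (length as) Ep))"
proof -
  let ?L = "Lq n"
  note wf = wf_L[OF n]
  have J: "is_ideal ?L (I_ideal ?L :: (path \<Rightarrow> 'k) set)"
    unfolding I_ideal_def by (rule ideal_gen_ideal) (rule I_rels_elem)
  have mesh: "mesh_rel ?L v \<in> (I_ideal ?L :: (path \<Rightarrow> 'k) set)" if "v < n" for v
    unfolding I_ideal_def using that by (auto simp: I_rels_def intro!: ideal_gen.gen)
  have "\<exists>w bs. closed_path ?L w bs \<and> w = 0 \<and> length bs = length as \<and> (\<forall>a\<in>set bs. src ?L a \<le> 1)
    \<and> \<tau> (pel (v, as)) = \<tau> (pel (w, bs))"
  proof (rule peak_reduction[OF wf _ _ _ _ cl, of "\<lambda>v as. \<tau> (pel (v, as))" "\<lambda>v. v"])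
    show "\<tau> (pel (v, xs @ ys)) = \<tau> (pel (pend ?L v xs, ys @ xs))" if "closed_path ?L v (xs @ ys)" for v xs ys
      by (rule trace_rotate[OF \<tau> wf that])
    show "tgt ?L a = Suc (src ?L a) \<or> src ?L a = Suc (tgt ?L a) \<or> src ?L a = 0 \<and> tgt ?L a = 0"
      if "a \<in> arrows ?L" for a using that by (elim Lq_arrow_cases) auto
    show "a = b" if "a \<in> arrows ?L" "b \<in> arrows ?L" "src ?L a = src ?L b" "tgt ?L a < src ?L a" "tgt ?L b < src ?L b" for a b
      using that by (elim Lq_arrow_cases) auto
    fix a mid assume a: "a \<in> arrows ?L" "tgt ?L a = Suc (src ?L a)" "0 < src ?L a" and mid: "closed_path ?L (src ?L a) mid"
    from a obtain w where w: "a = Ar w" "w + 2 \<le> n" "w > 0" by (elim Lq_arrow_cases) auto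
    have out: "out ?L w = {Br (w - 1), Ar w}" using out_arm[OF wf, of w] w by simp
    have "(\<Sum>a\<in>out ?L w. \<tau> (pel (w, a # bar a # mid))) = 0"
      using w mid by (intro trace_mesh[OF \<tau> J mesh wf]) (auto simp: closed_path_def)
    then have "\<tau> (pel (w, Ar w # Br w # mid)) = \<tau> (pel (w, Br (w - 1) # Ar (w - 1) # mid))"
      using char2_uminus[OF char] by (simp add: out add_eq_0_iff)
    then show "\<exists>b\<in>arrows ?L. src ?L b = src ?L a \<and> Suc (tgt ?L b) = src ?L b \<and>
        \<tau> (pel (src ?L a, a # bar a # mid)) = \<tau> (pel (src ?L a, b # bar b # mid))"
      using w by (intro bexI[of _ "Br (w - 1)"]) (auto simp: arrows_def)
  qed
  then obtain bs where bs: "closed_path ?L 0 bs" "length bs = length as" "\<forall>a\<in>set bs. src ?L a \<le> 1"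
    "\<tau> (pel (v, as)) = \<tau> (pel (0, bs))" by blast
  obtain h where h: "alg_hom ?L h" "\<And>f. elem ?L f \<Longrightarrow> h f = (0 :: 'k endo) \<longleftrightarrow> f \<in> I_ideal ?L"
    using ideal_hom[OF J wf] by metis
  have m0: "h (mesh_rel ?L 0) = 0" using h(2)[of "mesh_rel ?L 0"] mesh[of 0] n by simp
  have EE: "h (arrow_el ?L (Ar 0)) * h (arrow_el ?L (Br 0)) = h (arrow_el ?L Ep) * h (arrow_el ?L Ep)"
    using m0 char2_endo_uminus[OF char] unfolding hom_mesh_L0[OF n h(1)] by (simp add: add_eq_0_iff)
  have el: "elem ?L (pel (0, as) :: path \<Rightarrow> 'k)" if "closed_path ?L 0 as" for as
    using that by (auto simp: closed_path_def valid_path_def)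
  have rep: "closed_path ?L 0 (replicate k Ep)" for k
    using n by (induction k) (auto simp: closed_path_def)
  have "h (pel (0, bs)) = h (pel (0, replicate (length bs) Ep))"
    using bs(1,3)
  proof (induction bs rule: length_induct)
    case (1 bs)
    show ?case
    proof (cases bs)
      case (Cons a cs)
      then have a: "a \<in> arrows ?L" "src ?L a = 0" using 1(2) by (auto simp: closed_path_def)
      show ?thesis
      proof (cases "a = Ep")
        case True
        have cs: "closed_path ?L 0 cs" using 1(2) Cons True by (auto simp: closed_path_def)
        have s: "pel (0, Ep # as) = pmult ?L (arrow_el ?L Ep) (pel (0, as) :: path \<Rightarrow> 'k)" for as
          by (simp add: arrow_el_eq pmult_pel)
        have "h (pel (0, cs)) = h (pel (0, replicate (length cs) Ep))"
          using 1(1)[rule_format, of cs] 1(3) cs Cons by simp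
        then show ?thesis
          using cs Cons True wf rep el by (simp add: s hom_mult[OF h(1)])
      next
        case False
        then have a0: "a = Ar 0" using a by (elim Lq_arrow_cases) auto
        then obtain b ds where cs: "cs = b # ds" using 1(2) Cons by (cases cs) (auto simp: closed_path_def)
        have b: "b \<in> arrows ?L" "src ?L b = 1" using 1(2) Cons cs a0 by (auto simp: closed_path_def)
        \<comment> \<open>Its target 2 would be the source of another arrow of the closed path,
          which never leaves the vertices 0 and 1.\<close>
        have "b \<noteq> Ar 1"
        proof
          assume b1: "b = Ar 1"
          then have c: "closed_path ?L 0 (Ar 0 # Ar 1 # ds)" using 1(2) Cons cs a0 by simp
          have "tgt ?L (Ar 1) \<in> src ?L ` set (Ar 0 # Ar 1 # ds)"
            by (rule closed_tgt_src[OF c]) simp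
          then show False using 1(3) Cons cs a0 b1 by auto
        qed
        then have b0: "b = Br 0" using b by (elim Lq_arrow_cases) auto
        have ds: "closed_path ?L 0 ds" using 1(2) Cons cs a0 b0 by (auto simp: closed_path_def)
        have ab: "Ar 0 \<in> arrows ?L" "Br 0 \<in> arrows ?L" using a b a0 b0 by auto
        have s: "pel (0, Ep # Ep # as) = pmult ?L (arrow_el ?L Ep) (pmult ?L (arrow_el ?L Ep) (pel (0, as) :: path \<Rightarrow> 'k))"
          "pel (0, Ar 0 # Br 0 # as) = pmult ?L (arrow_el ?L (Ar 0)) (pmult ?L (arrow_el ?L (Br 0)) (pel (0, as) :: path \<Rightarrow> 'k))" for as
          by (simp_all add: arrow_el_eq pmult_pel)
        have "h (pel (0, ds)) = h (pel (0, replicate (length ds) Ep))"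
          using 1(1)[rule_format, of ds] 1(3) ds Cons cs by simp
        then show ?thesis
          using ds Cons cs a0 b0 wf rep el ab EE by (simp add: s hom_mult[OF h(1)] flip: mult.assoc)
      qed
    qed simp
  qed
  then have "\<tau> (pel (0, bs)) = \<tau> (pel (0, replicate (length bs) Ep))"
    using trace_cong[OF \<tau> h(1) iffD1[OF h(2)]] el bs(1) rep by metis
  then show ?thesis using bs by simp
qed

text \<open>Up to commutators \<open>\<epsilon>^(2k) = (a_0 b_0)^k\<close> becomes
  \<open>(b_0 a_0)^k = (a_1 b_1)^k\<close>, and so on along the arm; at its end the product is 0.
  The claim \<open>arm\<close> carries this out for any element representing the power.\<close>

lemma L_even_power_trace:
  fixes \<tau> :: "(path \<Rightarrow> 'k::field) \<Rightarrow> 'k"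
  assumes n: "n \<ge> 2" and char: "CHAR('k) = 2" and \<tau>: "is_trace (Lq n) (I_ideal (Lq n)) \<tau>"
  shows "\<tau> (pel (0, replicate (2 * Suc k) Ep)) = 0"
proof -
  let ?L = "Lq n"
  note wf = wf_L[OF n]
  have J: "is_ideal ?L (I_ideal ?L :: (path \<Rightarrow> 'k) set)"
    unfolding I_ideal_def by (rule ideal_gen_ideal) (rule I_rels_elem)
  obtain h where h: "alg_hom ?L h" "\<And>f. elem ?L f \<Longrightarrow> h f = (0 :: 'k endo) \<longleftrightarrow> f \<in> I_ideal ?L"
    using ideal_hom[OF J wf] by metis
  have mesh: "h (mesh_rel ?L v) = 0" if "v < n" for v
    using that h(2)[of "mesh_rel ?L v"] unfolding I_ideal_def
    by (auto simp: I_rels_def intro: ideal_gen.gen)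
  note cong = trace_cong[OF \<tau> h(1) iffD1[OF h(2)]]
  let ?A = "\<lambda>i. h (arrow_el ?L (Ar i))" and ?B = "\<lambda>i. h (arrow_el ?L (Br i))"
  have arm: "\<tau> u = 0" if "i + 2 \<le> n" "elem ?L u" "h u = (?A i * ?B i) ^ Suc k" for i u
    using that
  proof (induction "n - i" arbitrary: i u rule: less_induct)
    case less
    let ?a = "arrow_el ?L (Ar i) :: path \<Rightarrow> 'k" and ?b = "arrow_el ?L (Br i) :: path \<Rightarrow> 'k"
    have ab: "elem ?L ?a" "elem ?L ?b" using less.prems wf by (auto simp: arrows_def)
    define v where "v = pmult ?L ?b (ppow ?L (pmult ?L ?a ?b) k)"
    have v: "elem ?L v" "h v = ?B i * (?A i * ?B i) ^ k"
      using ab hom_mult_ppow[OF h(1) wf] by (simp_all add: v_def hom_mult[OF h(1)])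
    have "\<tau> u = \<tau> (pmult ?L ?a v)"
      using less.prems ab v by (intro cong) (simp_all add: hom_mult[OF h(1)] mult.assoc)
    also have "\<dots> = \<tau> (pmult ?L v ?a)" by (rule trace_comm[OF \<tau> ab(1) v(1)])
    finally have uv: "\<tau> u = \<tau> (pmult ?L v ?a)" .
    have "b * (a * b) ^ j * a = (b * a) ^ Suc j" for a b :: "'k endo" and j
      by (induction j) (simp_all add: mult.assoc)
    then have hv: "h (pmult ?L v ?a) = (?B i * ?A i) ^ Suc k"
      using ab v by (simp add: hom_mult[OF h(1)])
    show ?case
    proof (cases "i + 2 = n")
      case True
      have "?B i * ?A i = 0"
        using mesh[of "Suc i"] hom_mesh_rel[OF h(1) wf, of "Suc i"] out_arm[OF wf, of "Suc i"] True by simp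
      then have "h (pmult ?L v ?a) = h 0" using hv hom_0[OF h(1)] by simp
      then have "\<tau> (pmult ?L v ?a) = \<tau> 0" using ab v by (intro cong) simp_all
      then show ?thesis using uv trace_0[OF \<tau>] by simp
    next
      case False
      have "?B i * ?A i + ?A (Suc i) * ?B (Suc i) = 0"
        using mesh[of "Suc i"] hom_mesh_rel[OF h(1) wf, of "Suc i"] out_arm[OF wf, of "Suc i"] False less.prems by simp
      then have "?B i * ?A i = ?A (Suc i) * ?B (Suc i)"
        using char2_endo_uminus[OF char] by (simp add: add_eq_0_iff)
      then have "\<tau> (pmult ?L v ?a) = 0"
        using hv ab v False less.prems by (intro less.hyps[of "Suc i"]) simp_all
      then show ?thesis using uv by simp
    qed
  qed
  have "?A 0 * ?B 0 = h (arrow_el ?L Ep) * h (arrow_el ?L Ep)"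
    using mesh[of 0] n char2_endo_uminus[OF char] unfolding hom_mesh_L0[OF n h(1)] by (simp add: add_eq_0_iff)
  moreover have "h (pel (0, replicate (Suc j) Ep)) = h (arrow_el ?L Ep) ^ Suc j" for j
    unfolding ppow_Ep[OF n, symmetric] using wf by (intro hom_ppow_pos[OF wf h(1)]) simp_all
  from this[of "2 * Suc k - 1"]
  have "h (pel (0, replicate (2 * Suc k) Ep)) = h (arrow_el ?L Ep) ^ (2 * Suc k)" by simp
  ultimately have hp: "h (pel (0, replicate (2 * Suc k) Ep)) = (?A 0 * ?B 0) ^ Suc k"
    by (simp only: power_mult power2_eq_square)
  have "chain ?L 0 (replicate j Ep)" for j by (induction j) auto
  then have el: "elem ?L (pel (0, replicate (2 * Suc k) Ep) :: path \<Rightarrow> 'k)"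
    using order.strict_trans2[of 0 2 n] n
    by (simp only: elem_pel valid_path_def fst_conv snd_conv nverts.simps zero_less_numeral)
  show ?thesis using arm[OF _ el hp] n by simp
qed

text \<open>Coefficients at trivial paths multiply, so functions vanishing there are stable under
  multiplication from both sides.\<close>

lemma ideal_gen_trivial:
  assumes "\<And>s v. s \<in> S \<Longrightarrow> s (v, []) = 0" "f \<in> ideal_gen D S"
  shows "f (v, []) = (0 :: 'k::field)"
  using assms(2) by (induction arbitrary: v) (auto simp: assms(1) pzero_def padd_def pmult_apply)

lemma ppow_trivial: "v < nverts D \<Longrightarrow> ppow D f k (v, []) = f (v, []) ^ k"
  by (induction k) (auto simp: pone_def pmult_apply)

lemma mesh_rel_trivial: "mesh_rel D v (u, []) = (0 :: 'k::field)"
  unfolding mesh_rel_eq sum_fun_apply by (rule sum.neutral) (simp add: pel_def)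

lemma I_trivial: "f \<in> I_ideal D \<Longrightarrow> f (v, []) = (0 :: 'k::field)"
  unfolding I_ideal_def by (rule ideal_gen_trivial[of "I_rels D"]) (auto simp: I_rels_def mesh_rel_trivial)

lemma L_not_iso:
  assumes n: "n \<ge> 2" and char: "CHAR('k::field) = 2"
  shows "\<not> quot_alg_iso (Lq n) (Istar_ideal (Lq n) :: (path \<Rightarrow> 'k) set) (I_ideal (Lq n))"
proof
  let ?L = "Lq n" and ?e = "arrow_el (Lq n) Ep :: path \<Rightarrow> 'k"
  assume iso: "quot_alg_iso ?L (Istar_ideal ?L :: (path \<Rightarrow> 'k) set) (I_ideal ?L)"
  note wf = wf_L[OF n]
  have J1: "is_ideal ?L (Istar_ideal ?L :: (path \<Rightarrow> 'k) set)"
    unfolding L_Istar_ideal[OF n] by (rule ideal_gen_ideal) (rule Lrels_elem[OF n])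
  have J2: "is_ideal ?L (I_ideal ?L :: (path \<Rightarrow> 'k) set)"
    unfolding I_ideal_def by (rule ideal_gen_ideal) (rule I_rels_elem)
  show False
  proof (rule quot_alg_isoD[OF J1 J2 wf iso])
  fix h k assume h: "alg_hom ?L h" and k: "alg_hom ?L k"
    and hk: "\<And>f. elem ?L f \<Longrightarrow> h f = 0 \<longleftrightarrow> f \<in> (Istar_ideal ?L :: (path \<Rightarrow> 'k) set)"
      "\<And>f. elem ?L f \<Longrightarrow> k f = 0 \<longleftrightarrow> f \<in> I_ideal ?L"
    and im: "\<And>f. elem ?L f \<Longrightarrow> \<exists>g. elem ?L g \<and> k g = h f" "\<And>g. elem ?L g \<Longrightarrow> \<exists>f. elem ?L f \<and> k g = h f"
  note h = h hk(1) and k = k hk(2)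
  have im': "\<exists>f. elem ?L f \<and> h f = k g" if "elem ?L g" for g using im(2)[OF that] by auto
  show False
  proof (rule trace_transport[OF wL_trace[OF n char] h k J2 im'])
  fix \<tau> assume \<tau>: "is_trace ?L (I_ideal ?L) \<tau>"
    "\<And>f g. elem ?L f \<Longrightarrow> elem ?L g \<Longrightarrow> h g = k f \<Longrightarrow> \<tau> f = wt (wL n) g"
  have e: "elem ?L ?e" using wf by simp
  then obtain u where u: "elem ?L u" "k u = h ?e" using im(1) by blast
  have "\<tau> (pmult ?L u u) = wt (wL n) (pmult ?L ?e ?e)"
    using u e by (intro \<tau>(2)) (simp_all add: hom_mult[OF h(1)] hom_mult[OF k(1)])
  also have "\<dots> = 1" using n by (simp add: arrow_el_eq pmult_pel wL_def closed_path_def)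
  finally have 1: "\<tau> (pmult ?L u u) = 1" .
  have "k (ppow ?L u (2 * n)) = h (ppow ?L ?e (2 * n))"
    using hom_ppow_pos[OF wf h(1) e, of "2 * n"] hom_ppow_pos[OF wf k(1) u(1), of "2 * n"] n u(2) by simp
  also have "\<dots> = 0"
    using h(2)[of "ppow ?L ?e (2 * n)"] e unfolding L_Istar_ideal[OF n]
    by (simp add: Lrels_def ideal_gen.gen del: ppow.simps)
  finally have pow: "ppow ?L u (2 * n) \<in> I_ideal ?L" using k(2)[of "ppow ?L u (2 * n)"] u(1) by simp
  \<comment> \<open>The coefficient of \<open>ppow ?L u (2 * n)\<close> at a trivial path is a power
    of that of \<open>u\<close>, and elements of the ideal have none.\<close>
  have u0: "u (v, []) = 0" for v
  proof (cases "v < n")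
    case True
    then show ?thesis using I_trivial[OF pow, of v] ppow_trivial[of v ?L u "2 * n"] n by simp
  next
    case False
    then show ?thesis using u(1) by (auto simp: elem_def valid_path_def)
  qed
  have "\<tau> (pmult ?L u u) = 0"
  proof (rule trace_square[OF \<tau>(1) char _ u(1) u0])
    fix v as assume p: "valid_path ?L (v, as)" "as \<noteq> []"
    show "\<tau> (pmult ?L (pel (v, as)) (pel (v, as))) = 0"
    proof (cases "pend ?L v as = v")
      case True
      have cl: "closed_path ?L v (as @ as)" "as @ as \<noteq> []"
        using p True by (auto simp: closed_path_def valid_path_def)
      obtain j where "length as = Suc j" using p(2) by (cases as) auto
      then have "length (as @ as) = 2 * Suc j" by simp
      then have "\<tau> (pel (v, as @ as)) = 0"
        using L_closed_trace[OF n char \<tau>(1) cl] L_even_power_trace[OF n char \<tau>(1), of j] by metis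
      then show ?thesis using True by (simp add: pmult_pel)
    qed (simp add: pmult_pel trace_0[OF \<tau>(1)])
  qed
  with 1 show False by simp
  qed
  qed
qed

section \<open>Types D and E in characteristic two\<close>

text \<open>The height used for peak reduction; its parity gives the bipartition of the underlying
  tree.\<close>

fun dist :: "dyn \<Rightarrow> nat \<Rightarrow> nat" where
  "dist (Dq n) v = (if v \<le> 1 then 1 else v - 2)"
| "dist (Eq n) v = (if v = 0 then 1 else if v \<le> 3 then 3 - v else v - 3)"
| "dist (Lq n) v = v"

lemma star_shape: "star D \<Longrightarrow> (\<exists>n. D = Dq n \<and> n \<ge> 4) \<or> (\<exists>n. D = Eq n \<and> n \<ge> 7)"
  by (auto simp: star_def)

lemma star_edge:
  assumes "star D" "a \<in> arrows D"
  shows "dist D (tgt D a) = Suc (dist D (src D a)) \<or> dist D (src D a) = Suc (dist D (tgt D a))"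
  using star_shape[OF assms(1)] assms(2) by (cases a) (auto simp: arrows_def split: if_splits)

lemma star_parent:
  assumes "star D" "a \<in> arrows D" "b \<in> arrows D" "src D a = src D b"
    "dist D (tgt D a) < dist D (src D a)" "dist D (tgt D b) < dist D (src D b)"
  shows "a = b"
  using star_shape[OF assms(1)] assms(2-) by (cases a; cases b) (auto simp: arrows_def split: if_splits)

lemma star_dist_0: "star D \<Longrightarrow> v < nverts D \<Longrightarrow> dist D v = 0 \<longleftrightarrow> v = exc_vertex D"
  using star_shape[of D] by (auto split: if_splits)

text \<open>Provides the exchange step of peak reduction: at such a vertex the mesh relation has
  exactly two terms, one of which leads inwards.\<close>

lemma star_out_outward:
  assumes D: "star D" and a: "a \<in> arrows D" "dist D (tgt D a) = Suc (dist D (src D a))" "dist D (src D a) > 0"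
  obtains b where "out D (src D a) = {a, b}" "b \<noteq> a" "dist D (src D a) = Suc (dist D (tgt D b))"
proof -
  note wf = star_wf[OF D]
  from star_shape[OF D] consider (D) n where "D = Dq n" "n \<ge> 4" | (E) n where "D = Eq n" "n \<ge> 7" by auto
  then show thesis
  proof cases
    case D
    then obtain w where w: "a = Ar w" "w \<ge> 3" "w + 2 \<le> n"
      using a by (cases a) (auto simp: arrows_def split: if_splits)
    have "out D w = {Br (w - 1), Ar w}" using out_arm[OF wf, of w] w D by simp
    then show ?thesis using w D by (intro that[of "Br (w - 1)"], simp_all add: insert_commute, presburger?)
  next
    case E
    then consider w where "a = Ar w" "w \<ge> 4" "w + 2 \<le> n" | "a = Br 1"
      using a by (cases a) (auto simp: arrows_def split: if_splits)
    then show ?thesis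
    proof cases
      case 1
      have "out D w = {Br (w - 1), Ar w}" using out_arm[OF wf, of w] 1 E by simp
      then show ?thesis using 1 E by (intro that[of "Br (w - 1)"], simp_all add: insert_commute, presburger?)
    next
      case 2
      have "out D (Suc (Suc 0)) = {Br 1, Ar 2}" using out_Eq_2[of n] E by (simp add: numeral_2_eq_2)
      then show ?thesis using 2 E by (intro that[of "Ar 2"]) simp_all
    qed
  qed
qed

section \<open>Trace functions on the deformed algebra vanish on long paths\<close>

lemma trace_nonclosed:
  assumes "is_trace D J \<tau>" "wf_dyn D" "valid_path D (v, as)" "pend D v as \<noteq> v"
  shows "\<tau> (pel (v, as)) = 0"
proof -
  have "elem D (pel (v, []) :: path \<Rightarrow> 'a)" "elem D (pel (v, as) :: path \<Rightarrow> 'a)"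
    using assms(3) by (auto simp: valid_path_def)
  from trace_comm[OF assms(1) this] show ?thesis
    using assms(4) trace_0[OF assms(1)] by (simp add: pmult_pel)
qed

lemma prod_words_Cons: "x \<in> A \<Longrightarrow> w \<in> words A k \<Longrightarrow> x * w \<in> words A (Suc k)"
  unfolding words_def by (auto intro!: image_eqI[where x = "x # _"])

lemma sum_vertices:
  assumes wf: "wf_dyn D" shows "(\<Sum>v<nverts D. \<Sum>a\<in>out D v. f a) = (\<Sum>a\<in>arrows D. f a)"
  using sum.group[of "arrows D" "{..<nverts D}" "src D" f] arrow_less(1)[OF wf]
  by (auto simp: out_def)

text \<open>Summing the mesh relations over all vertices lists every edge twice, as
  \<open>a_i b_i\<close> and as \<open>b_i a_i\<close>. A trace takes equal values on the two, so
  the sum has trace 0 in characteristic 2. All mesh relations but the exceptional one vanish in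
  \<open>P*\<close>, and that one equals \<open>f\<close> up to sign.\<close>

lemma star_trace_fe:
  fixes \<tau> :: "(path \<Rightarrow> 'k::field) \<Rightarrow> 'k"
  assumes D: "star D" and char: "CHAR('k) = 2" and \<tau>: "is_trace D (Istar_ideal D) \<tau>"
  shows "\<tau> (fe D) = 0"
proof -
  note wf = star_wf[OF D]
  have mem: "r \<in> Istar_ideal D" if "r \<in> rels D (1 :: 'k)" for r
    unfolding star_Istar_ideal[OF D] using that by (rule ideal_gen.gen)
  let ?m = "\<lambda>v. mesh_rel D v :: path \<Rightarrow> 'k"
  have "\<tau> (?m (exc_vertex D) + psmult 1 (fe D)) = 0"
    using mem trace_ideal[OF \<tau>] unfolding rels_def by blast
  then have exc: "\<tau> (fe D) = \<tau> (?m (exc_vertex D))"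
    using D char2_uminus[OF char] by (simp add: trace_add[OF \<tau>] add_eq_0_iff)
  have other: "\<tau> (?m v) = 0" if "v < nverts D" "v \<noteq> exc_vertex D" for v
    using mem[of "?m v"] that trace_ideal[OF \<tau>] unfolding rels_def by blast
  have "(\<Sum>v<nverts D. \<tau> (?m v)) = \<tau> (?m (exc_vertex D)) + (\<Sum>v\<in>{..<nverts D} - {exc_vertex D}. \<tau> (?m v))"
    using D by (intro sum.remove) auto
  also have "\<dots> = \<tau> (?m (exc_vertex D))" using other by simp
  finally have "\<tau> (fe D) = (\<Sum>v<nverts D. \<tau> (?m v))" using exc by simp
  also have "\<dots> = (\<Sum>v<nverts D. \<Sum>a\<in>out D v. \<tau> (pel (src D a, [a, bar a])))"
  proof (rule sum.cong[OF refl])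
    fix v assume v: "v \<in> {..<nverts D}"
    have "\<tau> (\<Sum>a\<in>A. pel (v, [a, bar a])) = (\<Sum>a\<in>A. \<tau> (pel (src D a, [a, bar a])))" if "A \<subseteq> out D v" for A
      using that
    proof (induction A rule: infinite_finite_induct)
      case (insert a A)
      have el: "elem D (pel (v, [b, bar b]) :: path \<Rightarrow> 'k)" if "b \<in> out D v" for b
        using that v by (auto simp: valid_path_def out_def)
      have "elem D (\<Sum>a\<in>A. pel (v, [a, bar a]) :: path \<Rightarrow> 'k)" using insert.prems by (intro elem_sum el) auto
      moreover have "src D a = v" using insert.prems by (auto simp: out_def)
      ultimately show ?case using insert el by (simp add: trace_add[OF \<tau>])
    qed (auto simp: trace_0[OF \<tau>])
    from this[OF order_refl] show "\<tau> (?m v) = (\<Sum>a\<in>out D v. \<tau> (pel (src D a, [a, bar a])))"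
      by (simp only: mesh_rel_eq)
  qed
  also have "\<dots> = (\<Sum>a\<in>arrows D. \<tau> (pel (src D a, [a, bar a])))" by (rule sum_vertices[OF wf])
  also have "\<dots> = 0"
  proof -
    let ?f = "\<lambda>a. \<tau> (pel (src D a, [a, bar a]))"
    have arr: "arrows D = Ar ` {i. i + 2 \<le> nverts D} \<union> Br ` {i. i + 2 \<le> nverts D}"
      using star_not_L[OF D] by (auto simp: arrows_def)
    have fin: "finite {i. i + 2 \<le> nverts D}" by (rule finite_subset[of _ "{..nverts D}"]) auto
    have "(\<Sum>a\<in>arrows D. ?f a) = (\<Sum>i | i + 2 \<le> nverts D. ?f (Ar i)) + (\<Sum>i | i + 2 \<le> nverts D. ?f (Br i))"
      unfolding arr using fin by (subst sum.union_disjoint) (auto simp: sum.reindex inj_on_def)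
    also have "(\<Sum>i | i + 2 \<le> nverts D. ?f (Ar i)) = (\<Sum>i | i + 2 \<le> nverts D. ?f (Br i))"
    proof (rule sum.cong[OF refl])
      fix i assume "i \<in> {i. i + 2 \<le> nverts D}"
      then have a: "Ar i \<in> arrows D" "Br i \<in> arrows D" by (auto simp: arrows_def)
      then have "closed_path D (src D (Ar i)) ([Ar i] @ [Br i])"
        using arrow_less[OF wf a(1)] by (auto simp: closed_path_def)
      from trace_rotate[OF \<tau> wf this] show "?f (Ar i) = ?f (Br i)" by simp
    qed
    finally show ?thesis using char2_double[OF char] by simp
  qed
  finally show ?thesis .
qed

text \<open>Peak reduction uses the mesh relations only at positive distance from the exceptional
  vertex; these are not affected by the deformation.\<close>

lemma star_closed_trace:
  fixes \<tau> :: "(path \<Rightarrow> 'k::field) \<Rightarrow> 'k"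
  assumes D: "star D" and char: "CHAR('k) = 2" and \<tau>: "is_trace D (Istar_ideal D) \<tau>"
    and cl: "closed_path D v as" "as \<noteq> []"
  obtains bs where "closed_path D (exc_vertex D) bs" "length bs = length as"
    "\<forall>a\<in>set bs. dist D (src D a) \<le> 1" "\<tau> (pel (v, as)) = \<tau> (pel (exc_vertex D, bs))"
proof -
  note wf = star_wf[OF D]
  have J: "is_ideal D (Istar_ideal D :: (path \<Rightarrow> 'k) set)"
    unfolding star_Istar_ideal[OF D] by (rule ideal_gen_ideal) (rule rels_elem[OF D])
  have mesh: "mesh_rel D v \<in> (Istar_ideal D :: (path \<Rightarrow> 'k) set)" if "v < nverts D" "v \<noteq> exc_vertex D" for v
    unfolding star_Istar_ideal[OF D] using that by (auto simp: rels_def intro!: ideal_gen.gen)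
  have "\<exists>w bs. closed_path D w bs \<and> dist D w = 0 \<and> length bs = length as \<and> (\<forall>a\<in>set bs. dist D (src D a) \<le> 1)
    \<and> \<tau> (pel (v, as)) = \<tau> (pel (w, bs))"
  proof (rule peak_reduction[OF wf _ _ _ _ cl, of "\<lambda>v as. \<tau> (pel (v, as))" "dist D"])
    show "\<tau> (pel (v, xs @ ys)) = \<tau> (pel (pend D v xs, ys @ xs))" if "closed_path D v (xs @ ys)" for v xs ys
      by (rule trace_rotate[OF \<tau> wf that])
    show "dist D (tgt D a) = Suc (dist D (src D a)) \<or> dist D (src D a) = Suc (dist D (tgt D a))
        \<or> dist D (src D a) = 0 \<and> dist D (tgt D a) = 0" if "a \<in> arrows D" for a
      using star_edge[OF D that] by blast
    show "a = b" if "a \<in> arrows D" "b \<in> arrows D" "src D a = src D b" "dist D (tgt D a) < dist D (src D a)"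
      "dist D (tgt D b) < dist D (src D b)" for a b
      by (rule star_parent[OF D that])
    fix a mid assume a: "a \<in> arrows D" "dist D (tgt D a) = Suc (dist D (src D a))" "0 < dist D (src D a)"
      and mid: "closed_path D (src D a) mid"
    obtain b where b: "out D (src D a) = {a, b}" "b \<noteq> a" "dist D (src D a) = Suc (dist D (tgt D b))"
      using star_out_outward[OF D a] by metis
    have ba: "b \<in> arrows D" "src D b = src D a" using b(1) by (auto simp: out_def)
    have "src D a \<noteq> exc_vertex D" using a star_dist_0[OF D arrow_less(1)[OF wf a(1)]] by auto
    then have "(\<Sum>c\<in>out D (src D a). \<tau> (pel (src D a, c # bar c # mid))) = 0"
      using mid arrow_less(1)[OF wf a(1)] by (intro trace_mesh[OF \<tau> J mesh wf]) (auto simp: closed_path_def)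
    then have "\<tau> (pel (src D a, a # bar a # mid)) = \<tau> (pel (src D a, b # bar b # mid))"
      using char2_uminus[OF char] b(2) by (simp add: b(1) add_eq_0_iff)
    then show "\<exists>b\<in>arrows D. src D b = src D a \<and> Suc (dist D (tgt D b)) = dist D (src D b) \<and>
        \<tau> (pel (src D a, a # bar a # mid)) = \<tau> (pel (src D a, b # bar b # mid))"
      using b ba by auto
  qed
  then obtain w bs where w: "closed_path D w bs" "dist D w = 0" "length bs = length as" "\<forall>a\<in>set bs. dist D (src D a) \<le> 1"
    "\<tau> (pel (v, as)) = \<tau> (pel (w, bs))" by blast
  moreover have "w = exc_vertex D" using star_dist_0[OF D, of w] w by (auto simp: closed_path_def)
  ultimately show thesis using that by blast
qed

text \<open>A closed path that stays within distance one returns from each excursion along the edge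
  by which it left. It is therefore a product of the cycles \<open>x\<close>, \<open>y\<close> and
  \<open>z\<close> at the exceptional vertex.\<close>

lemma star_word:
  fixes h :: "(path \<Rightarrow> 'k::field) \<Rightarrow> 'k endo"
  assumes D: "star D" and h: "alg_hom D h"
    and cl: "closed_path D (exc_vertex D) bs" "\<forall>a\<in>set bs. dist D (src D a) \<le> 1" "bs \<noteq> []"
  shows "even (length bs)" and "h (pel (exc_vertex D, bs)) \<in> words {h (xe D), h (ye D),
      h (arrow_el D (Ar (exc_vertex D))) * h (arrow_el D (Br (exc_vertex D)))} (length bs div 2)"
proof -
  note wf = star_wf[OF D]
  let ?v = "exc_vertex D" and ?Z = "h (arrow_el D (Ar (exc_vertex D))) * h (arrow_el D (Br (exc_vertex D)))"
  let ?A = "{h (xe D), h (ye D), ?Z}"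
  have "even (length bs) \<and> h (pel (?v, bs)) \<in> words ?A (length bs div 2)"
    using cl
  proof (induction bs rule: length_induct)
    case (1 bs)
    then obtain a cs where bs: "bs = a # cs" by (cases bs) auto
    have a: "a \<in> arrows D" "src D a = ?v" using 1(2) by (auto simp: closed_path_def bs)
    have d0: "dist D ?v = 0" using star_dist_0[OF D] D by simp
    have d1: "dist D (tgt D a) = 1" using star_edge[OF D a(1)] a d0 by auto
    then have "cs \<noteq> []" using 1(2) d0 by (auto simp: bs closed_path_def)
    then obtain b ds where cs: "cs = b # ds" by (cases cs) auto
    have b: "b \<in> arrows D" "src D b = tgt D a" using 1(2) by (auto simp: closed_path_def bs cs)
    have "dist D (tgt D b) \<le> 1"
      using closed_tgt_src[OF 1(2), of b] 1(3) by (auto simp: bs cs)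
    then have "b = bar a"
      using star_edge[OF D b(1)] b d1 d0 a by (intro star_parent[OF D]) auto
    then have bs: "bs = a # bar a # ds" by (simp add: bs cs)
    have ds: "closed_path D ?v ds" using 1(2) a by (auto simp: bs closed_path_def)
    have aa: "h (pmult D (arrow_el D a) (arrow_el D (bar a))) \<in> ?A"
    proof -
      have "a \<in> {Br 0, Br (yi D), Ar ?v}"
        using a out_exc[OF wf star_not_L[OF D]] by (auto simp: out_def)
      then show ?thesis using D wf by (auto simp: xe_def ye_def hom_mult[OF h])
    qed
    have p: "pel (?v, bs) = pmult D (pmult D (arrow_el D a) (arrow_el D (bar a))) (pel (?v, ds) :: path \<Rightarrow> 'k)"
      using a by (simp add: bs arrow_el_eq pmult_pel)
    show ?case
    proof (cases "ds = []")
      case True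
      have "pel (?v, bs) = pmult D (arrow_el D a) (arrow_el D (bar a) :: path \<Rightarrow> 'k)"
        using a by (simp add: bs True arrow_el_eq pmult_pel)
      then show ?thesis using aa by (simp add: bs True words_Suc words_0)
    next
      case False
      then have IH: "even (length ds)" "h (pel (?v, ds)) \<in> words ?A (length ds div 2)"
        using 1 ds by (auto simp: bs)
      have "h (pel (?v, bs)) = h (pmult D (arrow_el D a) (arrow_el D (bar a))) * h (pel (?v, ds))"
        unfolding p using a wf ds by (intro hom_mult[OF h]) (auto simp: closed_path_def valid_path_def)
      then show ?thesis using prod_words_Cons[OF aa IH(2)] IH(1) by (simp add: bs)
    qed
  qed
  then show "even (length bs)" "h (pel (?v, bs)) \<in> words ?A (length bs div 2)" by auto
qed

text \<open>After peak reduction the path is a word in \<open>x\<close>, \<open>y\<close>,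
  \<open>z\<close> with at least \<open>2q\<close> letters. Such a word is a multiple of
  \<open>f\<close> for exactly \<open>2q\<close> letters and 0 beyond, and the trace of
  \<open>f\<close> vanishes.\<close>

lemma star_trace_long:
  fixes \<tau> :: "(path \<Rightarrow> 'k::field) \<Rightarrow> 'k"
  assumes D: "star D" and char: "CHAR('k) = 2" and \<tau>: "is_trace D (Istar_ideal D) \<tau>"
    and p: "valid_path D (v, as)" "length as \<ge> 4 * qexp D"
  shows "\<tau> (pel (v, as)) = 0"
proof (cases "pend D v as = v")
  case False
  then show ?thesis using trace_nonclosed[OF \<tau> star_wf[OF D] p(1)] by simp
next
  case True
  note wf = star_wf[OF D]
  have q: "qexp D \<ge> 1" by (rule star_qexp(1)[OF D])
  have "closed_path D v as" "as \<noteq> []" using True p q by (auto simp: closed_path_def valid_path_def)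
  then obtain bs where bs: "closed_path D (exc_vertex D) bs" "length bs = length as"
    "\<forall>a\<in>set bs. dist D (src D a) \<le> 1" "\<tau> (pel (v, as)) = \<tau> (pel (exc_vertex D, bs))"
    using star_closed_trace[OF D char \<tau>] by metis
  have J: "is_ideal D (Istar_ideal D :: (path \<Rightarrow> 'k) set)"
    unfolding star_Istar_ideal[OF D] by (rule ideal_gen_ideal) (rule rels_elem[OF D])
  obtain h where h: "alg_hom D h" "\<And>f. elem D f \<Longrightarrow> h f = (0 :: 'k endo) \<longleftrightarrow> f \<in> Istar_ideal D"
    using ideal_hom[OF J wf] by metis
  have R: "h r = 0" if "r \<in> rels D 1" for r
    using h(2)[of r] that rels_elem[OF D that] unfolding star_Istar_ideal[OF D] by (auto intro: ideal_gen.gen)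
  have soc: "socle_rel (h (xe D)) (h (ye D)) (qexp D)"
    using R by (intro star_socle_rel[OF D h(1)]) (auto simp: rels_def)
  let ?Z = "h (arrow_el D (Ar (exc_vertex D))) * h (arrow_el D (Br (exc_vertex D)))"
  have "h (mesh_rel D (exc_vertex D) + psmult 1 (fe D)) = 0" using R unfolding rels_def by blast
  then have "h (xe D) + h (ye D) + ?Z + (h (xe D) * h (ye D)) ^ qexp D = 0"
    using D hom_mesh_exc[OF D h(1)] hom_fe[OF D h(1)] by (simp add: hom_add[OF h(1)])
  note W = socle_rel_words[OF soc q this]
  have "bs \<noteq> []" using bs(2) p(2) q by auto
  note w = star_word[OF D h(1) bs(1,3) this]
  have "h (pel (exc_vertex D, bs)) \<in> gspan {(h (xe D) * h (ye D)) ^ qexp D}"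
  proof (cases "length bs div 2 = 2 * qexp D")
    case True then show ?thesis using w W(1) by auto
  next
    case False
    then have "length bs div 2 > 2 * qexp D" using p(2) bs(2) by linarith
    then have "h (pel (exc_vertex D, bs)) = 0" using w(2) W(2)[of "length bs div 2"] by blast
    then show ?thesis by (simp add: gspan_0)
  qed
  \<comment> \<open>The span lives in the operator ring, where \<open>\<tau>\<close> is not defined.
    Its members are lifted to elements of trace 0, beginning with \<open>fe D\<close>.\<close>
  then have "\<exists>u. elem D u \<and> h u = h (pel (exc_vertex D, bs)) \<and> \<tau> u = 0"
  proof induction
    case gspan_0
    then show ?case using hom_0[OF h(1)] trace_0[OF \<tau>] by (intro exI[of _ 0]) simp
  next
    case (gspan_base b)
    then show ?case using hom_fe[OF D h(1)] star_trace_fe[OF D char \<tau>] D by (intro exI[of _ "fe D"]) simp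
  next
    case (gspan_diff x y)
    then obtain u v where "elem D u" "h u = x" "\<tau> u = 0" "elem D v" "h v = y" "\<tau> v = 0" by blast
    then have "elem D (u - v) \<and> h (u - v) = x - y \<and> \<tau> (u - v) = 0"
      using hom_minus[OF h(1), of u v] trace_minus[OF \<tau>, of u v] elem_minus[of D u v] by simp
    then show ?case by blast
  qed
  then obtain u where "elem D u" "h u = h (pel (exc_vertex D, bs))" "\<tau> u = 0" by blast
  moreover have "elem D (pel (exc_vertex D, bs) :: path \<Rightarrow> 'k)" using bs(1) by (auto simp: closed_path_def valid_path_def)
  ultimately show ?thesis using trace_cong[OF \<tau> h(1) iffD1[OF h(2)]] bs(4) by metis
qed

section \<open>Cyclic words and a functional for the undeformed algebra\<close>

text \<open>
  A cyclic word is spread along a closed path: its letters sit at the vertices of odd distance from the exceptional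
  vertex, and a letter is forced only where the path turns at the end of a short arm.
\<close>

fun okl :: "dyn \<Rightarrow> nat \<Rightarrow> bool option \<Rightarrow> bool" where
  "okl D v None = even (dist D v)"
| "okl D v (Some b) = (odd (dist D v) \<and> (v = 0 \<longrightarrow> b) \<and> (v = yi D \<longrightarrow> \<not> b))"

definition inter :: "bool list \<Rightarrow> bool option list" where
  "inter w = concat (map (\<lambda>b. [Some b, None]) w)"

text \<open>The patterns starting with a letter fit paths that start at odd distance from the
  exceptional vertex; their rotations fit those that start at even distance.\<close>

definition blank :: "bool list set \<Rightarrow> bool option list set" where
  "blank S = inter ` S \<union> (\<lambda>w. rotate1 (inter w)) ` S"

definition compat :: "dyn \<Rightarrow> arr list \<Rightarrow> bool option list \<Rightarrow> bool" where
  "compat D as W = list_all2 (\<lambda>a c. okl D (src D a) c) as W"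

text \<open>Modulo 2 this is the value of the functional on the path. At an odd vertex of the long
  arm both letters are allowed, which amounts to replacing \<open>z\<close> by \<open>x + y\<close>
  and expanding.\<close>

definition cnt :: "dyn \<Rightarrow> bool list set \<Rightarrow> arr list \<Rightarrow> nat" where
  "cnt D S as = card {W \<in> blank S. compat D as W}"

lemma inter_simps [simp]: "inter [] = []" "inter (b # w) = Some b # None # inter w"
  "inter (v @ w) = inter v @ inter w" "length (inter w) = 2 * length w"
  by (induction w) (auto simp: inter_def)

lemma inter_inject: "inter v = inter w \<longleftrightarrow> v = w"
proof (induction v arbitrary: w)
  case Nil then show ?case by (cases w) auto
next
  case (Cons b v) then show ?case by (cases w) auto
qed

lemma inter_nth: "i < length w \<Longrightarrow> inter w ! (2 * i) = Some (w ! i)" "i < length w \<Longrightarrow> inter w ! Suc (2 * i) = None"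
proof (induction w arbitrary: i)
  case (Cons b w)
  { case 1 then show ?case using Cons.IH(1)[of "i - 1"] by (cases i) auto }
  { case 2 then show ?case using Cons.IH(2)[of "i - 1"] by (cases i) auto }
qed auto

lemma rotate1_inter: "rotate1 (rotate1 (inter w)) = inter (rotate1 w)"
  by (cases w) auto

lemma drop_inter: "drop (2 * k) (inter w) = inter (drop k w)"
proof (induction w arbitrary: k)
  case (Cons b w) then show ?case by (cases k) auto
qed auto

text \<open>With \<open>True\<close> for \<open>x\<close> and \<open>False\<close> for
  \<open>y\<close>, these conditions say that the indicator function of \<open>S\<close> modulo 2 is
  a rotation-invariant functional on words of length \<open>2q\<close> compatible with the local
  relations: no \<open>xx\<close>; no \<open>yy\<close> in type D and no \<open>yyy\<close> in type
  E; and an even count over all prefixes of a given suffix, expressing \<open>(x + y)^K = 0\<close>.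
  Invariance allows the forbidden factors to be tested at the front only. The last condition makes
  the functional nonzero on \<open>(xy)^q\<close>.\<close>

definition cyc_words :: "dyn \<Rightarrow> bool list set \<Rightarrow> bool" where
  "cyc_words D S \<longleftrightarrow> finite S \<and> (\<forall>w\<in>S. length w = 2 * qexp D \<and> rotate1 w \<in> S
     \<and> \<not> (w ! 0 \<and> w ! 1) \<and> (yi D = 1 \<longrightarrow> w ! 0 \<or> w ! 1) \<and> (yi D = 2 \<longrightarrow> w ! 0 \<or> w ! 1 \<or> w ! 2))
   \<and> (\<forall>s. even (card {w \<in> S. drop (nverts D - exc_vertex D) w = s}))
   \<and> concat (replicate (qexp D) [True, False]) \<in> S"

text \<open>The words for E7 and E8 are the support, modulo 2, of the functional on the top degree of
  the local algebra at the branch vertex; they are listed in pairs with a common suffix.\<close>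

definition pairs7 :: "(bool list \<times> bool list) list" where
  "pairs7 =
    [([True, False, True, False, True, False, True, False],
      [False, True, False, False, True, False, True, False]),
     ([False, True, False, True, False, True, False, True],
      [False, False, True, False, False, True, False, True]),
     ([True, False, True, False, False, True, False, False],
      [True, False, False, True, False, True, False, False]),
     ([False, True, False, False, True, False, False, True],
      [False, False, True, False, True, False, False, True]),
     ([True, False, False, True, False, False, True, False],
      [False, True, False, True, False, False, True, False])]"

lemma pairs7_words:
  "list_all (\<lambda>w. length w = 8 \<and> \<not> (w ! 0 \<and> w ! 1) \<and> (w ! 0 \<or> w ! 1 \<or> w ! 2)) (map fst pairs7 @ map snd pairs7)"
  by (simp add: pairs7_def)

lemma pairs7_suffix: "list_all (\<lambda>(v, w). drop 4 v = drop 4 w) pairs7"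
  by (simp add: pairs7_def)

lemma pairs7_distinct: "distinct (map fst pairs7 @ map snd pairs7)"
  by (simp add: pairs7_def)

lemma pairs7_rotate:
  "list_all (\<lambda>w. rotate1 w \<in> set (map fst pairs7 @ map snd pairs7)) (map fst pairs7 @ map snd pairs7)"
  by (simp add: pairs7_def)

lemma pairs7_alternating: "concat (replicate 4 [True, False]) \<in> set (map fst pairs7 @ map snd pairs7)"
  by (simp add: pairs7_def numeral_eq_Suc)

definition pairs8 :: "(bool list \<times> bool list) list" where
  "pairs8 =
    [([True, False, True, False, True, False, True, False, True, False, True, False, True, False],
      [True, False, False, True, False, False, True, False, True, False, True, False, True, False]),
     ([False, True, False, False, True, False, True, False, True, False, True, False, True, False],
      [False, True, False, True, False, False, True, False, True, False, True, False, True, False]),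
     ([False, True, False, True, False, True, False, True, False, True, False, True, False, True],
      [False, False, True, False, False, True, False, True, False, True, False, True, False, True]),
     ([True, False, True, False, True, False, True, False, True, False, False, True, False, False],
      [True, False, False, True, False, False, True, False, True, False, False, True, False, False]),
     ([False, True, False, True, False, True, False, True, False, False, True, False, False, True],
      [False, False, True, False, False, True, False, True, False, False, True, False, False, True]),
     ([True, False, True, False, True, False, True, False, False, True, False, False, True, False],
      [True, False, False, True, False, False, True, False, False, True, False, False, True, False]),
     ([False, True, False, False, True, False, True, False, False, True, False, False, True, False],
      [False, True, False, True, False, False, True, False, False, True, False, False, True, False]),
     ([False, True, False, True, False, True, False, False, True, False, False, True, False, True],
      [False, False, True, False, False, True, False, False, True, False, False, True, False, True]),
     ([True, False, True, False, True, False, False, True, False, False, True, False, True, False],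
      [False, True, False, False, True, False, False, True, False, False, True, False, True, False]),
     ([False, True, False, True, False, False, True, False, False, True, False, True, False, True],
      [False, True, False, False, True, False, True, False, False, True, False, True, False, True]),
     ([True, False, True, False, False, True, False, False, True, False, True, False, True, False],
      [True, False, False, True, False, True, False, False, True, False, True, False, True, False]),
     ([False, True, False, False, True, False, False, True, False, True, False, True, False, True],
      [False, False, True, False, True, False, False, True, False, True, False, True, False, True]),
     ([True, False, False, True, False, True, False, True, False, True, False, True, False, False],
      [True, False, True, False, False, True, False, True, False, True, False, True, False, False]),
     ([False, False, True, False, True, False, True, False, True, False, True, False, False, True],
      [False, True, False, False, True, False, True, False, True, False, True, False, False, True]),
     ([False, True, False, True, False, True, False, True, False, True, False, False, True, False],
      [True, False, False, True, False, True, False, True, False, True, False, False, True, False]),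
     ([True, False, True, False, True, False, True, False, False, True, False, True, False, False],
      [True, False, False, True, False, False, True, False, False, True, False, True, False, False]),
     ([False, True, False, True, False, True, False, False, True, False, True, False, False, True],
      [False, False, True, False, False, True, False, False, True, False, True, False, False, True]),
     ([True, False, True, False, True, False, False, True, False, True, False, False, True, False],
      [False, True, False, False, True, False, False, True, False, True, False, False, True, False]),
     ([False, True, False, True, False, False, True, False, True, False, False, True, False, True],
      [False, False, True, False, True, False, True, False, True, False, False, True, False, True]),
     ([True, False, True, False, False, True, False, True, False, False, True, False, True, False],
      [False, True, False, True, False, True, False, True, False, False, True, False, True, False]),
     ([True, False, True, False, False, True, False, False, True, False, False, True, False, False],
      [True, False, False, True, False, True, False, False, True, False, False, True, False, False]),
     ([False, True, False, False, True, False, False, True, False, False, True, False, False, True],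
      [False, False, True, False, True, False, False, True, False, False, True, False, False, True])]"

lemma pairs8_words:
  "list_all (\<lambda>w. length w = 14 \<and> \<not> (w ! 0 \<and> w ! 1) \<and> (w ! 0 \<or> w ! 1 \<or> w ! 2)) (map fst pairs8 @ map snd pairs8)"
  by (simp add: pairs8_def)

lemma pairs8_suffix: "list_all (\<lambda>(v, w). drop 5 v = drop 5 w) pairs8"
  by (simp add: pairs8_def)

lemma pairs8_distinct: "distinct (map fst pairs8 @ map snd pairs8)"
  by (simp add: pairs8_def)

lemma pairs8_rotate:
  "list_all (\<lambda>w. rotate1 w \<in> set (map fst pairs8 @ map snd pairs8)) (map fst pairs8 @ map snd pairs8)"
  by (simp add: pairs8_def)

lemma pairs8_alternating: "concat (replicate 7 [True, False]) \<in> set (map fst pairs8 @ map snd pairs8)"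
  by (simp add: pairs8_def numeral_eq_Suc)

text \<open>The members of a pair have the same suffix, so a fibre contains both or neither;
  distinctness ensures that each word is counted once.\<close>

lemma even_card_fibres:
  assumes "distinct (map fst ps @ map snd ps)" "list_all (\<lambda>(v, w). drop K v = drop K w) ps"
  shows "even (card {w \<in> set (map fst ps @ map snd ps). drop K w = s})"
proof -
  let ?P = "\<lambda>w. drop K w = s"
  have "{w \<in> set (map fst ps @ map snd ps). ?P w} = {w. ?P w} \<inter> set (map fst ps @ map snd ps)" by auto
  then have "card {w \<in> set (map fst ps @ map snd ps). ?P w} = length (filter ?P (map fst ps @ map snd ps))"
    using distinct_length_filter[OF assms(1), of ?P] by metis
  moreover have "length (filter ?P (map fst ps)) = length (filter ?P (map snd ps))"
    using assms(2) by (induction ps) auto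
  ultimately show ?thesis by simp
qed

lemma alternating_snoc: "concat (replicate q [x, y]) @ [x] = x # concat (replicate q [y, x])"
  by (induction q) auto

lemma alternating_shift: "rotate1 (concat (replicate q [x, y])) = concat (replicate q [y, x])"
  by (cases q) (simp_all add: alternating_snoc)

lemma cyc_words_exist:
  assumes "star D" obtains S where "cyc_words D S"
  using assms
proof (cases rule: star_cases)
  case (D m)
  let ?A = "concat (replicate (m - 1) [True, False])" and ?B = "concat (replicate (m - 1) [False, True])"
  obtain k where k: "m - 1 = Suc k" using D(1) by (cases "m - 1") auto
  have len: "length (concat (replicate j [x, y])) = 2 * j" for j and x y :: bool by (induction j) auto
  have AB: "?A \<noteq> ?B" unfolding k by simp
  \<comment> \<open>In type D the prefix length \<open>2 * m - 2\<close> is the full length of a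
    word, so the two alternating words share the empty suffix.\<close>
  have "even (card {w \<in> {?A, ?B}. drop (2 * m - 2) w = s})" for s
  proof -
    have "drop (2 * m - 2) w = []" if "w \<in> {?A, ?B}" for w using that len[of "m - 1"] by auto
    then have "{w \<in> {?A, ?B}. drop (2 * m - 2) w = s} = (if s = [] then {?A, ?B} else {})" by auto
    then show ?thesis using AB by auto
  qed
  then have "cyc_words D {?A, ?B}"
    unfolding cyc_words_def D(2) qexp.simps using len
    by (simp add: alternating_shift alternating_snoc k[simplified])
  then show ?thesis by (rule that)
next
  case E7
  let ?L = "map fst pairs7 @ map snd pairs7"
  have "\<forall>w\<in>set ?L. length w = 2 * qexp D \<and> rotate1 w \<in> set ?L \<and> \<not> (w ! 0 \<and> w ! 1) \<and> (w ! 0 \<or> w ! 1 \<or> w ! 2)"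
    using pairs7_words pairs7_rotate unfolding list_all_iff by (simp add: E7)
  moreover have "even (card {w \<in> set ?L. drop (nverts D - exc_vertex D) w = s})" for s
    using even_card_fibres[OF pairs7_distinct pairs7_suffix] by (simp add: E7)
  ultimately have "cyc_words D (set ?L)"
    using pairs7_alternating unfolding cyc_words_def by (simp add: E7)
  then show ?thesis by (rule that)
next
  case E8
  let ?L = "map fst pairs8 @ map snd pairs8"
  have "\<forall>w\<in>set ?L. length w = 2 * qexp D \<and> rotate1 w \<in> set ?L \<and> \<not> (w ! 0 \<and> w ! 1) \<and> (w ! 0 \<or> w ! 1 \<or> w ! 2)"
    using pairs8_words pairs8_rotate unfolding list_all_iff by (simp add: E8)
  moreover have "even (card {w \<in> set ?L. drop (nverts D - exc_vertex D) w = s})" for s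
    using even_card_fibres[OF pairs8_distinct pairs8_suffix] by (simp add: E8)
  ultimately have "cyc_words D (set ?L)"
    using pairs8_alternating unfolding cyc_words_def by (simp add: E8)
  then show ?thesis by (rule that)
qed

section \<open>Counting compatible words modulo 2\<close>

lemma blank_rotate1:
  assumes "cyc_words D S" shows "rotate1 ` blank S = blank S"
proof (rule endo_inj_surj)
  show "finite (blank S)" using assms by (auto simp: blank_def cyc_words_def)
  show "rotate1 ` blank S \<subseteq> blank S"
    using assms by (auto simp: blank_def cyc_words_def rotate1_inter)
  show "inj_on rotate1 (blank S)" using inj_rotate1 by (rule inj_on_subset) simp
qed

lemma compat_rotate1: "compat D (rotate1 as) (rotate1 W) \<longleftrightarrow> compat D as W"
proof (cases "length as = length W")
  case True
  then show ?thesis by (cases as; cases W) (auto simp: compat_def list_all2_append)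
next
  case False
  then show ?thesis unfolding compat_def by (metis length_rotate1 list_all2_lengthD)
qed

lemma cnt_rotate1:
  assumes "cyc_words D S" shows "cnt D S (rotate1 as) = cnt D S as"
proof -
  have "{W \<in> blank S. compat D (rotate1 as) W} = rotate1 ` {W \<in> blank S. compat D as W}"
  proof
    show "rotate1 ` {W \<in> blank S. compat D as W} \<subseteq> {W \<in> blank S. compat D (rotate1 as) W}"
      using blank_rotate1[OF assms] by (auto simp: compat_rotate1)
    show "{W \<in> blank S. compat D (rotate1 as) W} \<subseteq> rotate1 ` {W \<in> blank S. compat D as W}"
    proof
      fix W assume W: "W \<in> {W \<in> blank S. compat D (rotate1 as) W}"
      then obtain V where V: "V \<in> blank S" "W = rotate1 V" using blank_rotate1[OF assms] by (metis (no_types, lifting) imageE mem_Collect_eq)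
      with W show "W \<in> rotate1 ` {W \<in> blank S. compat D as W}" by (auto simp: compat_rotate1)
    qed
  qed
  then show ?thesis
    unfolding cnt_def by (simp add: card_image[OF inj_on_subset[OF inj_rotate1 subset_UNIV]])
qed

lemma cnt_rotate:
  assumes "cyc_words D S" shows "cnt D S (bs @ as) = cnt D S (as @ bs)"
proof -
  have "cnt D S (rotate k as) = cnt D S as" for k as
    by (induction k) (simp_all add: cnt_rotate1[OF assms])
  from this[of "length as" "as @ bs"] show ?thesis by (simp add: rotate_append)
qed

text \<open>Taking the maximum with the exceptional vertex flattens the short arms. What remains is
  the position on the long arm, which changes by at most one per arrow.\<close>

lemma star_height:
  assumes D: "star D"
  shows "chain D v as \<Longrightarrow> max v (exc_vertex D) \<le> max (pend D v as) (exc_vertex D) + length as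
    \<and> max (pend D v as) (exc_vertex D) \<le> max v (exc_vertex D) + length as"
proof (induction as arbitrary: v)
  case (Cons a as)
  have "max (src D a) (exc_vertex D) \<le> max (tgt D a) (exc_vertex D) + 1
     \<and> max (tgt D a) (exc_vertex D) \<le> max (src D a) (exc_vertex D) + 1"
    using star_shape[OF D] Cons.prems by (cases a) (auto simp: arrows_def split: if_splits)
  moreover have "src D a = v" using Cons.prems by simp
  ultimately show ?case using Cons.IH[of "tgt D a"] Cons.prems
    unfolding pend.simps list.size chain.simps by linarith
qed simp

lemma star_parity:
  assumes D: "star D" shows "chain D v as \<Longrightarrow> even (dist D v + dist D (pend D v as) + length as)"
proof (induction as arbitrary: v)
  case (Cons a as)
  have "odd (dist D (src D a) + dist D (tgt D a))" using star_edge[OF D, of a] Cons.prems by auto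
  then show ?case using Cons.IH[of "tgt D a"] Cons.prems by auto
qed simp

lemma chain_nth: "chain D v as \<Longrightarrow> i < length as \<Longrightarrow> src D (as ! i) = pend D v (take i as)"
proof (induction as arbitrary: v i)
  case (Cons a as) then show ?case by (cases i) auto
qed simp

lemma star_dist_arm: "star D \<Longrightarrow> exc_vertex D \<le> v \<Longrightarrow> dist D v = v - exc_vertex D"
  using star_shape[of D] by auto

lemma compatD:
  assumes "compat D as W" shows "length W = length as" "i < length as \<Longrightarrow> okl D (src D (as ! i)) (W ! i)"
  using assms by (auto simp: compat_def list_all2_conv_all_nth)

lemma compat_Cons2:
  "compat D (a # b # bs) W \<longleftrightarrow> (\<exists>c d W'. W = c # d # W' \<and> okl D (src D a) c \<and> okl D (src D b) d \<and> compat D bs W')"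
  by (auto simp: compat_def list_all2_Cons1)

lemma okl_even: "even (dist D v) \<Longrightarrow> okl D v c \<longleftrightarrow> c = None"
  by (cases c) auto

lemma okl_odd: "odd (dist D v) \<Longrightarrow> v \<noteq> 0 \<Longrightarrow> v \<noteq> yi D \<Longrightarrow> okl D v c \<longleftrightarrow> c \<noteq> None"
  by (cases c) auto

lemma okl_0: "star D \<Longrightarrow> okl D 0 c \<longleftrightarrow> c = Some True"
  using star_shape[of D] by (cases c) auto

lemma okl_yi: "star D \<Longrightarrow> okl D (yi D) c \<longleftrightarrow> c = Some False"
  using star_shape[of D] by (cases c) auto

lemma okl_exc: "star D \<Longrightarrow> okl D (exc_vertex D) c \<longleftrightarrow> c = None"
  by (intro okl_even) (simp add: star_dist_arm)

declare okl.simps [simp del]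

lemma blank_Some:
  assumes D: "star D" and S: "cyc_words D S" and W: "W \<in> blank S" "W ! 0 \<noteq> None"
  obtains w where "w \<in> S" "W = inter w"
proof -
  have "rotate1 (inter w) ! 0 = None" if "w \<in> S" for w
  proof -
    have "length w > 0" using S that star_qexp(1)[OF D] by (auto simp: cyc_words_def)
    then show ?thesis by (cases w) auto
  qed
  then show thesis using W that by (auto simp: blank_def)
qed

text \<open>Applied with \<open>f\<close> the suffix map: a condition on the suffix alone selects a
  union of fibres, each of even size.\<close>

lemma even_card_fibres_pred:
  assumes "finite S" "\<And>s. even (card {w \<in> S. f w = s})" shows "even (card {w \<in> S. Q (f w)})"
proof -
  let ?T = "{w \<in> S. Q (f w)}"
  have "card ?T = (\<Sum>s\<in>f ` ?T. card {w \<in> ?T. f w = s})"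
    using sum.image_gen[of ?T "\<lambda>_. 1 :: nat" f] assms(1) by simp
  also have "even \<dots>"
  proof (rule dvd_sum)
    fix s assume "s \<in> f ` ?T"
    then have "{w \<in> ?T. f w = s} = {w \<in> S. f w = s}" by auto
    then show "even (card {w \<in> ?T. f w = s})" using assms(2) by simp
  qed
  finally show ?thesis .
qed

text \<open>Here \<open>(x + y)^K = 0\<close> enters, with \<open>K\<close> the number of vertices
  of the long arm. A closed path visiting the end of that arm stays away from the exceptional vertex
  long enough for \<open>K\<close> consecutive letters to be free. Compatibility then depends only
  on the remaining letters, so the words counted form a union of fibres of even size.\<close>

lemma even_cnt_leaf:
  assumes D: "star D" and S: "cyc_words D S"
    and cl: "closed_path D (nverts D - 1) bs" and len: "length bs + 2 = 4 * qexp D"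
  shows "even (cnt D S (Br (nverts D - 2) # Ar (nverts D - 2) # bs))"
proof -
  let ?e = "exc_vertex D"
  define v where "v = nverts D - 1"
  define K where "K = nverts D - ?e"
  have K: "2 \<le> K" "K \<le> 2 * qexp D" using D by (auto simp: star_def K_def)
  have v: "?e < v" "v = ?e + (K - 1)" "v < nverts D" "v - 1 = nverts D - 2"
    using K star_tgt[OF D] by (auto simp: v_def K_def)
  let ?ad = "[Br (v - 1), Ar (v - 1)]"
  \<comment> \<open>The last \<open>K - 2\<close> arrows of \<open>bs\<close> are moved to the
    front. The path then starts at odd distance, and the \<open>K\<close> free letters occupy the
    positions 0, 2, ..., \<open>2 * K - 2\<close>.\<close>
  define cs zs where "cs = take (length bs - (K - 2)) bs" and "zs = drop (length bs - (K - 2)) bs"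
  have bs: "bs = cs @ zs" by (simp add: cs_def zs_def)
  have lz: "length zs = K - 2" "length cs + K = 4 * qexp D" using len K by (auto simp: zs_def cs_def)
  have ch: "chain D v cs" "chain D (pend D v cs) zs" "pend D (pend D v cs) zs = v"
    using cl by (auto simp: closed_path_def bs v_def)
  define s0 where "s0 = pend D v cs"
  define as where "as = zs @ ?ad @ cs"
  have ad: "chain D v ?ad" "pend D v ?ad = v"
    using v K star_shape[OF D] by (auto simp: arrows_def)
  have as: "chain D s0 as" using ch ad by (auto simp: as_def s0_def)
  have las: "length as = 4 * qexp D" using lz K by (simp add: as_def)
  have cnt: "cnt D S (Br (nverts D - 2) # Ar (nverts D - 2) # bs) = cnt D S as"
    using cnt_rotate[OF S, of zs "?ad @ cs"] unfolding as_def bs v(4)[symmetric] by simp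
  have par: "odd (dist D (pend D s0 (take i as)) + i)" if "i \<le> length as" for i
  proof -
    have "even (dist D s0 + dist D v + (K - 2))"
      using star_parity[OF D ch(2)] ch(3) lz by (simp add: s0_def)
    moreover have "dist D v = K - 1" using star_dist_arm[OF D, of v] v by simp
    ultimately have "odd (dist D s0)" using K by presburger
    moreover have "chain D s0 (take i as)" using as append_take_drop_id[of i as] by (metis chain_append)
    from star_parity[OF D this] have "even (dist D s0 + dist D (pend D s0 (take i as)) + i)"
      using that by (simp add: min_def)
    ultimately show ?thesis by presburger
  qed
  \<comment> \<open>On the way to the end of the arm, a vertex \<open>j\<close> steps before it is
    at distance at least \<open>K - 1 - j\<close>; the same estimate holds after leaving it. This
    stays positive for even positions up to \<open>2 * K - 2\<close>.\<close>
  have high: "?e < pend D s0 (take i as)" if i: "i < 2 * K - 1" "even i" for i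
  proof -
    consider "i \<le> K - 2" | "i = K - 1" | "i \<ge> K" by linarith
    then show ?thesis
    proof cases
      case 1
      have "chain D (pend D s0 (take i zs)) (drop i zs)" "pend D (pend D s0 (take i zs)) (drop i zs) = v"
        using ch append_take_drop_id[of i zs] unfolding s0_def by (metis chain_append, metis pend_append)
      moreover have "take i as = take i zs" using 1 lz by (simp add: as_def)
      ultimately have "max v ?e \<le> max (pend D s0 (take i as)) ?e + (K - 2 - i)"
        using star_height[OF D, of "pend D s0 (take i zs)" "drop i zs"] lz by simp
      then show ?thesis using v K by linarith
    next
      case 2
      then have "odd K" "K \<ge> 3" using i K by presburger+
      have "take i as = zs @ [Br (v - 1)]" using 2 lz K by (simp add: as_def take_Cons' numeral_2_eq_2)
      then have "pend D s0 (take i as) = v - 1" using ch by (simp add: s0_def)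
      then show ?thesis using v \<open>K \<ge> 3\<close> by simp
    next
      case 3
      have "chain D v (take (i - K) cs)" using ch(1) append_take_drop_id[of "i - K" cs] by (metis chain_append)
      moreover have "take i as = zs @ ?ad @ take (i - K) cs"
      proof -
        have "i - length zs = Suc (Suc (i - K))" using lz K 3 by simp
        then show ?thesis using lz 3 by (simp add: as_def)
      qed
      then have "pend D s0 (take i as) = pend D v (take (i - K) cs)" using ch ad by (simp add: s0_def)
      ultimately have "max v ?e \<le> max (pend D s0 (take i as)) ?e + (i - K)"
        using star_height[OF D, of v "take (i - K) cs"] by (simp add: min_def split: if_splits)
      then show ?thesis using v K i 3 by linarith
    qed
  qed
  have ok: "okl D (src D (as ! i)) c \<longleftrightarrow> (if even i then c \<noteq> None else c = None)" if i: "i < 2 * K - 1" for i c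
  proof -
    have il: "i < length as" using i K las by linarith
    have src: "src D (as ! i) = pend D s0 (take i as)" by (rule chain_nth[OF as il])
    show ?thesis
    proof (cases "even i")
      case True
      have "odd (dist D (src D (as ! i)))" using par[of i] il True by (simp add: src)
      moreover have "?e < src D (as ! i)" using high[OF i True] by (simp add: src)
      ultimately show ?thesis using True star_tgt(9)[OF D] by (simp add: okl_odd)
    next
      case False
      have "even (dist D (src D (as ! i)))" using par[of i] il False by (simp add: src)
      then show ?thesis using False by (simp add: okl_even)
    qed
  qed
  \<comment> \<open>The cut after \<open>2 * K - 1\<close> entries falls just behind the last free
    letter, so the \<open>None\<close> that follows it is the first entry of the remainder.\<close>
  define g where "g = (\<lambda>w. compat D (drop (2 * K - 1) as) (None # inter w))"
  have drop: "drop (2 * K - 1) (inter w) = None # inter (drop K w)" if "w \<in> S" for w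
  proof -
    have lw: "K \<le> length w" using S that K by (auto simp: cyc_words_def)
    then have "drop (K - 1) w = w ! (K - 1) # drop K w"
      using Cons_nth_drop_Suc[of "K - 1" w] K by simp
    moreover have "2 * K - 1 = Suc (2 * (K - 1))" using K by simp
    then have "drop (2 * K - 1) (inter w) = drop 1 (drop (2 * (K - 1)) (inter w))"
      by (simp add: drop_drop)
    ultimately show ?thesis by (simp add: drop_inter)
  qed
  have lw: "length (inter w) = length as" if "w \<in> S" for w using S that las by (auto simp: cyc_words_def)
  have "{W \<in> blank S. compat D as W} = inter ` {w \<in> S. g (drop K w)}"
  proof (intro equalityI subsetI)
    fix W assume "W \<in> {W \<in> blank S. compat D as W}"
    then have W: "W \<in> blank S" "compat D as W" by auto
    have "okl D (src D (as ! 0)) (W ! 0)" using compatD(2)[OF W(2), of 0] las star_qexp(1)[OF D] by simp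
    then have "W ! 0 \<noteq> None" using ok[of 0] K by simp
    then obtain w where w: "w \<in> S" "W = inter w" using blank_Some[OF D S W(1)] by metis
    have "compat D (drop (2 * K - 1) as) (drop (2 * K - 1) W)"
      using W(2) unfolding compat_def by (rule list_all2_dropI)
    then show "W \<in> inter ` {w \<in> S. g (drop K w)}" using w drop by (auto simp: g_def)
  next
    fix W assume "W \<in> inter ` {w \<in> S. g (drop K w)}"
    then obtain w where w: "w \<in> S" "g (drop K w)" "W = inter w" by auto
    have dr: "compat D (drop (2 * K - 1) as) (drop (2 * K - 1) W)" using w drop by (simp add: g_def)
    have "okl D (src D (as ! i)) (W ! i)" if i: "i < length as" for i
    proof (cases "i < 2 * K - 1")
      case True
      have lw': "i div 2 < length w" using i lw[OF w(1)] by simp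
      show ?thesis
      proof (cases "even i")
        case True
        then have "W ! i = Some (w ! (i div 2))" using inter_nth(1)[OF lw'] w(3) by simp
        then show ?thesis using ok[OF \<open>i < 2 * K - 1\<close>] True by simp
      next
        case False
        then have "Suc (2 * (i div 2)) = i" by presburger
        then have "W ! i = None" using inter_nth(2)[OF lw'] w(3) by simp
        then show ?thesis using ok[OF \<open>i < 2 * K - 1\<close>] False by simp
      qed
    next
      case False
      then show ?thesis using compatD(2)[OF dr, of "i - (2 * K - 1)"] i lw[OF w(1)] w(3) by simp
    qed
    then have "compat D as W" using lw[OF w(1)] w(3) by (simp add: compat_def list_all2_conv_all_nth)
    then show "W \<in> {W \<in> blank S. compat D as W}" using w by (auto simp: blank_def)
  qed
  then have "cnt D S as = card {w \<in> S. g (drop K w)}"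
    unfolding cnt_def by (simp add: card_image inj_on_def inter_inject)
  also have "even \<dots>"
  proof (rule even_card_fibres_pred[of S "drop K" g])
    show "finite S" "even (card {w \<in> S. drop K w = s})" for s
      using S unfolding cyc_words_def K_def by blast+
  qed
  finally show ?thesis by (simp add: cnt)
qed

text \<open>This is the mesh relation at each vertex, modulo 2. At the exceptional vertex the words
  for \<open>z\<close> split into those for \<open>x\<close> and those for \<open>y\<close>. At a
  vertex with two neighbours both detours admit the same letters, so their counts agree. At the ends
  of the short arms a forbidden factor leaves no word, and the end of the long arm is
  \<open>even_cnt_leaf\<close>.\<close>

lemma even_cnt_sum:
  assumes D: "star D" and S: "cyc_words D S" and cl: "closed_path D v bs" and len: "length bs + 2 = 4 * qexp D"
  shows "even (\<Sum>a\<in>out D v. cnt D S (a # bar a # bs))"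
proof -
  note wf = star_wf[OF D] and nL = star_not_L[OF D]
  have q: "qexp D \<ge> 1" by (rule star_qexp(1)[OF D])
  have v: "v < nverts D" using cl by (simp add: closed_path_def)
  have "length bs \<noteq> 0" using len by presburger
  then have ne: "bs \<noteq> []" by simp
  have fin: "finite {W \<in> blank S. P W}" for P using S by (auto simp: blank_def cyc_words_def)
  have eq: "cnt D S (a # bar a # bs) = cnt D S (b # bar b # bs)"
    if "src D a = src D b" "\<And>c. okl D (tgt D a) c \<longleftrightarrow> okl D (tgt D b) c" for a b
    unfolding cnt_def compat_Cons2 using that by simp
  have two: "even (\<Sum>a\<in>out D v. cnt D S (a # bar a # bs))"
    if "out D v = {a, b}" "a \<noteq> b" "\<And>c. okl D (tgt D a) c \<longleftrightarrow> okl D (tgt D b) c" for a b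
  proof -
    have "a \<in> out D v" "b \<in> out D v" using that(1) by auto
    then have "src D a = src D b" by (simp add: out_def)
    then show ?thesis using eq[OF _ that(3)] that(1,2) by simp
  qed
  have w: "w ! 0 \<and> w ! 1 \<Longrightarrow> False" "yi D = 1 \<Longrightarrow> w ! 0 \<or> w ! 1"
    "yi D = 2 \<Longrightarrow> w ! 0 \<or> w ! 1 \<or> w ! 2" "length w = 2 * qexp D" if "w \<in> S" for w
    using S that by (auto simp: cyc_words_def)
  have srcs: "(as ! 0 \<in> arrows D \<and> src D (as ! 0) = u)" if "chain D u as" "as \<noteq> []" for u as
    using that by (cases as) auto
  consider (e) "v = exc_vertex D" | (leaf) "v = nverts D - 1" | (arm) "exc_vertex D < v" "v + 1 < nverts D"
    | (zero) "v = 0" | (D1) n where "D = Dq n" "v = 1" | (E1) n where "D = Eq n" "n \<ge> 7" "v = 1"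
    | (E2) n where "D = Eq n" "n \<ge> 7" "v = 2"
    using star_shape[OF D] v by fastforce
  then show ?thesis
  proof cases
    case e
    have out: "out D v = {Br 0, Br (yi D), Ar (exc_vertex D)}" using out_exc[OF wf nL] e by simp
    have tgtZ: "odd (dist D (Suc (exc_vertex D)))" using star_dist_arm[OF D, of "Suc (exc_vertex D)"] by simp
    have tz: "tgtA D (exc_vertex D) = Suc (exc_vertex D)" using star_shape[OF D] by auto
    \<comment> \<open>The neighbour on the long arm admits either letter, while the other two force
      theirs, and these differ.\<close>
    have okz: "okl D (Suc (exc_vertex D)) c \<longleftrightarrow> okl D 0 c \<or> okl D (yi D) c" for c
      using okl_odd[OF tgtZ, of c] star_tgt(9)[OF D] by (cases c) (auto simp: okl_0[OF D] okl_yi[OF D])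
    have "{W \<in> blank S. compat D (Ar (exc_vertex D) # bar (Ar (exc_vertex D)) # bs) W}
      = {W \<in> blank S. compat D (Br 0 # bar (Br 0) # bs) W} \<union> {W \<in> blank S. compat D (Br (yi D) # bar (Br (yi D)) # bs) W}"
      unfolding compat_Cons2 using D by (auto simp: okz tz) 
    moreover have "{W \<in> blank S. compat D (Br 0 # bar (Br 0) # bs) W} \<inter> {W \<in> blank S. compat D (Br (yi D) # bar (Br (yi D)) # bs) W} = {}"
      unfolding compat_Cons2 using D by (auto simp: okl_0 okl_yi)
    ultimately have "cnt D S (Ar (exc_vertex D) # bar (Ar (exc_vertex D)) # bs)
      = cnt D S (Br 0 # bar (Br 0) # bs) + cnt D S (Br (yi D) # bar (Br (yi D)) # bs)"
      unfolding cnt_def by (simp only: card_Un_disjoint[OF fin fin])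
    then show ?thesis using star_tgt(5)[OF D] by (simp add: out) blast
  next
    case leaf
    have "exc_vertex D < v" using star_qexp(2)[OF D] leaf by simp
    then have "out D v = {Br (nverts D - 2)}" using out_arm[OF wf, of v] v leaf by (simp add: numeral_2_eq_2)
    then show ?thesis using even_cnt_leaf[OF D S _ len] cl leaf by simp
  next
    case arm
    have t: "tgt D (Br (v - 1)) = v - 1" "tgt D (Ar v) = v + 1"
      using arm star_shape[OF D] by auto
    have "dist D (v - 1) = v - 1 - exc_vertex D" "dist D (v + 1) = v + 1 - exc_vertex D"
      using arm by (intro star_dist_arm[OF D]; simp)+
    then have "even (dist D (v - 1)) \<longleftrightarrow> even (dist D (v + 1))" using arm by presburger
    then have "okl D (tgt D (Br (v - 1))) c \<longleftrightarrow> okl D (tgt D (Ar v)) c" for c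
      unfolding t using arm star_tgt[OF D] by (cases c) (auto simp: okl.simps)
    then show ?thesis using arm out_arm[OF wf, of v] v by (intro two[of "Br (v - 1)" "Ar v"]) auto
  next
    case E2
    have "out D v = {Br 1, Ar 2}" using E2 out_Eq_2[of n] by simp
    moreover have "okl D (tgt D (Br 1)) c \<longleftrightarrow> okl D (tgt D (Ar 2)) c" for c
      using E2 by (cases c) (auto simp: okl.simps)
    ultimately show ?thesis by (intro two[of "Br 1" "Ar 2"]) auto
  next
    case zero
    \<comment> \<open>The detour returns to vertex 0, where \<open>bs\<close> starts, so two
      successive letters would both be \<open>x\<close>.\<close>
    have "\<not> compat D (Ar 0 # Br 0 # bs) W" if W: "W \<in> blank S" for W
    proof
      assume c: "compat D (Ar 0 # Br 0 # bs) W"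
      have "src D (bs ! 0) = 0" using srcs cl ne zero by (auto simp: closed_path_def)
      then have W02: "W ! 0 = Some True" "W ! 2 = Some True"
        using compatD(2)[OF c, of 0] compatD(2)[OF c, of 2] ne by (auto simp: okl_0[OF D])
      then obtain x where x: "x \<in> S" "W = inter x" using blank_Some[OF D S W] by auto
      have "1 < length x" "0 < length x" using w(4)[OF x(1)] q by simp_all
      then show False using W02 w(1)[OF x(1)] inter_nth(1)[of 0 x] inter_nth(1)[of 1 x] x(2) by simp
    qed
    then have "cnt D S (Ar 0 # Br 0 # bs) = 0" unfolding cnt_def by (metis (no_types, lifting) card.empty Collect_empty_eq)
    then show ?thesis using out_0[OF wf nL] zero by simp
  next
    case D1
    have y: "yi D = 1" using D1 by simp
    have "\<not> compat D (Ar 1 # Br 1 # bs) W" if W: "W \<in> blank S" for W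
    proof
      assume c: "compat D (Ar 1 # Br 1 # bs) W"
      have "src D (bs ! 0) = 1" using srcs cl ne D1 by (auto simp: closed_path_def)
      then have W02: "W ! 0 = Some False" "W ! 2 = Some False"
        using compatD(2)[OF c, of 0] compatD(2)[OF c, of 2] ne okl_yi[OF D] by (auto simp: y)
      then obtain x where x: "x \<in> S" "W = inter x" using blank_Some[OF D S W] by auto
      have "1 < length x" "0 < length x" using w(4)[OF x(1)] q by simp_all
      then show False using W02 w(2)[OF x(1) y] inter_nth(1)[of 0 x] inter_nth(1)[of 1 x] x(2) by simp
    qed
    then have "cnt D S (Ar 1 # Br 1 # bs) = 0" unfolding cnt_def by (metis (no_types, lifting) card.empty Collect_empty_eq)
    then show ?thesis using out_1[OF wf nL] D1(2) by simp
  next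
    case E1
    have y: "yi D = 2" using E1 by simp
    have q4: "qexp D \<ge> 4" using E1 by simp
    obtain cs l where bs: "bs = cs @ [l]" using ne by (metis rev_exhaust)
    have l: "l \<in> arrows D" "tgt D l = 1" using cl E1 by (auto simp: closed_path_def bs)
    then have l2: "src D l = 2" using E1 by (cases l) (auto simp: arrows_def split: if_splits)
    obtain c1 c2 ds where cs: "cs = c1 # c2 # ds"
    proof -
      have "length cs \<ge> 2" using len q4 by (simp add: bs)
      then show thesis using that by (cases cs; cases "tl cs") auto
    qed
    have c1: "c1 \<in> arrows D" "src D c1 = 1" "src D c2 = tgt D c1" using cl E1 by (auto simp: closed_path_def bs cs)
    then have c2: "src D c2 = 2" using E1 by (cases c1) (auto simp: arrows_def split: if_splits)
    \<comment> \<open>The factor \<open>yyy\<close> becomes visible only after the last arrow of the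
      closed path is moved to the front: vertex 2 is then visited at the positions 0, 2 and
      4.\<close>
    have rot: "cnt D S (Ar 1 # Br 1 # bs) = cnt D S (l # Ar 1 # Br 1 # cs)"
      using cnt_rotate[OF S, of "[l]" "Ar 1 # Br 1 # cs"] by (simp add: bs)
    have "\<not> compat D (l # Ar 1 # Br 1 # cs) W" if W: "W \<in> blank S" for W
    proof
      assume c: "compat D (l # Ar 1 # Br 1 # cs) W"
      have "src D (Br 1) = 2" using E1 by simp
      then have W02: "W ! 0 = Some False" "W ! 2 = Some False" "W ! 4 = Some False"
        using compatD(2)[OF c, of 0] compatD(2)[OF c, of 2] compatD(2)[OF c, of 4] okl_yi[OF D] l2 c2
        by (auto simp: y cs simp del: src.simps)
      then obtain x where x: "x \<in> S" "W = inter x" using blank_Some[OF D S W] by auto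
      have "2 < length x" "1 < length x" "0 < length x" using w(4)[OF x(1)] q4 by simp_all
      then show False using W02 w(3)[OF x(1) y] inter_nth(1)[of 0 x] inter_nth(1)[of 1 x] inter_nth(1)[of 2 x] x(2) by simp
    qed
    then have "cnt D S (l # Ar 1 # Br 1 # cs) = 0" unfolding cnt_def by (metis (no_types, lifting) card.empty Collect_empty_eq)
    then show ?thesis using out_1[OF wf nL] E1(3) rot by simp
  qed
qed

text \<open>The functional lives in the single length \<open>4 * qexp D\<close>, that of the paths
  in \<open>f\<close>. The mesh relations are homogeneous of length 2, so this restriction is
  compatible with them.\<close>

definition wS :: "dyn \<Rightarrow> bool list set \<Rightarrow> path \<Rightarrow> 'k::field" where
  "wS D S = (\<lambda>(v, as). if closed_path D v as \<and> length as = 4 * qexp D then of_nat (cnt D S as) else 0)"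

lemma of_nat_even:
  assumes "CHAR('k::field) = 2" "even n" shows "(of_nat n :: 'k) = 0"
proof -
  obtain k where "n = k + k" using assms(2) by (metis evenE mult_2)
  then show ?thesis using char2_double[OF assms(1)] by simp
qed

lemma wS_trace:
  assumes D: "star D" and S: "cyc_words D S" and char: "CHAR('k::field) = 2"
  shows "is_trace D (I_ideal D) (wt (wS D S :: path \<Rightarrow> 'k))"
  unfolding I_ideal_def
proof (rule wt_trace[OF star_wf[OF D]])
  let ?w = "wS D S :: path \<Rightarrow> 'k"
  show "?w (v, as @ bs) = ?w (pend D v as, bs @ as)" if c: "closed_path D v (as @ bs)" for v as bs
    using c closed_path_rotate[OF star_wf[OF D] c] cnt_rotate[OF S, of bs as] by (simp add: wS_def add.commute)
  fix s :: "path \<Rightarrow> 'k" and p assume s: "s \<in> I_rels D" and p: "valid_path D p"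
  obtain u where u: "s = mesh_rel D u" "u < nverts D" using s by (auto simp: I_rels_def)
  obtain v bs where vb: "p = (v, bs)" "v < nverts D" "chain D v bs" using p by (cases p) (auto simp: valid_path_def)
  show "wt ?w (pmult D s (pel p)) = 0"
  proof (cases "v = u")
    case True
    have eq: "wt ?w (pmult D s (pel p)) = (\<Sum>a\<in>out D v. ?w (v, a # bar a # bs))"
      using wt_mesh_rel[OF vb(2,3), of ?w] by (simp add: u True vb)
    have cl: "closed_path D v (a # bar a # bs) \<longleftrightarrow> closed_path D v bs" if "a \<in> out D v" for a
      using that vb by (auto simp: closed_path_def out_def)
    show ?thesis
    proof (cases "closed_path D v bs \<and> length bs + 2 = 4 * qexp D")
      case c: True
      have "(\<Sum>a\<in>out D v. ?w (v, a # bar a # bs)) = (\<Sum>a\<in>out D v. of_nat (cnt D S (a # bar a # bs)))"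
        by (rule sum.cong[OF refl]) (use c cl in \<open>simp add: wS_def\<close>)
      also have "\<dots> = of_nat (\<Sum>a\<in>out D v. cnt D S (a # bar a # bs))" by simp
      also have "\<dots> = 0" using even_cnt_sum[OF D S, of v bs] c by (intro of_nat_even[OF char]) auto
      finally show ?thesis using eq by simp
    next
      case c: False
      have "(\<Sum>a\<in>out D v. ?w (v, a # bar a # bs)) = 0"
        by (rule sum.neutral) (use c cl in \<open>auto simp: wS_def\<close>)
      then show ?thesis using eq by simp
    qed
  next
    case False
    then show ?thesis using u vb by (simp add: pmult_mesh_rel)
  qed
qed (use I_rels_elem in \<open>auto simp: wS_def closed_path_def\<close>)

text \<open>The cycle of \<open>(xy)^q\<close> with vertex 0 as its base point. It visits only the
  short arms and the exceptional vertex, so every letter is forced and exactly one word is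
  counted.\<close>

definition top_path :: "dyn \<Rightarrow> arr list" where
  "top_path D = concat (replicate (qexp D) [Ar 0, Br (yi D), Ar (yi D), Br 0])"

lemma top_path_closed:
  assumes D: "star D"
  shows "closed_path D 0 (top_path D)" "length (top_path D) = 4 * qexp D" "top_path D \<noteq> []"
proof -
  have "chain D 0 (concat (replicate k [Ar 0, Br (yi D), Ar (yi D), Br 0]))
    \<and> pend D 0 (concat (replicate k [Ar 0, Br (yi D), Ar (yi D), Br 0])) = 0
    \<and> length (concat (replicate k [Ar 0, Br (yi D), Ar (yi D), Br 0])) = 4 * k" for k
    using D by (induction k) auto
  then show "closed_path D 0 (top_path D)" "length (top_path D) = 4 * qexp D"
    using D by (auto simp: closed_path_def top_path_def)
  then show "top_path D \<noteq> []" using star_qexp(1)[OF D] by auto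
qed

lemma wS_top_path:
  assumes D: "star D" and S: "cyc_words D S" shows "wS D S (0, top_path D) = (1 :: 'k::field)"
proof -
  let ?P = "\<lambda>k. concat (replicate k [Ar 0, Br (yi D), Ar (yi D), Br 0])"
  have c: "compat D (?P k) W \<longleftrightarrow> W = inter (concat (replicate k [True, False]))" for k W
  proof (induction k arbitrary: W)
    case 0 then show ?case by (auto simp: compat_def)
  next
    case (Suc k)
    show ?case
      using Suc.IH D by (auto simp: compat_Cons2 okl_0 okl_yi okl_exc)
  qed
  have "concat (replicate (qexp D) [True, False]) \<in> S" using S by (simp add: cyc_words_def)
  then have "{W \<in> blank S. compat D (top_path D) W} = {inter (concat (replicate (qexp D) [True, False]))}"
    unfolding top_path_def c by (auto simp: blank_def)
  then show ?thesis using top_path_closed[OF D] by (simp add: wS_def cnt_def)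
qed

section \<open>Non-isomorphism for D and E in characteristic two\<close>

lemma pmult_support:
  assumes "\<And>p. f p \<noteq> 0 \<Longrightarrow> length (snd p) \<ge> m" "\<And>p. g p \<noteq> 0 \<Longrightarrow> length (snd p) \<ge> n"
    "pmult D f g p \<noteq> (0 :: 'k::field)"
  shows "length (snd p) \<ge> m + n"
proof -
  obtain v as where p: "p = (v, as)" by force
  from assms(3) obtain i where i: "i \<le> length as" "f (v, take i as) \<noteq> 0" "g (pend D v (take i as), drop i as) \<noteq> 0"
    unfolding p pmult_apply by (metis (no_types, lifting) atMost_iff mult_not_zero sum.not_neutral_contains_not_neutral)
  then show ?thesis using assms(1)[OF i(2)] assms(2)[OF i(3)] by (simp add: p)
qed

text \<open>The trace \<open>wS\<close> of \<open>P\<close> is transported to \<open>P*\<close>. The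
  path \<open>top_path D\<close>, where it equals 1, is represented in \<open>P*\<close> by a
  product of the elements representing its arrows; that product is supported in lengths at least
  \<open>4q\<close>, where every trace on \<open>P*\<close> vanishes.\<close>

lemma star_not_iso:
  assumes D: "star D" and char: "CHAR('k::field) = 2"
  shows "\<not> quot_alg_iso D (Istar_ideal D :: (path \<Rightarrow> 'k) set) (I_ideal D)"
proof
  assume iso: "quot_alg_iso D (Istar_ideal D :: (path \<Rightarrow> 'k) set) (I_ideal D)"
  note wf = star_wf[OF D]
  have J1: "is_ideal D (Istar_ideal D :: (path \<Rightarrow> 'k) set)"
    unfolding star_Istar_ideal[OF D] by (rule ideal_gen_ideal) (rule rels_elem[OF D])
  have J2: "is_ideal D (I_ideal D :: (path \<Rightarrow> 'k) set)"
    unfolding I_ideal_def by (rule ideal_gen_ideal) (rule I_rels_elem)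
  obtain S where S: "cyc_words D S" using cyc_words_exist[OF D] by metis
  show False
  proof (rule quot_alg_isoD[OF J1 J2 wf iso])
    fix h k assume h: "alg_hom D h" and k: "alg_hom D k"
      and hk: "\<And>f. elem D f \<Longrightarrow> h f = 0 \<longleftrightarrow> f \<in> (Istar_ideal D :: (path \<Rightarrow> 'k) set)"
        "\<And>f. elem D f \<Longrightarrow> k f = 0 \<longleftrightarrow> f \<in> I_ideal D"
      and im: "\<And>f. elem D f \<Longrightarrow> \<exists>g. elem D g \<and> k g = h f" "\<And>g. elem D g \<Longrightarrow> \<exists>f. elem D f \<and> k g = h f"
    show False
    proof (rule trace_transport[OF wS_trace[OF D S char] k hk(2) h hk(1) J1 im(1)])
      fix \<tau> assume \<tau>: "is_trace D (Istar_ideal D) \<tau>"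
        "\<And>f g. elem D f \<Longrightarrow> elem D g \<Longrightarrow> k g = h f \<Longrightarrow> \<tau> f = wt (wS D S) g"
      \<comment> \<open>The isomorphism may send an arrow to any element, but \<open>a^2 = 0\<close>
        is preserved. So the square of a representative \<open>u\<close> lies in
        \<open>Istar_ideal D\<close>, and \<open>u\<close> has no trivial paths.\<close>
      have arrow: "\<exists>u. elem D u \<and> h u = k (arrow_el D a) \<and> (\<forall>p. u p \<noteq> 0 \<longrightarrow> length (snd p) \<ge> 1)"
        if a: "a \<in> arrows D" for a
      proof -
        let ?a = "arrow_el D a :: path \<Rightarrow> 'k"
        have ea: "elem D ?a" using a wf by simp
        obtain u where u: "elem D u" "h u = k ?a" using im(2)[OF ea] by metis
        have "pmult D ?a ?a = 0" using star_edge[OF D a] by (auto simp: arrow_el_eq pmult_pel)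
        then have "k ?a * k ?a = 0" using hom_mult[OF k ea ea] hom_0[OF k] by simp
        then have "h (pmult D u u) = 0" using u hom_mult[OF h, of u u] by simp
        then have mem: "pmult D u u \<in> Istar_ideal D" using hk(1)[of "pmult D u u"] u by simp
        have "f (v, []) = 0" if "f \<in> (Istar_ideal D :: (path \<Rightarrow> 'k) set)" for f v
        proof (rule ideal_gen_trivial[OF _ that[unfolded star_Istar_ideal[OF D]]])
          fix s :: "path \<Rightarrow> 'k" and v assume "s \<in> rels D 1"
          moreover have t: "xe D (v, []) = (0 :: 'k)" "ye D (v, []) = (0 :: 'k)"
            by (simp_all add: xe_def ye_def pmult_apply arrow_el_eq pel_def)
          have z: "pmult D f g (v, []) = 0" if "f (v, []) = 0" for f g :: "path \<Rightarrow> 'k"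
            using that by (simp add: pmult_apply)
          obtain j where "qexp D = Suc j" using star_qexp(1)[OF D] by (cases "qexp D") auto
          then have "fe D (v, []) = (0 :: 'k)" using t by (simp add: fe_def z)
          moreover obtain i where "nverts D - exc_vertex D = Suc i"
            using star_qexp(2)[OF D] by (cases "nverts D - exc_vertex D") auto
          then have "ge D (v, []) = (0 :: 'k)" using t by (simp add: ge_def z plus_fun_apply)
          ultimately show "s (v, []) = 0"
            by (auto simp: rels_def mesh_rel_trivial plus_fun_apply psmult_def)
        qed
        from this[OF mem] have "u (v, []) = 0" for v by (rule ppow_trivial_zero)
        then have "length (snd p) \<ge> 1" if "u p \<noteq> 0" for p
          using that by (cases p; cases "snd p") auto
        then show ?thesis using u by blast
      qed
      have path: "\<exists>u. elem D u \<and> h u = k (pel (v, as)) \<and> (\<forall>p. u p \<noteq> 0 \<longrightarrow> length (snd p) \<ge> length as)"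
        if "chain D v as" "as \<noteq> []" for v as
        using that
      proof (induction as arbitrary: v)
        case (Cons a as)
        have a: "a \<in> arrows D" "src D a = v" using Cons.prems by auto
        obtain u where u: "elem D u" "h u = k (arrow_el D a)" "\<forall>p. u p \<noteq> 0 \<longrightarrow> length (snd p) \<ge> 1"
          using arrow[OF a(1)] by blast
        show ?case
        proof (cases "as = []")
          case True then show ?thesis using u a by (auto simp: arrow_el_eq)
        next
          case False
          have "chain D (tgt D a) as" using Cons.prems by simp
          then obtain u' where u': "elem D u'" "h u' = k (pel (tgt D a, as))" "\<forall>p. u' p \<noteq> 0 \<longrightarrow> length (snd p) \<ge> length as"
            using Cons.IH[OF _ False] by blast
          have e: "elem D (arrow_el D a :: path \<Rightarrow> 'k)" "elem D (pel (tgt D a, as) :: path \<Rightarrow> 'k)"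
            using a wf Cons.prems by (auto simp: valid_path_def arrow_less)
          have "pel (v, a # as) = pmult D (arrow_el D a) (pel (tgt D a, as) :: path \<Rightarrow> 'k)"
            using a by (simp add: arrow_el_eq pmult_pel)
          then have "h (pmult D u u') = k (pel (v, a # as))"
            using hom_mult[OF h u(1) u'(1)] hom_mult[OF k e] u(2) u'(2) by simp
          moreover have "length (snd p) \<ge> length (a # as)" if "pmult D u u' p \<noteq> 0" for p
            using pmult_support[of u 1 u' "length as" D p] u(3) u'(3) that by auto
          ultimately show ?thesis using u(1) u'(1) by (intro exI[of _ "pmult D u u'"]) auto
        qed
      qed simp
      note top = top_path_closed[OF D]
      obtain u where u: "elem D u" "h u = k (pel (0, top_path D))" "\<forall>p. u p \<noteq> 0 \<longrightarrow> length (snd p) \<ge> 4 * qexp D"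
        using path[of 0 "top_path D"] top by (auto simp: closed_path_def)
      have "elem D (pel (0, top_path D) :: path \<Rightarrow> 'k)"
        using top(1) by (auto simp: closed_path_def valid_path_def)
      then have "\<tau> u = 1" using \<tau>(2)[OF u(1) _ u(2)[symmetric]] wS_top_path[OF D S] by simp
      moreover have "\<tau> u = 0"
        using u(1)
      proof (induction u rule: elem_induct)
        case zero then show ?case by (rule trace_0[OF \<tau>(1)])
      next
        case (step c p g)
        obtain v as where p: "p = (v, as)" by force
        have "\<tau> (pel p) = 0"
          using step(1,2) u(3) star_trace_long[OF D char \<tau>(1), of v as] by (auto simp: p)
        then show ?case using step by (simp add: trace_add[OF \<tau>(1)] trace_psmult[OF \<tau>(1)])
      qed
      ultimately show False by simp
    qed
  qed
qed

theorem mainTheorem19: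
  fixes D :: dyn
  assumes "D \<in> {Dq (2 * m) | m. m \<ge> 2} \<union> {Eq 7, Eq 8} \<union> {Lq n | n. n \<ge> 2}"
  shows "quot_alg_iso D (Istar_ideal D :: (path \<Rightarrow> 'k::alg_closed_field) set) (I_ideal D)
         \<longleftrightarrow> CHAR('k) \<noteq> 2"
proof
  assume iso: "quot_alg_iso D (Istar_ideal D :: (path \<Rightarrow> 'k) set) (I_ideal D)"
  show "CHAR('k) \<noteq> 2"
  proof
    assume char: "CHAR('k) = 2"
    from assms consider "star D" | n where "n \<ge> 2" "D = Lq n" by (auto simp: star_def)
    then show False
      using iso star_not_iso[OF _ char] L_not_iso[OF _ char] by cases auto
  qed
next
  assume char: "CHAR('k) \<noteq> 2"
  have "(2 :: 'k) \<noteq> 0"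
  proof
    assume "(2 :: 'k) = 0"
    then have "of_nat 2 = (0 :: 'k)" by simp
    then have "CHAR('k) dvd 2" by (simp only: of_nat_eq_0_iff_char_dvd)
    \<comment> \<open>A characteristic dividing the prime 2 and different from it is 1, which no
      field has.\<close>
    then have "CHAR('k) = 1" using char prime_nat_iff[of 2] two_is_prime_nat by blast
    then show False using CHAR_not_1 by (metis One_nat_def)
  qed
  \<comment> \<open>The coefficient \<open>c = - 1/2\<close> carries the deformation parameter from
    1 to 0.\<close>
  then have half: "(1 :: 'k) + (- (1 / 2) + - (1 / 2)) = 0" by (simp add: field_simps)
  from assms consider "star D" | n where "n \<ge> 2" "D = Lq n" by (auto simp: star_def)
  then show "quot_alg_iso D (Istar_ideal D :: (path \<Rightarrow> 'k) set) (I_ideal D)"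
  proof cases
    case 1
    show ?thesis unfolding star_Istar_ideal[OF 1] star_I_ideal[OF 1] by (rule star_iso[OF 1 half])
  next
    case 2
    show ?thesis unfolding 2(2) L_Istar_ideal[OF 2(1)] L_I_ideal[OF 2(1)] by (rule L_iso[OF 2(1) half])
  qed
qed

end
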